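(* Let $1\le\alpha<2$ and $\beta>0$ be constants. Unless $P=NP$, there is no polynomial-time algorithm for the Fair Max-Min diversification problem that obtains an $\alpha$-approximation factor for the diversity score and $\beta$ fairness; that is, no polynomial-time algorithm that on every instance returns a set $\mathcal{S}\subseteq\mathcal{X}$ with $\mathrm{div}(\mathcal{S})\ge \ell^*/\alpha$ and $|\mathcal{S}\cap\mathcal{X}_i|\ge\beta k_i$ for all $i\in[m]$.
   Context: Fair Max-Min diversification: the input is a finite metric space $(\mathcal{X},d)$, where $\mathcal{X}=\bigcup_{i=1}^m\mathcal{X}_i$ is partitioned into $m$ disjoint groups, and non-negative integers $k_1,\dots,k_m$ with $k_i\le|\mathcal{X}_i|$. For $\mathcal{S}\subseteq\mathcal{X}$ let $\mathrm{div}(\mathcal{S})=\min_{u,v\in\mathcal{S},u\ne v}d(u,v)$ (the minimum over the empty set is $+\infty$). The optimal diversity is $\ell^*=\max\{\mathrm{div}(\mathcal{S}):\mathcal{S}\subseteq\mathcal{X},\ |\mathcal{S}\cap\mathcal{X}_i|=k_i\ \forall i\in[m]\}$. *)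

theory Defs
  imports "HOL-Analysis.Analysis" "HOL-Computational_Algebra.Polynomial"
begin

section \<open>Deterministic multi-tape Turing machines\<close>

text \<open>
  Tapes are infinite in both directions and are described relative to the head: cell 0 is the
  cell under the head, so that moving the head to the right shifts the contents to the left.
  State 0 is the start state, state 1 is the halting state; symbol 0 is the blank, symbols 1 and 2
  are the bits. Of the transition function only the finite part constrained by \<open>wf_tm\<close>
  is ever used.
\<close>

type_synonym tape = "int \<Rightarrow> nat"

datatype move = Go_Left | Stay | Go_Right

record tm =
  num_tapes :: nat
  num_states :: nat
  num_symbols :: nat
  delta :: "nat \<Rightarrow> nat list \<Rightarrow> nat \<times> (nat \<times> move) list"

definition wf_tm :: "tm \<Rightarrow> bool" where
  "wf_tm M \<longleftrightarrow>
     1 \<le> num_tapes M \<and> 2 \<le> num_states M \<and> 3 \<le> num_symbols M \<and>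
     (\<forall>q rs. q < num_states M \<and> length rs = num_tapes M \<and> set rs \<subseteq> {..<num_symbols M} \<longrightarrow>
       (case delta M q rs of (q', as) \<Rightarrow>
          q' < num_states M \<and> length as = num_tapes M \<and> fst ` set as \<subseteq> {..<num_symbols M}))"

fun offset :: "move \<Rightarrow> int" where
  "offset Go_Left = -1"
| "offset Stay = 0"
| "offset Go_Right = 1"

definition act :: "nat \<times> move \<Rightarrow> tape \<Rightarrow> tape" where
  "act a t = (\<lambda>i. (t(0 := fst a)) (i + offset (snd a)))"

definition step :: "tm \<Rightarrow> nat \<times> tape list \<Rightarrow> nat \<times> tape list" where
  "step M c =
     (if fst c = 1 then c
      else let (q', as) = delta M (fst c) (map (\<lambda>t. t 0) (snd c))
           in (q', map2 act as (snd c)))"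

definition bit_symbol :: "bool \<Rightarrow> nat" where
  "bit_symbol b = (if b then 2 else 1)"

definition input_tape :: "bool list \<Rightarrow> tape" where
  "input_tape x = (\<lambda>i. if 0 \<le> i \<and> i < int (length x) then bit_symbol (x ! nat i) else 0)"

definition init :: "tm \<Rightarrow> bool list \<Rightarrow> nat \<times> tape list" where
  "init M x = (0, input_tape x # replicate (num_tapes M - 1) (\<lambda>_. 0))"

text \<open>The output is the string on the first tape from the head up to the first blank.\<close>

definition output_is :: "tape \<Rightarrow> bool list \<Rightarrow> bool" where
  "output_is t w \<longleftrightarrow>
     (\<forall>i<length w. t (int i) = bit_symbol (w ! i)) \<and> t (int (length w)) = 0"

definition computes_within :: "tm \<Rightarrow> bool list \<Rightarrow> bool list \<Rightarrow> nat \<Rightarrow> bool" where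
  "computes_within M x w n \<longleftrightarrow>
     (case (step M ^^ n) (init M x) of (q, ts) \<Rightarrow> q = 1 \<and> output_is (hd ts) w)"


section \<open>The classes P and NP\<close>

definition class_P :: "bool list set set" where
  "class_P = {L. \<exists>M (p :: nat poly). wf_tm M \<and>
     (\<forall>x. computes_within M x [x \<in> L] (poly p (length x)))}"

text \<open>Prefix-free coding: every bit is preceded by a continuation bit.\<close>

definition self_delimiting :: "bool list \<Rightarrow> bool list" where
  "self_delimiting x = concat (map (\<lambda>b. [True, b]) x) @ [False]"

definition encode_pair :: "bool list \<Rightarrow> bool list \<Rightarrow> bool list" where
  "encode_pair x y = self_delimiting x @ y"

definition class_NP :: "bool list set set" where
  "class_NP = {L. \<exists>V\<in>class_P. \<exists>p :: nat poly. \<forall>x.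
     x \<in> L \<longleftrightarrow> (\<exists>y. length y \<le> poly p (length x) \<and> encode_pair x y \<in> V)}"


section \<open>Fair Max-Min diversification\<close>

text \<open>
  An instance with $n$ points and $m$ groups: the points are the numbers below $n$, the groups are
  numbered from $0$ to $m - 1$, and \<open>group_of\<close> lists the group of each point. Distances
  are rational so that instances are finite objects.
\<close>

record fmm =
  group_of :: "nat list"
  demand :: "nat list"
  dist_matrix :: "rat list list"

definition points :: "fmm \<Rightarrow> nat set" where
  "points I = {..<length (group_of I)}"

definition num_groups :: "fmm \<Rightarrow> nat" where
  "num_groups I = length (demand I)"

definition members :: "fmm \<Rightarrow> nat \<Rightarrow> nat set" where
  "members I i = {u \<in> points I. group_of I ! u = i}"

definition distance :: "fmm \<Rightarrow> nat \<Rightarrow> nat \<Rightarrow> real" where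
  "distance I u v =
     (if u \<in> points I \<and> v \<in> points I then real_of_rat (dist_matrix I ! u ! v) else 0)"

definition valid :: "fmm \<Rightarrow> bool" where
  "valid I \<longleftrightarrow>
     length (dist_matrix I) = length (group_of I) \<and>
     (\<forall>r\<in>set (dist_matrix I). length r = length (group_of I)) \<and>
     Metric_space (points I) (distance I) \<and>
     (\<forall>g\<in>set (group_of I). g < num_groups I) \<and>
     (\<forall>i<num_groups I. members I i \<noteq> {} \<and> demand I ! i \<le> card (members I i))"

definition diversity :: "fmm \<Rightarrow> nat set \<Rightarrow> ereal" where
  "diversity I S = (INF (u, v)\<in>{(u, v). u \<in> S \<and> v \<in> S \<and> u \<noteq> v}. ereal (distance I u v))"

definition feasible :: "fmm \<Rightarrow> nat set \<Rightarrow> bool" where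
  "feasible I S \<longleftrightarrow>
     S \<subseteq> points I \<and> (\<forall>i<num_groups I. card (S \<inter> members I i) = demand I ! i)"

text \<open>For valid instances the maximum ranges over a finite nonempty set.\<close>

definition opt_diversity :: "fmm \<Rightarrow> ereal" where
  "opt_diversity I = Max (diversity I ` {S. feasible I S})"


section \<open>Polynomial-time approximation algorithms\<close>

text \<open>Binary digits, least significant first.\<close>

fun binary :: "nat \<Rightarrow> bool list" where
  "binary n = (if n = 0 then [] else odd n # binary (n div 2))"

declare binary.simps [simp del]

definition encode_nats :: "nat list \<Rightarrow> bool list" where
  "encode_nats ns = concat (map (\<lambda>n. self_delimiting (binary n)) ns)"

text \<open>Numerator and denominator in lowest terms; only used for nonnegative numbers.\<close>

definition rat_code :: "rat \<Rightarrow> nat list" where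
  "rat_code r = (case quotient_of r of (a, b) \<Rightarrow> [nat a, nat b])"

definition encode_fmm :: "fmm \<Rightarrow> bool list" where
  "encode_fmm I = encode_nats
     ([length (group_of I), num_groups I] @ group_of I @ demand I @
      concat (map rat_code (concat (dist_matrix I))))"

definition encode_subset :: "fmm \<Rightarrow> nat set \<Rightarrow> bool list" where
  "encode_subset I S = map (\<lambda>u. u \<in> S) [0..<length (group_of I)]"

definition poly_time_fair_approx :: "real \<Rightarrow> real \<Rightarrow> tm \<Rightarrow> bool" where
  "poly_time_fair_approx \<alpha> \<beta> M \<longleftrightarrow> wf_tm M \<and>
     (\<exists>p :: nat poly. \<forall>I. valid I \<longrightarrow>
       (\<exists>S. S \<subseteq> points I \<and>
          computes_within M (encode_fmm I) (encode_subset I S) (poly p (length (encode_fmm I))) \<and>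
          diversity I S \<ge> opt_diversity I / ereal \<alpha> \<and>
          (\<forall>i<num_groups I. real (card (S \<inter> members I i)) \<ge> \<beta> * real (demand I ! i))))"

end

theory Submission
  imports Defs
begin

text \<open>
  An approximation algorithm is turned into a decision procedure for an arbitrary language \<open>L\<close> in NP.
  The accepting runs of a verifier are tableaux whose cells take values in a finite set that depends on
  the verifier only. As every cell also records the state and the symbols under the heads, being a
  tableau is a conjunction of unary and binary constraints. The instance for \<open>x\<close> has a group of demand 1
  for every cell and a point for every value of the cell; two points have distance 2 if they satisfy all
  constraints and distance 1 otherwise. If \<open>x \<in> L\<close>, the optimum is at least 2, and since \<open>\<alpha> < 2\<close> and
  \<open>\<beta> > 0\<close>, the algorithm returns a set that meets every group and contains no two points at
  distance 1. Conversely, such a set yields a tableau.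

  The Turing machine that prints the instance, runs the algorithm and checks its answer is obtained from
  a language of loop programs in which every program takes polynomial time.
\<close>


section \<open>Structured programs over tapes\<close>

text \<open>Hardness has to start from an arbitrary verifier, since P and NP are given by Turing
  machines, and a diversity is a minimum over pairs, so distances can express nothing but binary
  constraints. The usual local rule of a tableau relates a cell to several cells of the previous
  row; the state and read symbols copied into every cell avoid this. The values 1 and 2 have the
  largest ratio for which every symmetric choice of distances is a metric, and this ratio is the
  origin of the bound \<alpha> < 2. The machine never compares the answer with the optimum: it looks
  for a pair at distance 1 in the returned set. That set may contain several points of a group, and
  which admissible set is returned has no influence on the verdict. A concrete machine with a proved
  time bound is required, hence two languages: \<open>com\<close>, whose steps are those of a
  machine with the rest of the program as its state, and \<open>lp\<close>, in which the printer and
  the checker are written and where polynomial time comes for free.\<close>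

datatype com =
  Skip
| Prim nat "nat \<Rightarrow> nat \<times> move"
| Seq com com
| Branch nat com com com
| While nat com
| Run tm nat nat

definition stay :: "(nat \<Rightarrow> nat) \<Rightarrow> nat \<Rightarrow> nat \<times> move" where
  "stay h r = (h r, Stay)"

text \<open>Only the symbols \<open>h\<close> under the heads enter, so this has the shape of a
  transition function with the remaining program in the role of the state. For the same reason
  \<open>Run M b q\<close> carries the current state \<open>q\<close> of the embedded machine, which
  works on the tapes from \<open>b\<close> on.\<close>

fun trans :: "com \<Rightarrow> (nat \<Rightarrow> nat) \<Rightarrow> com \<times> (nat \<Rightarrow> nat \<times> move)" where
  "trans Skip h = (Skip, stay h)"
| "trans (Prim r f) h = (Skip, (stay h)(r := f (h r)))"
| "trans (Seq c d) h = (if c = Skip then (d, stay h) else (Seq (fst (trans c h)) d, snd (trans c h)))"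
| "trans (Branch r c0 c1 c2) h = (if h r = 0 then c0 else if h r = 1 then c1 else c2, stay h)"
| "trans (While r c) h = (if h r = 0 then Skip else Seq c (While r c), stay h)"
| "trans (Run M b q) h =
    (if q = 1 then (Skip, stay h)
     else (Run M b (fst (delta M q (map h [b..<b + num_tapes M]))),
       \<lambda>r. if b \<le> r \<and> r < b + num_tapes M
           then snd (delta M q (map h [b..<b + num_tapes M])) ! (r - b) else stay h r))"

definition cstep :: "com \<times> (nat \<Rightarrow> tape) \<Rightarrow> com \<times> (nat \<Rightarrow> tape)" where
  "cstep s = (fst (trans (fst s) (\<lambda>r. snd s r 0)),
     \<lambda>r. act (snd (trans (fst s) (\<lambda>r. snd s r 0)) r) (snd s r))"

definition exec :: "com \<Rightarrow> (nat \<Rightarrow> tape) \<Rightarrow> nat \<Rightarrow> (nat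
  \<Rightarrow> tape) \<Rightarrow> bool" where
  "exec c \<sigma> n \<sigma>' \<longleftrightarrow> (\<exists>m\<le>n. (cstep ^^ m) (c, \<sigma>) = (Skip, \<sigma>'))"

lemma act_stay [simp]: "act (stay h r) t = t" if "h r = t 0"
  using that by (auto simp: act_def stay_def fun_eq_iff)

lemma cstep_simps [simp]:
  "cstep (Skip, \<sigma>) = (Skip, \<sigma>)"
  "cstep (Prim r f, \<sigma>) = (Skip, \<sigma>(r := act (f (\<sigma> r 0)) (\<sigma> r)))"
  "cstep (Seq Skip d, \<sigma>) = (d, \<sigma>)"
  "c \<noteq> Skip \<Longrightarrow> cstep (Seq c d, \<sigma>) = (Seq (fst (cstep (c, \<sigma>))) d, snd (cstep (c, \<sigma>)))"
  "cstep (Branch r c0 c1 c2, \<sigma>) = (if \<sigma> r 0 = 0 then c0 else if \<sigma> r 0 = 1 then c1 else c2, \<sigma>)"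
  "cstep (While r c, \<sigma>) = (if \<sigma> r 0 = 0 then Skip else Seq c (While r c), \<sigma>)"
  by (auto simp: cstep_def fun_eq_iff)

lemma cstep_Skip_pow [simp]: "(cstep ^^ n) (Skip, \<sigma>) = (Skip, \<sigma>)"
  by (induction n) auto

text \<open>\<open>Skip\<close> is a fixed point of \<open>cstep\<close>, so a run that ends within
  \<open>n\<close> steps is still in its final configuration after exactly \<open>n\<close>. Time
  bounds can therefore be relaxed freely.\<close>

lemma exec_alt: "exec c \<sigma> n \<sigma>' \<longleftrightarrow> (cstep ^^ n) (c, \<sigma>) = (Skip, \<sigma>')"
proof
  assume "exec c \<sigma> n \<sigma>'"
  then obtain m where m: "m \<le> n" "(cstep ^^ m) (c, \<sigma>) = (Skip, \<sigma>')"
    by (auto simp: exec_def)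
  have "(cstep ^^ n) (c, \<sigma>) = (cstep ^^ (n - m)) ((cstep ^^ m) (c, \<sigma>))"
    using m(1) by (metis funpow_add comp_apply le_add_diff_inverse2)
  then show "(cstep ^^ n) (c, \<sigma>) = (Skip, \<sigma>')" by (simp add: m)
qed (auto simp: exec_def)

lemma exec_mono: "exec c \<sigma> n \<sigma>' \<Longrightarrow> n \<le> m \<Longrightarrow> exec c \<sigma> m \<sigma>'"
  unfolding exec_def by (meson order_trans)

lemma exec_Suc: "exec (fst (cstep (c, \<sigma>))) (snd (cstep (c, \<sigma>))) n \<sigma>' \<Longrightarrow>
  exec c \<sigma> (Suc n) \<sigma>'"
  unfolding exec_alt by (simp add: funpow_swap1)

lemma exec_Skip [intro]: "exec Skip \<sigma> n \<sigma>"
  by (simp add: exec_alt)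

lemma exec_Prim: "exec (Prim r f) \<sigma> 1 (\<sigma>(r := act (f (\<sigma> r 0)) (\<sigma> r)))"
  by (simp add: exec_alt)

lemma exec_Seq:
  assumes "exec c \<sigma> n \<sigma>1" "exec d \<sigma>1 m \<sigma>2"
  shows "exec (Seq c d) \<sigma> (n + m + 1) \<sigma>2"
  using assms(1)
proof (induction n arbitrary: c \<sigma>)
  case 0
  then have "c = Skip" "\<sigma> = \<sigma>1" by (auto simp: exec_alt)
  then show ?case using assms(2) by (auto intro!: exec_Suc)
next
  case (Suc n)
  show ?case
  proof (cases "c = Skip")
    case True
    then have "\<sigma> = \<sigma>1" using Suc.prems by (simp add: exec_alt)
    moreover have "exec (Seq c d) \<sigma> (Suc m) \<sigma>2"
      using True assms(2) \<open>\<sigma> = \<sigma>1\<close> by (auto intro!: exec_Suc)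
    ultimately show ?thesis by (auto intro: exec_mono)
  next
    case False
    have "exec (fst (cstep (c, \<sigma>))) (snd (cstep (c, \<sigma>))) n \<sigma>1"
      using Suc.prems by (simp add: exec_alt funpow_swap1)
    from Suc.IH[OF this] have "exec (Seq c d) \<sigma> (Suc (n + m + 1)) \<sigma>2"
      using False by (intro exec_Suc) simp
    then show ?thesis by simp
  qed
qed

lemma exec_Branch:
  assumes "exec (if \<sigma> r 0 = 0 then c0 else if \<sigma> r 0 = 1 then c1 else c2) \<sigma> n \<sigma>'"
  shows "exec (Branch r c0 c1 c2) \<sigma> (n + 1) \<sigma>'"
  using exec_Suc[of "Branch r c0 c1 c2" \<sigma> n \<sigma>'] assms by simp

lemma exec_While_done: "\<sigma> r 0 = 0 \<Longrightarrow> exec (While r c) \<sigma> 1 \<sigma>"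
  by (simp add: exec_alt)

lemma exec_While_step:
  assumes "\<sigma> r 0 \<noteq> 0" "exec c \<sigma> n \<sigma>1" "exec (While r c) \<sigma>1 m \<sigma>2"
  shows "exec (While r c) \<sigma> (n + m + 2) \<sigma>2"
  using exec_Suc[of "While r c" \<sigma> "n + m + 1" \<sigma>2] exec_Seq[OF assms(2,3)] assms(1) by simp

section \<open>Embedded Turing machines\<close>

lemma wf_tm_delta:
  assumes "wf_tm M" "q < num_states M" "length rs = num_tapes M" "set rs \<subseteq> {..<num_symbols M}"
  shows "fst (delta M q rs) < num_states M" "length (snd (delta M q rs)) = num_tapes M"
    "i < num_tapes M \<Longrightarrow> fst (snd (delta M q rs) ! i) < num_symbols M"
proof -
  obtain q' as where d: "delta M q rs = (q', as)" by force
  have "q' < num_states M \<and> length as = num_tapes M \<and> fst ` set as \<subseteq> {..<num_symbols M}"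
    using assms d unfolding wf_tm_def by (elim conjE allE[of _ q] allE[of _ rs]) auto
  moreover from this have "fst (as ! i) < num_symbols M" if "i < num_tapes M"
    using that by (metis imageI lessThan_iff nth_mem subsetD)
  ultimately show "fst (delta M q rs) < num_states M" "length (snd (delta M q rs)) = num_tapes M"
    "i < num_tapes M \<Longrightarrow> fst (snd (delta M q rs) ! i) < num_symbols M"
    using d by auto
qed

text \<open>\<open>wf_tm\<close> says nothing about \<open>delta\<close> on foreign symbols, not
  even that it returns one action per tape; the bound on the symbols is therefore carried along as
  an invariant. The extra step replaces the halted \<open>Run\<close> by
  \<open>Skip\<close>.\<close>

lemma exec_Run:
  assumes wf: "wf_tm M" and q: "q < num_states M"
    and sym: "\<And>r. b \<le> r \<Longrightarrow> r < b + num_tapes M \<Longrightarrow> range (\<sigma> r)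
      \<subseteq> {..<num_symbols M}"
    and run: "(step M ^^ n) (q, map \<sigma> [b..<b + num_tapes M]) = (1, ts)"
  shows "length ts = num_tapes M \<and>
    exec (Run M b q) \<sigma> (n + 1) (\<lambda>r. if b \<le> r \<and> r < b + num_tapes M then ts ! (r - b) else \<sigma> r)"
  using q sym run
proof (induction n arbitrary: q \<sigma>)
  case 0
  then have "q = 1" "ts = map \<sigma> [b..<b + num_tapes M]" by auto
  then show ?case by (auto simp: exec_alt cstep_def fun_eq_iff)
next
  case (Suc n)
  let ?k = "num_tapes M"
  show ?case
  proof (cases "q = 1")
    case True
    have "(step M ^^ m) (1, ts') = (1, ts')" for m ts'
      by (induction m) (auto simp: step_def)
    then have "ts = map \<sigma> [b..<b + num_tapes M]"
      using Suc.prems(3) True by (metis prod.inject)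
    then have "length ts = ?k" "exec (Run M b q) \<sigma> 1 (\<lambda>r. if b \<le> r \<and> r < b + ?k then ts
      ! (r - b) else \<sigma> r)"
      using True by (auto simp: exec_alt cstep_def fun_eq_iff)
    then show ?thesis by (auto intro: exec_mono)
  next
    case False
    let ?rs = "map (\<lambda>r. \<sigma> r 0) [b..<b + ?k]"
    obtain q' as where d: "delta M q ?rs = (q', as)" by force
    have "set ?rs \<subseteq> {..<num_symbols M}" using Suc.prems(2) by fastforce
    then have w: "q' < num_states M" "length as = ?k" "\<And>i. i < ?k \<Longrightarrow> fst (as ! i) < num_symbols M"
      using wf_tm_delta[OF wf Suc.prems(1), of ?rs] d by auto
    define \<sigma>1 where "\<sigma>1 = (\<lambda>r. if b \<le> r \<and> r < b + ?k then act (as ! (r - b))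
      (\<sigma> r) else \<sigma> r)"
    have cs: "cstep (Run M b q, \<sigma>) = (Run M b q', \<sigma>1)"
      using False d by (auto simp: cstep_def fun_eq_iff \<sigma>1_def)
    have "map (\<lambda>t. t 0) (map \<sigma> [b..<b + ?k]) = ?rs" by simp
    then have st: "step M (q, map \<sigma> [b..<b + ?k]) = (q', map \<sigma>1 [b..<b + ?k])"
      using False d w(2) by (auto simp: step_def \<sigma>1_def comp_def intro!: nth_equalityI)
    have "\<And>r. b \<le> r \<Longrightarrow> r < b + ?k \<Longrightarrow> range (\<sigma>1 r) \<subseteq> {..<num_symbols M}"
    proof -
      fix r assume r: "b \<le> r" "r < b + ?k"
      have "fst (as ! (r - b)) < num_symbols M" using w(3) r by auto
      then show "range (\<sigma>1 r) \<subseteq> {..<num_symbols M}"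
        using Suc.prems(2)[OF r] r by (auto simp: \<sigma>1_def act_def)
    qed
    moreover have "(step M ^^ n) (q', map \<sigma>1 [b..<b + ?k]) = (1, ts)"
      using Suc.prems(3) st by (simp add: funpow_swap1)
    ultimately have "length ts = ?k"
      and ex: "exec (Run M b q') \<sigma>1 (n + 1) (\<lambda>r. if b \<le> r \<and> r < b + ?k then ts ! (r -
        b) else \<sigma>1 r)"
      using Suc.IH[OF w(1)] by auto
    moreover have "(\<lambda>r. if b \<le> r \<and> r < b + ?k then ts ! (r - b) else \<sigma>1 r)
        = (\<lambda>r. if b \<le> r \<and> r < b + ?k then ts ! (r - b) else \<sigma> r)"
      by (auto simp: \<sigma>1_def fun_eq_iff)
    ultimately show ?thesis using exec_Suc[of "Run M b q" \<sigma>] cs by simp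
  qed
qed

subsection \<open>Translation to Turing machines\<close>

text \<open>An embedded machine must have exactly the alphabet \<open>G\<close>: a larger one could
  write symbols outside \<open>G\<close>, a smaller one could meet symbols on which its
  \<open>delta\<close> is unconstrained.\<close>

fun wf_com :: "nat \<Rightarrow> nat \<Rightarrow> com \<Rightarrow> bool" where
  "wf_com K G Skip \<longleftrightarrow> True"
| "wf_com K G (Prim r f) \<longleftrightarrow> r < K \<and> (\<forall>s<G. fst (f s) < G)"
| "wf_com K G (Seq c d) \<longleftrightarrow> wf_com K G c \<and> wf_com K G d"
| "wf_com K G (Branch r c0 c1 c2) \<longleftrightarrow> r < K \<and> wf_com K G c0 \<and> wf_com K G c1 \<and> wf_com K G c2"
| "wf_com K G (While r c) \<longleftrightarrow> r < K \<and> wf_com K G c"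
| "wf_com K G (Run M b q) \<longleftrightarrow> wf_tm M \<and> b + num_tapes M \<le> K \<and> num_symbols M = G
  \<and> q < num_states M"

text \<open>The state of the Turing machine is the rest of the program.\<close>

fun reach :: "com \<Rightarrow> com set" where
  "reach Skip = {Skip}"
| "reach (Prim r f) = {Prim r f, Skip}"
| "reach (Seq c d) = (\<lambda>c'. Seq c' d) ` reach c \<union> reach d"
| "reach (Branch r c0 c1 c2) = {Branch r c0 c1 c2} \<union> reach c0 \<union> reach c1 \<union> reach c2"
| "reach (While r c) = {While r c, Skip} \<union> (\<lambda>c'. Seq c' (While r c)) ` reach c"
| "reach (Run M b q) = {Skip} \<union> Run M b ` {..<num_states M}"

lemma finite_reach: "finite (reach c)"
  by (induction c) auto

lemma reach_self: "wf_com K G c \<Longrightarrow> c \<in> reach c"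
  by (induction c) auto

lemma Skip_reach: "Skip \<in> reach c"
  by (induction c) auto

lemma reach_wf:
  assumes "wf_com K G c" "c' \<in> reach c"
  shows "wf_com K G c'"
proof -
  define ok where "ok c \<longleftrightarrow> (\<forall>c'\<in>reach c. wf_com K G c')" for c
  have "wf_com K G c \<Longrightarrow> ok c" for c
  proof (induction c)
    case (Seq c d)
    then have "ok c" "ok d" "wf_com K G d" by auto
    then show ?case by (auto simp: ok_def)
  next
    case (Branch r c0 c1 c2)
    then have "ok c0" "ok c1" "ok c2" by auto
    then show ?case using Branch.prems by (auto simp: ok_def)
  next
    case (While r c)
    then have "ok c" by auto
    then show ?case using While.prems by (auto simp: ok_def)
  qed (auto simp: ok_def)
  then show ?thesis using assms by (auto simp: ok_def)
qed

lemma trans_wf: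
  assumes "wf_com K G c" "\<And>r. r < K \<Longrightarrow> h r < G"
  shows "r < K \<Longrightarrow> fst (snd (trans c h) r) < G"
  using assms(1)
proof (induction c)
  case (Run M b q)
  let ?d = "delta M q (map h [b..<b + num_tapes M])"
  show ?case
  proof (cases "b \<le> r \<and> r < b + num_tapes M \<and> q \<noteq> 1")
    case True
    have s: "set (map h [b..<b + num_tapes M]) \<subseteq> {..<num_symbols M}"
      using Run.prems assms(2) by auto
    have "fst (snd ?d ! (r - b)) < num_symbols M"
      using wf_tm_delta(3)[OF _ _ _ s] Run.prems True by auto
    then show ?thesis using True Run.prems by simp
  next
    case False
    then show ?thesis using Run.prems assms(2) by (auto simp: stay_def)
  qed
qed (use assms(2) in \<open>auto simp: stay_def\<close>)

lemma trans_reach: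
  assumes "wf_com K G c" "c' \<in> reach c" "\<And>r. r < K \<Longrightarrow> h r < G"
  shows "fst (trans c' h) \<in> reach c"
  using assms(1,2)
proof (induction c arbitrary: c')
  case (Seq c d)
  show ?case
  proof (cases "c' \<in> reach d")
    case False
    then obtain c'' where "c' = Seq c'' d" "c'' \<in> reach c" using Seq.prems by auto
    then show ?thesis using Seq.IH(1)[of c''] Seq.prems reach_self[of K G d] by auto
  qed (use Seq.IH(2)[of c'] Seq.prems in auto)
next
  case (Branch r c0 c1 c2)
  then consider "c' = Branch r c0 c1 c2" | "c' \<in> reach c0" | "c' \<in> reach c1" | "c' \<in> reach c2" by auto
  then show ?case
  proof cases
    case 1
    then show ?thesis using Branch.prems reach_self[of K G c0] reach_self[of K G c1] reach_self[of K G c2]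
      by auto
  qed (use Branch.IH(1)[of c'] Branch.IH(2)[of c'] Branch.IH(3)[of c'] Branch.prems in auto)
next
  case (While r c)
  then consider "c' = While r c" | "c' = Skip" | c'' where "c'' \<in> reach c" "c' = Seq c'' (While r c)"
    by auto
  then show ?case
    by cases (use While.IH While.prems reach_self[of K G c] in auto)
next
  case (Run M b q)
  have "fst (delta M q' (map h [b..<b + num_tapes M])) < num_states M" if "q' < num_states M" for q'
  proof -
    have s: "set (map h [b..<b + num_tapes M]) \<subseteq> {..<num_symbols M}"
      using Run.prems assms(3) by auto
    then show ?thesis using wf_tm_delta(1)[OF _ that _ s] Run.prems by auto
  qed
  then show ?case using Run.prems by (auto split: if_splits)
qed auto

text \<open>The machine built from a program knows the symbols under the heads only as a list of
  length \<open>K\<close>; \<open>nth\<close> of this list agrees with the true head symbols below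
  \<open>K\<close> and is arbitrary beyond.\<close>

lemma trans_cong:
  assumes "wf_com K G c" "\<And>r. r < K \<Longrightarrow> h r = h' r"
  shows "fst (trans c h) = fst (trans c h') \<and> (\<forall>r<K. snd (trans c h) r = snd (trans c h') r)"
  using assms(1)
proof (induction c)
  case (Run M b q)
  then have "map h [b..<b + num_tapes M] = map h' [b..<b + num_tapes M]"
    using assms(2) by auto
  then show ?case using assms(2) by (simp add: stay_def del: map_eq_conv)
qed (use assms(2) in \<open>auto simp: stay_def\<close>)

text \<open>States are numbers with 0 as start and 1 as halting state, so the enumeration of
  programs has to place the whole program at 0 and \<open>Skip\<close> at 1.\<close>

lemma enum_two:
  assumes "finite A" "a \<in> A" "b \<in> A" "a \<noteq> b"
  obtains f :: "nat \<Rightarrow> 'a" where "bij_betw f {..<card A} A" "f 0 = a" "f 1 = b" "2 \<le> card A"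
proof -
  obtain xs where xs: "set xs = A - {a, b}" "distinct xs"
    using finite_distinct_list[of "A - {a, b}"] assms by auto
  let ?ys = "a # b # xs"
  have s: "set ?ys = A" using xs assms by auto
  have d: "distinct ?ys" using xs assms by auto
  have c: "card A = length ?ys" using s d distinct_card by metis
  have "bij_betw (nth ?ys) {..<card A} A"
    using bij_betw_nth[OF d] s c by auto
  then show thesis using that c by auto
qed

text \<open>The finitely many programs in \<open>reach c\<close> serve as states. One step of the
  machine is one \<open>cstep\<close>, so the time bound is carried over unchanged.\<close>

lemma tm_of_com:
  assumes wf: "wf_com K G c" and K: "1 \<le> K" and G: "3 \<le> G" and c: "c \<noteq> Skip"
  obtains M where "wf_tm M"
    "\<And>x n \<sigma>' w. exec c ((\<lambda>_. input_tape [])(0 := input_tape x)) n \<sigma>'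
      \<Longrightarrow> output_is (\<sigma>' 0) w \<Longrightarrow>
       computes_within M x w n"
proof -
  obtain f where f: "bij_betw f {..<card (reach c)} (reach c)" "f 0 = c" "f 1 = Skip" "2 \<le> card (reach c)"
    using enum_two[OF finite_reach reach_self[OF wf] Skip_reach c] by metis
  define g where "g = inv_into {..<card (reach c)} f"
  have gf: "g (f q) = q" if "q < card (reach c)" for q
    using f(1) that by (simp add: g_def bij_betw_inv_into_left)
  have fg: "f (g c') = c'" and glt: "g c' < card (reach c)" if "c' \<in> reach c" for c'
    using f(1) that bij_betw_inv_into_right[OF f(1)] bij_betw_inv_into[OF f(1)]
    by (auto simp: g_def bij_betw_def)
  have fr: "f q \<in> reach c" if "q < card (reach c)" for q
    using f(1) that by (auto simp: bij_betw_def)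
  have g0: "g c = 0" and g1: "g Skip = 1" using gf[of 0] gf[of 1] f(2-) by auto
  define M where "M = \<lparr>num_tapes = K, num_states = card (reach c), num_symbols = G,
    delta = (\<lambda>q rs. (g (fst (trans (f q) (nth rs))), map (snd (trans (f q) (nth rs))) [0..<K]))\<rparr>"
  have M: "num_tapes M = K" "num_states M = card (reach c)" "num_symbols M = G"
    "\<And>q rs. delta M q rs = (g (fst (trans (f q) (nth rs))), map (snd (trans (f q) (nth rs))) [0..<K])"
    by (auto simp: M_def)
  have wfM: "wf_tm M"
    unfolding wf_tm_def
  proof (intro conjI allI impI)
    fix q rs assume a: "q < num_states M \<and> length rs = num_tapes M \<and> set rs \<subseteq> {..<num_symbols M}"
    then have h: "rs ! r < G" if "r < K" for r
      using that M(1,3) nth_mem[of r rs] by (metis lessThan_iff subset_iff)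
    have r: "f q \<in> reach c" using fr a M by auto
    then have "fst (trans (f q) (nth rs)) \<in> reach c" using trans_reach[OF wf _ h] by auto
    moreover have "fst (snd (trans (f q) (nth rs)) r) < G" if "r < K" for r
      using trans_wf[OF reach_wf[OF wf r] h that] .
    ultimately show "case delta M q rs of (q', as) \<Rightarrow>
      q' < num_states M \<and> length as = num_tapes M \<and> fst ` set as \<subseteq> {..<num_symbols M}"
      using glt M by auto
  qed (use M K G f in auto)
  define I where "I c' \<sigma> \<longleftrightarrow> c' \<in> reach c \<and> (\<forall>r<K. range (\<sigma> r)
    \<subseteq> {..<G})" for c' and \<sigma> :: "nat \<Rightarrow> tape"
  have stp: "step M (g c', map \<sigma> [0..<K]) = (g (fst (cstep (c', \<sigma>))), map (snd (cstep (c', \<sigma>))) [0..<K])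
      \<and> I (fst (cstep (c', \<sigma>))) (snd (cstep (c', \<sigma>)))" if "I c' \<sigma>" for c' \<sigma>
  proof -
    let ?h = "\<lambda>r. \<sigma> r 0" and ?rs = "map (\<lambda>t. t 0) (map \<sigma> [0..<K])"
    have h: "?h r < G" if "r < K" for r using \<open>I c' \<sigma>\<close> that by (force simp: I_def)
    have r: "c' \<in> reach c" using that by (auto simp: I_def)
    note w = reach_wf[OF wf r]
    have tc: "fst (trans c' (nth ?rs)) = fst (trans c' ?h)"
        "\<And>r. r < K \<Longrightarrow> snd (trans c' (nth ?rs)) r = snd (trans c' ?h) r"
      using trans_cong[OF w, of "nth ?rs" ?h] by auto
    have I': "I (fst (cstep (c', \<sigma>))) (snd (cstep (c', \<sigma>)))"
    proof -
      have "range (act (snd (trans c' ?h) r) (\<sigma> r)) \<subseteq> {..<G}" if "r < K" for r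
      proof -
        have "\<sigma> r i < G" for i using \<open>I c' \<sigma>\<close> that by (auto simp: I_def)
        then show ?thesis using trans_wf[OF w h that] by (auto simp: act_def)
      qed
      then show ?thesis using trans_reach[OF wf r h] by (auto simp: I_def cstep_def)
    qed
    show ?thesis
    proof (cases "c' = Skip")
      case True
      then show ?thesis using that g1 by (simp add: step_def)
    next
      case False
      then have "g c' \<noteq> 1" using fg[OF r] f(3) by metis
      then have "step M (g c', map \<sigma> [0..<K]) =
        (g (fst (trans c' (nth ?rs))), map2 act (map (snd (trans c' (nth ?rs))) [0..<K]) (map \<sigma> [0..<K]))"
        by (simp add: step_def M fg[OF r])
      also have "\<dots> = (g (fst (cstep (c', \<sigma>))), map (snd (cstep (c', \<sigma>))) [0..<K])"
        using tc by (auto simp: cstep_def intro!: nth_equalityI)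
      finally show ?thesis using I' by simp
    qed
  qed
  have run: "(step M ^^ n) (g c', map \<sigma> [0..<K]) =
      (case (cstep ^^ n) (c', \<sigma>) of (d, \<tau>) \<Rightarrow> (g d, map \<tau> [0..<K]))" if "I c'
        \<sigma>" for n c' \<sigma>
    using that
  proof (induction n arbitrary: c' \<sigma>)
    case (Suc n)
    obtain c1 \<sigma>1 where s: "cstep (c', \<sigma>) = (c1, \<sigma>1)" by force
    show ?case using stp[OF Suc.prems] Suc.IH[of c1 \<sigma>1]
      by (simp add: s funpow_Suc_right del: funpow.simps)
  qed simp
  show thesis
  proof (rule that[OF wfM])
    fix x n \<sigma>' w
    let ?s = "(\<lambda>_. input_tape [])(0 := input_tape x)"
    assume e: "exec c ?s n \<sigma>'" and o: "output_is (\<sigma>' 0) w"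
    have "I c ?s" using reach_self[OF wf] G by (auto simp: I_def input_tape_def bit_symbol_def)
    from run[OF this, of n] e have "(step M ^^ n) (0, map ?s [0..<K]) = (1, map \<sigma>' [0..<K])"
      by (simp add: exec_alt g0 g1)
    moreover have "map ?s [0..<K] = input_tape x # replicate (K - 1) (\<lambda>_. 0)"
      using K by (auto simp: nth_Cons' input_tape_def intro!: nth_equalityI)
    moreover have "hd (map \<sigma>' [0..<K]) = \<sigma>' 0" using K by (simp add: upt_conv_Cons)
    ultimately show "computes_within M x w n"
      using o by (simp add: computes_within_def init_def M)
  qed
qed

subsection \<open>Tapes as stacks\<close>

abbreviation stk :: "bool list \<Rightarrow> tape" where
  "stk \<equiv> input_tape"

lemma bit_symbol_simps [simp]: "bit_symbol True = 2" "bit_symbol False = 1"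
  by (auto simp: bit_symbol_def)

lemma stk_0 [simp]: "stk [] 0 = 0" "stk (b # w) 0 = bit_symbol b"
  by (auto simp: input_tape_def)

lemma stk_Cons: "stk (b # w) i = (if i = 0 then bit_symbol b else stk w (i - 1))"
  by (auto simp: input_tape_def nth_Cons nat_diff_distrib split: nat.splits)

lemma stk_neg: "i < 0 \<Longrightarrow> stk w i = 0"
  by (auto simp: input_tape_def)

text \<open>The top cell is blanked before the head leaves it. Hence all cells to the left of the
  head stay blank and the tape is again a stack.\<close>

lemma act_pop [simp]: "act (0, Go_Right) (stk w) = stk (tl w)"
  by (cases w) (auto simp: act_def fun_eq_iff stk_Cons stk_neg input_tape_def[of "[]"])

lemma act_push [simp]: "act (bit_symbol b, Stay) (act (stk w 0, Go_Left) (stk w)) = stk (b # w)"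
  by (auto simp: act_def fun_eq_iff stk_Cons)

definition Push :: "nat \<Rightarrow> bool \<Rightarrow> com" where
  "Push r b = Seq (Prim r (\<lambda>s. (s, Go_Left))) (Prim r (\<lambda>_. (bit_symbol b, Stay)))"

definition Pop :: "nat \<Rightarrow> com" where
  "Pop r = Prim r (\<lambda>_. (0, Go_Right))"

definition Loop :: "nat \<Rightarrow> com \<Rightarrow> com \<Rightarrow> com" where
  "Loop u cF cT = While u (Branch u Skip (Seq (Pop u) cF) (Seq (Pop u) cT))"

lemma exec_eq: "exec c \<sigma> n \<sigma>' \<Longrightarrow> \<sigma>' = \<sigma>'' \<Longrightarrow> n \<le>
  m \<Longrightarrow> exec c \<sigma> m \<sigma>''"
  using exec_mono by blast

lemma exec_Push: "\<sigma> r = stk w \<Longrightarrow> exec (Push r b) \<sigma> 3 (\<sigma>(r := stk (b # w)))"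
  unfolding Push_def
  by (rule exec_eq[OF exec_Seq[OF exec_Prim exec_Prim]]) auto

lemma exec_Pop: "\<sigma> r = stk w \<Longrightarrow> exec (Pop r) \<sigma> 1 (\<sigma>(r := stk (tl w)))"
  unfolding Pop_def by (rule exec_eq[OF exec_Prim]) auto

lemma exec_Branch_stk:
  assumes "\<sigma> r = stk w" "exec (case w of [] \<Rightarrow> c0 | b # _ \<Rightarrow> if b then c2 else c1)
    \<sigma> n \<sigma>'"
  shows "exec (Branch r c0 c1 c2) \<sigma> (n + 1) \<sigma>'"
  by (rule exec_Branch) (use assms in \<open>auto split: list.splits if_splits\<close>)

text \<open>\<open>st zs ys\<close> is the loop invariant, with \<open>zs\<close> already consumed
  and \<open>ys\<close> still on the stack. The overhead of 5 per round consists of 2 steps for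
  \<open>While\<close> and one each for \<open>Branch\<close>, \<open>Pop\<close> and
  \<open>Seq\<close>.\<close>

lemma exec_Loop:
  assumes st: "\<And>zs ys. st zs ys u = stk ys"
    and step: "\<And>zs b ys. xs = zs @ b # ys \<Longrightarrow>
      exec (if b then cT else cF) ((st zs (b # ys))(u := stk ys)) k (st (zs @ [b]) ys)"
  shows "exec (Loop u cF cT) (st [] xs) (length xs * (k + 5) + 1) (st xs [])"
proof -
  have "exec (Loop u cF cT) (st zs ys) (length ys * (k + 5) + 1) (st (zs @ ys) [])"
    if "xs = zs @ ys" for zs ys
    using that
  proof (induction ys arbitrary: zs)
    case Nil
    then show ?case using exec_While_done[of "st zs []" u] by (simp add: Loop_def st)
  next
    case (Cons b ys)
    have pop: "exec (Pop u) (st zs (b # ys)) 1 ((st zs (b # ys))(u := stk ys))"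
      using exec_Pop[of "st zs (b # ys)" u "b # ys"] st by auto
    have "exec (Branch u Skip (Seq (Pop u) cF) (Seq (Pop u) cT)) (st zs (b # ys)) (1 + k + 1 + 1) (st (zs @ [b]) ys)"
      by (rule exec_Branch_stk[where w = "b # ys"])
        (use exec_Seq[OF pop step[OF Cons.prems]] st in auto)
    moreover have "exec (Loop u cF cT) (st (zs @ [b]) ys) (length ys * (k + 5) + 1) (st (zs @ b # ys) [])"
      using Cons.IH[of "zs @ [b]"] Cons.prems by simp
    ultimately have "exec (Loop u cF cT) (st zs (b # ys)) (1 + k + 1 + 1 + (length ys * (k + 5) + 1) + 2) (st (zs @ b # ys) [])"
      unfolding Loop_def by (intro exec_While_step) (auto simp: st bit_symbol_def)
    then show ?case by (rule exec_eq) auto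
  qed
  from this[of "[]" xs] show ?thesis by simp
qed

fun splits :: "bool list \<Rightarrow> (bool \<times> bool list) list" where
  "splits [] = []"
| "splits (b # s) = (b, s) # splits s"

lemma splits_append: "splits (xs @ ys) = map (\<lambda>(b, s). (b, s @ ys)) (splits xs) @ splits ys"
  by (induction xs) auto

text \<open>The form for bodies that only add to an output stack. The body may assume that the
  remaining string is shorter than \<open>m\<close>, so one time bound in terms of \<open>m\<close>
  serves for all rounds.\<close>

lemma exec_Loop_out:
  assumes "i \<noteq> o'" "length xs \<le> m"
    and step: "\<And>b ys w. length ys < m \<Longrightarrow>
      exec (if b then cT else cF) (\<sigma>(i := stk ys, o' := stk w)) k
        (\<sigma>(i := stk ys, o' := stk (rev (f b ys) @ w)))"
  shows "exec (Loop i cF cT) (\<sigma>(i := stk xs, o' := stk w)) (length xs * (k + 5) + 1)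
    (\<sigma>(i := stk [], o' := stk (rev (concat (map (\<lambda>(b, s). f b s) (splits xs))) @ w)))"
  using assms(2)
proof (induction xs arbitrary: w)
  case Nil
  have "exec (Loop i cF cT) (\<sigma>(i := stk [], o' := stk w)) 1 (\<sigma>(i := stk [], o' := stk w))"
    unfolding Loop_def by (rule exec_While_done) (use assms(1) in simp)
  then show ?case by (rule exec_eq) (auto simp: fun_eq_iff)
next
  case (Cons b ys)
  let ?s = "\<sigma>(i := stk (b # ys), o' := stk w)" and ?w = "rev (f b ys) @ w"
  have "exec (Pop i) ?s 1 (\<sigma>(i := stk ys, o' := stk w))"
    by (rule exec_eq[OF exec_Pop[of _ _ "b # ys"]]) (use assms(1) in \<open>auto simp: fun_eq_iff\<close>)
  from exec_Seq[OF this step[where b = b]] Cons.prems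
  have "exec (Branch i Skip (Seq (Pop i) cF) (Seq (Pop i) cT)) ?s (1 + k + 1 + 1) (\<sigma>(i := stk ys, o' := stk ?w))"
    by (intro exec_Branch_stk[where w = "b # ys"]) (use assms(1) in auto)
  moreover have "exec (Loop i cF cT) (\<sigma>(i := stk ys, o' := stk ?w)) (length ys * (k + 5) + 1)
    (\<sigma>(i := stk [], o' := stk (rev (concat (map (\<lambda>(b, s). f b s) (splits ys))) @ ?w)))"
    by (rule Cons.IH) (use Cons.prems in simp)
  ultimately have "exec (Loop i cF cT) ?s (1 + k + 1 + 1 + (length ys * (k + 5) + 1) + 2)
    (\<sigma>(i := stk [], o' := stk (rev (concat (map (\<lambda>(b, s). f b s) (splits ys))) @ ?w)))"
    unfolding Loop_def by (intro exec_While_step) (use assms(1) in \<open>auto simp: bit_symbol_def\<close>)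
  then show ?case by (rule exec_eq) (auto simp: fun_eq_iff)
qed

definition mv :: "nat \<Rightarrow> nat \<Rightarrow> com" where
  "mv u v = Loop u (Push v False) (Push v True)"

text \<open>Moving a stack reverses and empties it. The second pass, from the scratch stack, undoes
  the reversal and refills the source along with the target.\<close>

definition copy :: "nat \<Rightarrow> nat \<Rightarrow> nat \<Rightarrow> com" where
  "copy u v t = Seq (mv u t)
     (Loop t (Seq (Push u False) (Push v False)) (Seq (Push u True) (Push v True)))"

definition dropc :: "nat \<Rightarrow> nat \<Rightarrow> nat \<Rightarrow> com" where
  "dropc u g t = Seq (Loop u (Seq (Pop g) (Push t False)) (Seq (Pop g) (Push t True))) (mv t u)"

definition clear :: "nat \<Rightarrow> com" where
  "clear u = Loop u Skip Skip"

lemma exec_mv: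
  assumes "u \<noteq> v" "\<sigma> u = stk xs" "\<sigma> v = stk w"
  shows "exec (mv u v) \<sigma> (length xs * 8 + 1) (\<sigma>(u := stk [], v := stk (rev xs @ w)))"
proof -
  define st where "st zs ys = \<sigma>(u := stk ys, v := stk (rev zs @ w))" for zs ys
  have "exec (mv u v) (st [] xs) (length xs * (3 + 5) + 1) (st xs [])"
    unfolding mv_def
  proof (rule exec_Loop)
    fix zs b ys
    have "exec (Push v b) ((st zs (b # ys))(u := stk ys)) 3 (st (zs @ [b]) ys)"
      by (rule exec_eq[OF exec_Push[where w = "rev zs @ w"]])
        (use assms(1) in \<open>auto simp: st_def fun_eq_iff\<close>)
    then show "exec (if b then Push v True else Push v False) ((st zs (b # ys))(u := stk ys)) 3 (st (zs @ [b]) ys)"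
      by (cases b) auto
  qed (use assms in \<open>auto simp: st_def\<close>)
  moreover have "st [] xs = \<sigma>" using assms by (auto simp: st_def fun_eq_iff)
  ultimately show ?thesis by (simp add: st_def)
qed

lemma exec_copy:
  assumes d: "u \<noteq> v" "u \<noteq> t" "v \<noteq> t" and s: "\<sigma> u = stk xs" "\<sigma> v = stk w" "\<sigma> t = stk []"
  shows "exec (copy u v t) \<sigma> (length xs * 20 + 3) (\<sigma>(v := stk (xs @ w)))"
proof -
  define \<sigma>1 where "\<sigma>1 = \<sigma>(u := stk [], t := stk (rev xs))"
  define st where "st zs ys = \<sigma>1(t := stk ys, u := stk (rev zs), v := stk (rev zs @ w))" for zs ys
  have "exec (mv u t) \<sigma> (length xs * 8 + 1) \<sigma>1"
    using exec_mv[of u t \<sigma> xs "[]"] d s by (simp add: \<sigma>1_def)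
  moreover have "exec (Loop t (Seq (Push u False) (Push v False)) (Seq (Push u True) (Push v True)))
      (st [] (rev xs)) (length (rev xs) * (7 + 5) + 1) (st (rev xs) [])"
  proof (rule exec_Loop)
    fix zs b ys
    have "exec (Seq (Push u b) (Push v b)) ((st zs (b # ys))(t := stk ys)) (3 + 3 + 1) (st (zs @ [b]) ys)"
      by (rule exec_eq[OF exec_Seq[OF exec_Push[where w = "rev zs"] exec_Push[where w = "rev zs @ w"]]])
        (use d in \<open>auto simp: st_def fun_eq_iff\<close>)
    then show "exec (if b then Seq (Push u True) (Push v True) else Seq (Push u False) (Push v False))
       ((st zs (b # ys))(t := stk ys)) 7 (st (zs @ [b]) ys)"
      by (cases b) auto
  qed (use d in \<open>auto simp: st_def\<close>)
  moreover have "st [] (rev xs) = \<sigma>1" using d s by (auto simp: st_def \<sigma>1_def fun_eq_iff)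
  moreover have "st (rev xs) [] = \<sigma>(v := stk (xs @ w))" using d s by (auto simp: st_def \<sigma>1_def fun_eq_iff)
  ultimately show ?thesis
    unfolding copy_def by (auto intro!: exec_eq[OF exec_Seq])
qed

lemma exec_dropc:
  assumes d: "u \<noteq> g" "u \<noteq> t" "g \<noteq> t" and s: "\<sigma> u = stk xs" "\<sigma> g = stk w" "\<sigma> t = stk []"
  shows "exec (dropc u g t) \<sigma> (length xs * 18 + 3) (\<sigma>(g := stk (drop (length xs) w)))"
proof -
  define st where "st zs ys = \<sigma>(u := stk ys, t := stk (rev zs), g := stk (drop (length zs) w))" for zs ys
  have "exec (Loop u (Seq (Pop g) (Push t False)) (Seq (Pop g) (Push t True)))
      (st [] xs) (length xs * (5 + 5) + 1) (st xs [])"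
  proof (rule exec_Loop)
    fix zs b ys
    have "exec (Seq (Pop g) (Push t b)) ((st zs (b # ys))(u := stk ys)) (1 + 3 + 1) (st (zs @ [b]) ys)"
      by (rule exec_eq[OF exec_Seq[OF exec_Pop[where w = "drop (length zs) w"] exec_Push[where w = "rev zs"]]])
        (use d in \<open>auto simp: st_def fun_eq_iff drop_Suc tl_drop\<close>)
    then show "exec (if b then Seq (Pop g) (Push t True) else Seq (Pop g) (Push t False))
       ((st zs (b # ys))(u := stk ys)) 5 (st (zs @ [b]) ys)"
      by (cases b) auto
  qed (use d in \<open>auto simp: st_def\<close>)
  moreover have "exec (mv t u) (st xs []) (length (rev xs) * 8 + 1) ((st xs [])(t := stk [], u := stk (rev (rev xs) @ [])))"
    by (rule exec_mv) (use d in \<open>auto simp: st_def\<close>)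
  moreover have "st [] xs = \<sigma>" using d s by (auto simp: st_def fun_eq_iff)
  moreover have "(st xs [])(t := stk [], u := stk (rev (rev xs) @ [])) = \<sigma>(g := stk (drop (length xs) w))"
    using d s by (auto simp: st_def fun_eq_iff)
  ultimately show ?thesis
    unfolding dropc_def by (auto intro!: exec_eq[OF exec_Seq])
qed

lemma exec_clear:
  assumes "\<sigma> u = stk xs"
  shows "exec (clear u) \<sigma> (length xs * 5 + 1) (\<sigma>(u := stk []))"
proof -
  define st where "st zs ys = \<sigma>(u := stk ys)" for zs ys :: "bool list"
  have "exec (Loop u Skip Skip) (st [] xs) (length xs * (0 + 5) + 1) (st xs [])"
  proof (rule exec_Loop)
    fix zs b ys
    have "exec Skip ((st zs (b # ys))(u := stk ys)) 0 (st (zs @ [b]) ys)"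
      by (rule exec_eq[OF exec_Skip]) (auto simp: st_def)
    then show "exec (if b then Skip else Skip) ((st zs (b # ys))(u := stk ys)) 0 (st (zs @ [b]) ys)"
      by simp
  qed (simp add: st_def)
  moreover have "st [] xs = \<sigma>" using assms by (auto simp: st_def fun_eq_iff)
  ultimately show ?thesis by (simp add: st_def clear_def)
qed

subsection \<open>Printing binary numbers\<close>

text \<open>Tape 2 is a toggle: every second round empties it and puts a mark on tape 4. At the end
  it holds the remainder and tape 4 the quotient.\<close>

definition halve :: com where
  "halve = (let c = Branch 2 (Push 2 True) Skip (Seq (Pop 2) (Push 4 True)) in Loop 3 c c)"

definition bin_loop :: "nat \<Rightarrow> com" where
  "bin_loop r = While 3 (Seq halve (Seq (Push r True)
     (Seq (Branch 2 (Push r False) Skip (Seq (Pop 2) (Push r True))) (mv 4 3))))"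

lemma exec_halve:
  assumes s: "\<sigma> 3 = stk xs" "\<sigma> 2 = stk []" "\<sigma> 4 = stk []"
  shows "exec halve \<sigma> (length xs * 11 + 1)
    (\<sigma>(3 := stk [], 2 := stk (replicate (length xs mod 2) True), 4 := stk (replicate (length xs div 2) True)))"
proof -
  define st where "st zs ys = \<sigma>(3 := stk ys, 2 := stk (replicate (length zs mod 2) True),
    4 := stk (replicate (length zs div 2) True))" for zs ys :: "bool list"
  let ?c = "Branch 2 (Push 2 True) Skip (Seq (Pop 2) (Push 4 True))"
  have "exec (Loop 3 ?c ?c) (st [] xs) (length xs * (6 + 5) + 1) (st xs [])"
  proof (rule exec_Loop)
    fix zs b ys
    let ?s = "(st zs (b # ys))(3 := stk ys)"
    have "exec ?c ?s (5 + 1) (st (zs @ [b]) ys)"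
    proof (rule exec_Branch_stk)
      show "?s 2 = stk (replicate (length zs mod 2) True)" by (simp add: st_def)
      show "exec (case replicate (length zs mod 2) True of [] \<Rightarrow> Push 2 True
           | b # _ \<Rightarrow> if b then Seq (Pop 2) (Push 4 True) else Skip) ?s 5 (st (zs @ [b]) ys)"
      proof (cases "even (length zs)")
        case True
        then have z: "Suc (length zs) mod 2 = 1" "length zs mod 2 = 0" "Suc (length zs) div 2 = length zs div 2"
          by presburger+
        show ?thesis unfolding z
          by (simp, rule exec_eq[OF exec_Push[where w = "[]"]]) (auto simp: st_def z fun_eq_iff)
      next
        case False
        then have z: "Suc (length zs) mod 2 = 0" "length zs mod 2 = 1" "Suc (length zs) div 2 = Suc (length zs div 2)"
          by presburger+
        show ?thesis unfolding z
          by (simp, rule exec_eq[OF exec_Seq[OF exec_Pop[where w = "[True]"]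
                 exec_Push[where w = "replicate (length zs div 2) True"]]])
            (auto simp: st_def z fun_eq_iff)
      qed
    qed
    then show "exec (if b then ?c else ?c) ?s 6 (st (zs @ [b]) ys)" by simp
  qed (auto simp: st_def)
  moreover have "st [] xs = \<sigma>" using s by (auto simp: st_def fun_eq_iff)
  ultimately show ?thesis by (simp add: halve_def st_def Let_def)
qed

lemma exec_bin_loop:
  assumes "r \<notin> {2, 3, 4}" "\<sigma> 2 = stk []" "\<sigma> 4 = stk []" "\<sigma> 3 = stk xs" "\<sigma> r = stk w"
  shows "exec (bin_loop r) \<sigma> (length xs * (20 * length xs + 40) + 1)
    (\<sigma>(3 := stk [], r := stk (rev (concat (map (\<lambda>b. [True, b]) (binary (length xs)))) @ w)))"
  using assms
proof (induction "length xs" arbitrary: xs w \<sigma> rule: less_induct)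
  case less
  show ?case
  proof (cases "xs = []")
    case True
    have "exec (bin_loop r) \<sigma> 1 \<sigma>"
      unfolding bin_loop_def by (rule exec_While_done) (simp add: less.prems True)
    then show ?thesis
      by (rule exec_eq) (use True less.prems in \<open>auto simp: fun_eq_iff binary.simps[of 0]\<close>)
  next
    case False
    let ?n = "length xs"
    define \<sigma>1 where "\<sigma>1 = \<sigma>(3 := stk [], 2 := stk (replicate (?n mod 2) True), 4 := stk
      (replicate (?n div 2) True))"
    define \<sigma>2 where "\<sigma>2 = \<sigma>1(r := stk (True # w))"
    define \<sigma>3 where "\<sigma>3 = \<sigma>2(2 := stk [], r := stk (odd ?n # True # w))"
    define \<sigma>4 where "\<sigma>4 = \<sigma>3(4 := stk [], 3 := stk (replicate (?n div 2) True))"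
    have e1: "exec halve \<sigma> (?n * 11 + 1) \<sigma>1"
      unfolding \<sigma>1_def by (rule exec_halve) (use less.prems in auto)
    have e2: "exec (Push r True) \<sigma>1 3 \<sigma>2"
      unfolding \<sigma>2_def by (rule exec_Push) (use less.prems in \<open>auto simp: \<sigma>1_def\<close>)
    have e3: "exec (Branch 2 (Push r False) Skip (Seq (Pop 2) (Push r True))) \<sigma>2 (5 + 1) \<sigma>3"
    proof (rule exec_Branch_stk)
      show "\<sigma>2 2 = stk (replicate (?n mod 2) True)" using less.prems by (auto simp: \<sigma>2_def \<sigma>1_def)
      show "exec (case replicate (?n mod 2) True of [] \<Rightarrow> Push r False
           | b # _ \<Rightarrow> if b then Seq (Pop 2) (Push r True) else Skip) \<sigma>2 5 \<sigma>3"
      proof (cases "even ?n")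
        case True
        then have z: "?n mod 2 = 0" by presburger
        show ?thesis unfolding z
          by (simp, rule exec_eq[OF exec_Push[where w = "True # w"]])
            (use less.prems True in \<open>auto simp: \<sigma>3_def \<sigma>2_def \<sigma>1_def z fun_eq_iff\<close>)
      next
        case False
        then have z: "?n mod 2 = 1" by presburger
        show ?thesis unfolding z
          by (simp, rule exec_eq[OF exec_Seq[OF exec_Pop[where w = "[True]"] exec_Push[where w = "True # w"]]])
            (use less.prems False in \<open>auto simp: \<sigma>3_def \<sigma>2_def \<sigma>1_def z fun_eq_iff\<close>)
      qed
    qed
    have e4: "exec (mv 4 3) \<sigma>3 (?n div 2 * 8 + 1) \<sigma>4"
      by (rule exec_eq[OF exec_mv[where xs = "replicate (?n div 2) True" and w = "[]"]])
        (use less.prems in \<open>auto simp: \<sigma>4_def \<sigma>3_def \<sigma>2_def \<sigma>1_def\<close>)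
    let ?m = "?n div 2" and ?w = "odd ?n # True # w"
    let ?T = "\<lambda>n::nat. n * (20 * n + 40) + 1"
    have lt: "?m < ?n" using False by simp
    have e5: "exec (bin_loop r) \<sigma>4 (?T ?m)
      (\<sigma>4(3 := stk [], r := stk (rev (concat (map (\<lambda>b. [True, b]) (binary ?m))) @ ?w)))"
      using less.hyps[of "replicate ?m True" \<sigma>4 ?w] lt less.prems
      by (auto simp: \<sigma>4_def \<sigma>3_def \<sigma>2_def \<sigma>1_def)
    have "\<sigma> 3 0 \<noteq> 0" using False less.prems by (cases xs) (auto simp: bit_symbol_def)
    from exec_While_step[OF this exec_Seq[OF e1 exec_Seq[OF e2 exec_Seq[OF e3 e4]]] e5[unfolded bin_loop_def]]
    have "exec (bin_loop r) \<sigma> (?n * 11 + 1 + (3 + (5 + 1 + (?m * 8 + 1) + 1) + 1) + 1 + ?T ?m + 2)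
       (\<sigma>4(3 := stk [], r := stk (rev (concat (map (\<lambda>b. [True, b]) (binary ?m))) @ ?w)))"
      unfolding bin_loop_def .
    moreover have "\<sigma>4(3 := stk [], r := stk (rev (concat (map (\<lambda>b. [True, b]) (binary ?m))) @ ?w))
        = \<sigma>(3 := stk [], r := stk (rev (concat (map (\<lambda>b. [True, b]) (binary ?n))) @ w))"
      using less.prems False
      by (auto simp: \<sigma>4_def \<sigma>3_def \<sigma>2_def \<sigma>1_def fun_eq_iff binary.simps[of ?n])
    \<comment> \<open>One pass costs at most \<open>15 * ?n + 16\<close> steps. Lowering the outer
      factor of the quadratic bound from \<open>?n\<close> to \<open>?n - 1\<close> leaves
      \<open>20 * ?n + 40\<close>, and the recursive call at \<open>?n div 2\<close> fits into the
      rest.\<close>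
    moreover have "?n * 11 + 1 + (3 + (5 + 1 + (?m * 8 + 1) + 1) + 1) + 1 + ?T ?m + 2 \<le> ?T ?n"
    proof -
      obtain k where k: "?n = Suc k" using False by (cases xs) auto
      have "?m \<le> k" using lt k by simp
      then have "?m * (20 * ?m + 40) \<le> k * (20 * ?n + 40)"
        using k by (intro mult_mono) auto
      then have "?T ?m \<le> k * (20 * ?n + 40) + 1" by simp
      moreover have "?T ?n = k * (20 * ?n + 40) + (20 * ?n + 40) + 1" by (simp add: k)
      moreover have "?m * 8 \<le> ?n * 4" by simp
      ultimately show ?thesis by linarith
    qed
    ultimately show ?thesis by (rule exec_eq)
  qed
qed

section \<open>A printing language with polynomial running time\<close>

text \<open>
  Variables hold strings and are never overwritten; numbers are the lengths of strings.
  A loop runs over the elements \<open>b\<close> of a string and binds the rest of the string after \<open>b\<close>,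
  so that a loop over a string of length \<open>n\<close> counts from \<open>n - 1\<close> down to \<open>0\<close>.
  Since the length of every loop is fixed before it starts, all programs take polynomial time.
\<close>

datatype lp =
  Quiet
| Emit bool
| Then lp lp
| For nat nat lp lp
| IfDrop nat nat lp lp lp
| Bind nat lp lp
| Bin nat

text \<open>\<open>IfDrop u v\<close> looks at the element of \<open>v\<close> at position
  \<open>length (e u)\<close>, so it is a comparison of lengths and a random access at once.
  \<open>Bind\<close> stores the reverse of what is printed because output is pushed on a stack,
  which leaves the last symbol on top.\<close>

primrec out :: "lp \<Rightarrow> (nat \<Rightarrow> bool list) \<Rightarrow> bool list" where
  "out Quiet = (\<lambda>e. [])"
| "out (Emit b) = (\<lambda>e. [b])"
| "out (Then c d) = (\<lambda>e. out c e @ out d e)"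
| "out (For i v cF cT) = (\<lambda>e. concat (map (\<lambda>(b, s). (if b then out cT else out cF) (e(i := s))) (splits (e v))))"
| "out (IfDrop u v c0 cF cT) = (\<lambda>e. (case drop (length (e u)) (e v) of
     [] \<Rightarrow> out c0 | b # _ \<Rightarrow> if b then out cT else out cF) e)"
| "out (Bind i c d) = (\<lambda>e. out d (e(i := rev (out c e))))"
| "out (Bin v) = (\<lambda>e. self_delimiting (binary (length (e v))))"

text \<open>Tapes 2, 3 and 4 are scratch space.\<close>

primrec compile :: "lp \<Rightarrow> nat \<Rightarrow> com" where
  "compile Quiet = (\<lambda>r. Skip)"
| "compile (Emit b) = (\<lambda>r. Push r b)"
| "compile (Then c d) = (\<lambda>r. Seq (compile c r) (compile d r))"
| "compile (For i v cF cT) = (\<lambda>r. Seq (copy v i 2) (Loop i (compile cF r) (compile cT r)))"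
| "compile (IfDrop u v c0 cF cT) = (\<lambda>r. Seq (copy v 3 2) (Seq (dropc u 3 2)
     (Branch 3 (compile c0 r) (Seq (clear 3) (compile cF r)) (Seq (clear 3) (compile cT r)))))"
| "compile (Bind i c d) = (\<lambda>r. Seq (compile c i) (Seq (compile d r) (clear i)))"
| "compile (Bin v) = (\<lambda>r. Seq (copy v 3 2) (Seq (bin_loop r) (Push r False)))"

text \<open>Every bound variable exceeds those bound around it; \<open>B\<close> bounds all of them and \<open>A\<close> contains
  the free variables.\<close>

primrec wf_lp :: "nat \<Rightarrow> lp \<Rightarrow> nat set \<Rightarrow> nat \<Rightarrow> bool" where
  "wf_lp B Quiet = (\<lambda>A d. True)"
| "wf_lp B (Emit b) = (\<lambda>A d. True)"
| "wf_lp B (Then c c') = (\<lambda>A d. wf_lp B c A d \<and> wf_lp B c' A d)"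
| "wf_lp B (For i v cF cT) = (\<lambda>A d. v \<in> A \<and> d \<le> i \<and> i < B \<and>
     wf_lp B cF (insert i A) (Suc i) \<and> wf_lp B cT (insert i A) (Suc i))"
| "wf_lp B (IfDrop u v c0 cF cT) = (\<lambda>A d. u \<in> A \<and> v \<in> A \<and> wf_lp B c0 A d \<and> wf_lp
  B cF A d \<and> wf_lp B cT A d)"
| "wf_lp B (Bind i c c') = (\<lambda>A d. d \<le> i \<and> i < B \<and> wf_lp B c A (Suc i) \<and> wf_lp B c'
  (insert i A) (Suc i))"
| "wf_lp B (Bin v) = (\<lambda>A d. v \<in> A)"

text \<open>The output stack \<open>r\<close> lies below \<open>d\<close> and outside
  \<open>A\<close>, so binding a variable at or above \<open>d\<close> disturbs neither the output
  nor the variables in scope, and finds an empty tape.\<close>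

definition layout :: "nat \<Rightarrow> nat set \<Rightarrow> nat \<Rightarrow> nat \<Rightarrow> (nat
  \<Rightarrow> bool list) \<Rightarrow> (nat \<Rightarrow> tape) \<Rightarrow> bool" where
  "layout B A d r e \<sigma> \<longleftrightarrow> A \<subseteq> {..<d} - {r, 2, 3, 4} \<and> 5 \<le> r \<and> r < d \<and>
     (\<forall>v\<in>A. \<sigma> v = stk (e v)) \<and> (\<forall>v\<in>{2, 3, 4} \<union> {d..<B}. \<sigma> v = stk [])"

lemma layout_bind:
  assumes L: "layout B A d r e \<sigma>" and i: "d \<le> i"
  shows "layout B (insert i A) (Suc i) r (e(i := ys)) (\<sigma>(i := stk ys, r := t))"
proof -
  let ?\<sigma> = "\<sigma>(i := stk ys, r := t)"
  have A: "A \<subseteq> {..<d} - {r, 2, 3, 4}" "\<forall>v\<in>A. \<sigma> v = stk (e v)" and r: "5 \<le> r" "r < d"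
    and s: "\<forall>v\<in>{2, 3, 4} \<union> {d..<B}. \<sigma> v = stk []"
    using L unfolding layout_def by blast+
  have n: "i \<noteq> r" "i \<noteq> 2" "i \<noteq> 3" "i \<noteq> 4" using r i by linarith+
  have "insert i A \<subseteq> {..<Suc i} - {r, 2, 3, 4}" using A(1) n i by fastforce
  moreover have "?\<sigma> v = stk ((e(i := ys)) v)" if "v \<in> insert i A" for v
    using A that n(1) by (cases "v = i") auto
  moreover have "?\<sigma> v = stk []" if "v \<in> {2, 3, 4} \<union> {Suc i..<B}" for v
  proof -
    have "v \<noteq> i" "v \<noteq> r" using that n i r by auto
    moreover have "v \<in> {2, 3, 4} \<union> {d..<B}" using that i by auto
    ultimately show ?thesis using bspec[OF s] by simp
  qed
  moreover have "r < Suc i" using r i by simp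
  ultimately show ?thesis
    unfolding layout_def using r(1) by blast
qed

section \<open>Correctness and polynomial running time of compiled programs\<close>

lemma poly_nat_mono: "m \<le> n \<Longrightarrow> poly p m \<le> poly p n" for p :: "nat poly"
  by (induction p) (auto intro!: add_mono mult_mono)

lemma length_binary: "length (binary n) \<le> n"
proof (induction n rule: less_induct)
  case (less n)
  show ?case
  proof (cases "n = 0")
    case False
    then have "length (binary (n div 2)) \<le> n div 2" by (intro less) auto
    then show ?thesis using False by (subst binary.simps) auto
  qed (simp add: binary.simps)
qed

lemma length_concat_splits:
  assumes "length xs \<le> m" "\<And>b s. length s < m \<Longrightarrow> length (f b s) \<le> k"
  shows "length (concat (map (\<lambda>(b, s). f b s) (splits xs))) \<le> length xs * k"
  using assms(1)
proof (induction xs)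
  case (Cons b xs)
  then show ?case using assms(2)[of xs b] by auto
qed simp

lemma length_self_delimiting: "length (self_delimiting w) = 2 * length w + 1"
  by (induction w) (auto simp: self_delimiting_def)

text \<open>The polynomial is chosen before the environment, the tapes and \<open>m\<close>, so that
  it serves for every round of an enclosing loop. The length of the output is bounded as well, since
  \<open>Bind\<close> turns it into a variable over which later loops may run.\<close>

definition realized :: "nat \<Rightarrow> lp \<Rightarrow> nat set \<Rightarrow> nat \<Rightarrow> nat poly
  \<Rightarrow> bool" where
  "realized B c A d p \<longleftrightarrow> (\<forall>r e \<sigma> w m. layout B A d r e \<sigma>
    \<longrightarrow> \<sigma> r = stk w \<longrightarrow> (\<forall>v\<in>A. length (e v) \<le> m) \<longrightarrow>
     exec (compile c r) \<sigma> (poly p m) (\<sigma>(r := stk (rev (out c e) @ w))) \<and> length (out c e) \<le> poly p m)"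

lemma realizedI:
  assumes "\<And>r e \<sigma> w m. layout B A d r e \<sigma> \<Longrightarrow> \<sigma> r = stk w
    \<Longrightarrow> \<forall>v\<in>A. length (e v) \<le> m \<Longrightarrow>
     exec (compile c r) \<sigma> (poly p m) (\<sigma>(r := stk (rev (out c e) @ w))) \<and> length (out c e) \<le> poly p m"
  shows "\<exists>p. realized B c A d p"
  using assms unfolding realized_def by blast

lemma realizedD:
  assumes "realized B c A d p" "layout B A d r e \<sigma>" "\<sigma> r = stk w" "\<And>v. v \<in> A
    \<Longrightarrow> length (e v) \<le> m"
  shows "exec (compile c r) \<sigma> (poly p m) (\<sigma>(r := stk (rev (out c e) @ w)))" "length (out c e) \<le> poly p m"
  using assms unfolding realized_def by blast+

text \<open>The loop variable is bound to proper suffixes of a variable in scope, so the bound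
  \<open>m\<close> persists inside the body; at most \<open>m\<close> rounds then give a factor
  \<open>m\<close>, not a composition of polynomials.\<close>

lemma realized_For:
  assumes wf: "v \<in> A" "d \<le> i" "i < B"
    and F: "realized B cF (insert i A) (Suc i) pF" and T: "realized B cT (insert i A) (Suc i) pT"
  shows "\<exists>p. realized B (For i v cF cT) A d p"
proof (rule realizedI[where p = "[:5, 20:] + [:0, 1:] * (pF + pT + [:5:])"])
  fix r e \<sigma> w m
  assume L: "layout B A d r e \<sigma>" and o: "\<sigma> r = stk w" and m: "\<forall>v\<in>A. length (e v) \<le> m"
  let ?k = "poly pF m + poly pT m"
  have d: "v \<noteq> i" "i \<noteq> r" "i \<noteq> 2" "v \<noteq> 2" "\<sigma> v = stk (e v)" "\<sigma> i =
    stk []" "\<sigma> 2 = stk []" "length (e v) \<le> m"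
    using L wf m by (auto simp: layout_def)
  let ?f = "\<lambda>b s. (if b then out cT else out cF) (e(i := s))"
  have body: "exec (if b then compile cT r else compile cF r) (\<sigma>(i := stk ys, r := stk w)) ?k
          (\<sigma>(i := stk ys, r := stk (rev (?f b ys) @ w))) \<and> length (?f b ys) \<le> ?k"
    if "length ys < m" for b ys w
  proof -
    let ?\<sigma> = "\<sigma>(i := stk ys, r := stk w)"
    have L': "layout B (insert i A) (Suc i) r (e(i := ys)) ?\<sigma>"
      by (rule layout_bind[OF L wf(2)])
    have m': "length ((e(i := ys)) u) \<le> m" if "u \<in> insert i A" for u
      using m that \<open>length ys < m\<close> by auto
    have u: "?\<sigma> r = stk w" by simp
    note * = realizedD[where \<sigma> = ?\<sigma> and e = "e(i := ys)", OF F L' u m']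
      realizedD[where \<sigma> = ?\<sigma> and e = "e(i := ys)", OF T L' u m']
    show ?thesis
      using exec_mono[OF *(1), of ?k] exec_mono[OF *(3), of ?k] *(2,4) by (cases b) auto
  qed
  have "exec (copy v i 2) \<sigma> (length (e v) * 20 + 3) (\<sigma>(i := stk (e v @ [])))"
    by (rule exec_copy) (use d in auto)
  then have c: "exec (copy v i 2) \<sigma> (length (e v) * 20 + 3) (\<sigma>(i := stk (e v), r := stk w))"
    by (rule exec_eq) (use o d in \<open>auto simp: fun_eq_iff\<close>)
  have l: "exec (Loop i (compile cF r) (compile cT r)) (\<sigma>(i := stk (e v), r := stk w)) (length (e v) * (?k + 5) + 1)
    (\<sigma>(i := stk [], r := stk (rev (concat (map (\<lambda>(b, s). ?f b s) (splits (e v)))) @ w)))"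
    by (rule exec_Loop_out[where m = m]) (use d body in blast)+
  have "length (e v) * 20 + 3 + (length (e v) * (?k + 5) + 1) + 1 \<le> m * 20 + 3 + (m * (?k + 5) + 1) + 1"
    using d(8) by (intro add_mono mult_mono) auto
  then have "exec (compile (For i v cF cT) r) \<sigma> (poly ([:5, 20:] + [:0, 1:] * (pF + pT + [:5:])) m)
      (\<sigma>(r := stk (rev (out (For i v cF cT) e) @ w)))"
    unfolding compile.simps
    by (intro exec_eq[OF exec_Seq[OF c l]]) (use d in \<open>auto simp: fun_eq_iff algebra_simps\<close>)
  moreover have "length (out (For i v cF cT) e) \<le> length (e v) * ?k"
    using length_concat_splits[OF d(8), of ?f ?k] body by auto
  then have "length (out (For i v cF cT) e) \<le> m * ?k"
    using d(8) by (meson le_trans mult_le_mono1)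
  then have "length (out (For i v cF cT) e) \<le> poly ([:5, 20:] + [:0, 1:] * (pF + pT + [:5:])) m"
    by (simp add: algebra_simps)
  ultimately show "exec (compile (For i v cF cT) r) \<sigma> (poly ([:5, 20:] + [:0, 1:] * (pF + pT + [:5:])) m)
      (\<sigma>(r := stk (rev (out (For i v cF cT) e) @ w))) \<and>
      length (out (For i v cF cT) e) \<le> poly ([:5, 20:] + [:0, 1:] * (pF + pT + [:5:])) m" by blast
qed

text \<open>The test leaves its remainder on tape 3, which the branches use as scratch space
  themselves. It is cleared on entering them, except in the first branch, where it is empty
  already.\<close>

lemma realized_IfDrop:
  assumes wf: "u \<in> A" "v \<in> A"
    and 0: "realized B c0 A d p0" and F: "realized B cF A d pF" and T: "realized B cT A d pT"
  shows "\<exists>p. realized B (IfDrop u v c0 cF cT) A d p"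
proof (rule realizedI[where p = "[:20, 43:] + (p0 + pF + pT)"])
  fix r e \<sigma> w m
  assume L: "layout B A d r e \<sigma>" and o: "\<sigma> r = stk w" and m: "\<forall>v\<in>A. length (e v) \<le> m"
  let ?k = "poly p0 m + poly pF m + poly pT m"
  let ?z = "drop (length (e u)) (e v)"
  have d: "v \<noteq> 3" "v \<noteq> 2" "u \<noteq> 3" "u \<noteq> 2" "r \<noteq> 3" "\<sigma> v = stk (e v)"
    "\<sigma> u = stk (e u)" "\<sigma> 2 = stk []" "\<sigma> 3 = stk []"
    "length (e v) \<le> m" "length (e u) \<le> m"
    using L wf m by (auto simp: layout_def)
  have 1: "exec (copy v 3 2) \<sigma> (length (e v) * 20 + 3) (\<sigma>(3 := stk (e v)))"
    using exec_copy[of v 3 2 \<sigma> "e v" "[]"] d by auto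
  have "exec (dropc u 3 2) (\<sigma>(3 := stk (e v))) (length (e u) * 18 + 3) (\<sigma>(3 := stk (e v), 3 := stk ?z))"
    by (rule exec_dropc) (use d in auto)
  then have 2: "exec (dropc u 3 2) (\<sigma>(3 := stk (e v))) (length (e u) * 18 + 3) (\<sigma>(3 := stk ?z))" by simp
  note * = realizedD[OF 0 L o] realizedD[OF F L o] realizedD[OF T L o]
  have cl: "exec (clear 3) (\<sigma>(3 := stk ?z)) (length ?z * 5 + 1) \<sigma>"
    by (rule exec_eq[OF exec_clear]) (use d in \<open>auto simp: fun_eq_iff\<close>)
  have "exec (case ?z of [] \<Rightarrow> compile c0 r | b # _ \<Rightarrow> if b then Seq (clear 3) (compile
    cT r) else Seq (clear 3) (compile cF r))
      (\<sigma>(3 := stk ?z)) (m * 5 + 2 + ?k) (\<sigma>(r := stk (rev (out (IfDrop u v c0 cF cT) e) @ w)))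
      \<and> length (out (IfDrop u v c0 cF cT) e) \<le> ?k"
  proof (cases ?z)
    case Nil
    then have "\<sigma>(3 := stk ?z) = \<sigma>" using d by (auto simp: fun_eq_iff)
    moreover have "exec (compile c0 r) \<sigma> (m * 5 + 2 + ?k) (\<sigma>(r := stk (rev (out c0 e) @ w)))"
      by (rule exec_mono[OF *(1)[of m]]) (use m in auto)
    ultimately show ?thesis using *(2)[of m] m Nil by (auto intro: trans_le_add1)
  next
    case (Cons b ys)
    have "length ?z \<le> m" using d by simp
    have "exec (Seq (clear 3) (compile (if b then cT else cF) r)) (\<sigma>(3 := stk ?z)) (m * 5 + 2 + ?k)
      (\<sigma>(r := stk (rev (out (if b then cT else cF) e) @ w)))"
    proof (rule exec_mono)
      show "exec (Seq (clear 3) (compile (if b then cT else cF) r)) (\<sigma>(3 := stk ?z))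
        ((length ?z * 5 + 1) + poly (if b then pT else pF) m + 1)
        (\<sigma>(r := stk (rev (out (if b then cT else cF) e) @ w)))"
        by (rule exec_Seq[OF cl]) (use * m in \<open>cases b; auto\<close>)
      show "(length ?z * 5 + 1) + poly (if b then pT else pF) m + 1 \<le> m * 5 + 2 + ?k"
        using \<open>length ?z \<le> m\<close> by (cases b) auto
    qed
    moreover have "length (out (if b then cT else cF) e) \<le> ?k"
      using *(4)[of m] *(6)[of m] m by (cases b) auto
    ultimately show ?thesis using Cons by (cases b) auto
  qed
  from exec_Branch_stk[OF fun_upd_same conjunct1[OF this]] conjunct2[OF this]
  have i: "exec (Branch 3 (compile c0 r) (Seq (clear 3) (compile cF r)) (Seq (clear 3) (compile cT r)))
      (\<sigma>(3 := stk ?z)) (m * 5 + 2 + ?k + 1) (\<sigma>(r := stk (rev (out (IfDrop u v c0 cF cT) e) @ w)))"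
    and len: "length (out (IfDrop u v c0 cF cT) e) \<le> ?k"
    by blast+
  have "exec (compile (IfDrop u v c0 cF cT) r) \<sigma> (poly ([:20, 43:] + (p0 + pF + pT)) m)
      (\<sigma>(r := stk (rev (out (IfDrop u v c0 cF cT) e) @ w)))"
    unfolding compile.simps
    by (rule exec_mono[OF exec_Seq[OF 1 exec_Seq[OF 2 i]]]) (use d in auto)
  then show "exec (compile (IfDrop u v c0 cF cT) r) \<sigma> (poly ([:20, 43:] + (p0 + pF + pT)) m)
      (\<sigma>(r := stk (rev (out (IfDrop u v c0 cF cT) e) @ w))) \<and>
      length (out (IfDrop u v c0 cF cT) e) \<le> poly ([:20, 43:] + (p0 + pF + pT)) m"
    using len by simp
qed

text \<open>The bound string can be as long as \<open>poly p m\<close>, hence the composition of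
  polynomials. Of the six copies of \<open>p\<close>, one pays for computing the string and five for
  clearing its tape, which makes the variable available again.\<close>

lemma realized_Bind:
  assumes wf: "d \<le> i" "i < B"
    and C: "realized B c A (Suc i) p" and D: "realized B c' (insert i A) (Suc i) q"
  shows "\<exists>p. realized B (Bind i c c') A d p"
proof (rule realizedI[where p = "[:3:] + p + p + p + p + p + p + pcompose q ([:0, 1:] + p)"])
  fix r e \<sigma> w m
  assume L: "layout B A d r e \<sigma>" and o: "\<sigma> r = stk w" and m: "\<forall>v\<in>A. length (e v) \<le> m"
  let ?v = "rev (out c e)" and ?n = "m + poly p m"
  have d: "i \<noteq> r" "\<sigma> i = stk []" using L wf by (auto simp: layout_def)
  have L1: "layout B A (Suc i) i e \<sigma>" using L wf by (auto simp: layout_def)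
  have 1: "exec (compile c i) \<sigma> (poly p m) (\<sigma>(i := stk ?v))" "length ?v \<le> poly p m"
    using realizedD[OF C L1 d(2), of m] m by auto
  have L2: "layout B (insert i A) (Suc i) r (e(i := ?v)) (\<sigma>(i := stk ?v))"
    using layout_bind[OF L wf(1), of ?v "\<sigma> r"] d by (simp add: fun_upd_twist fun_upd_idem)
  have "\<And>u. u \<in> insert i A \<Longrightarrow> length ((e(i := ?v)) u) \<le> ?n"
    using m 1(2) by (auto intro: trans_le_add1)
  then have 2: "exec (compile c' r) (\<sigma>(i := stk ?v)) (poly q ?n) (\<sigma>(i := stk ?v, r := stk (rev
    (out c' (e(i := ?v))) @ w)))"
    "length (out c' (e(i := ?v))) \<le> poly q ?n"
    using realizedD[OF D L2, of w ?n] o d by auto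
  have 3: "exec (clear i) (\<sigma>(i := stk ?v, r := stk (rev (out c' (e(i := ?v))) @ w))) (length ?v * 5 + 1)
     (\<sigma>(r := stk (rev (out c' (e(i := ?v))) @ w)))"
    by (rule exec_eq[OF exec_clear]) (use d in \<open>auto simp: fun_eq_iff\<close>)
  have "exec (compile (Bind i c c') r) \<sigma> (poly p m + (poly q ?n + (length ?v * 5 + 1) + 1) + 1)
      (\<sigma>(r := stk (rev (out (Bind i c c') e) @ w)))"
    using exec_Seq[OF 1(1) exec_Seq[OF 2(1) 3]] by simp
  then show "exec (compile (Bind i c c') r) \<sigma> (poly ([:3:] + p + p + p + p + p + p + pcompose q ([:0, 1:] + p)) m)
      (\<sigma>(r := stk (rev (out (Bind i c c') e) @ w))) \<and>
      length (out (Bind i c c') e) \<le> poly ([:3:] + p + p + p + p + p + p + pcompose q ([:0, 1:] + p)) m"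
    using 1(2) 2(2) by (intro conjI, elim exec_mono) (simp_all add: poly_pcompose)
qed

lemma realized_Bin:
  assumes wf: "v \<in> A"
  shows "\<exists>p. realized B (Bin v) A d p"
proof (rule realizedI[where p = "[:20, 100, 20:]"])
  fix r e \<sigma> w m
  assume L: "layout B A d r e \<sigma>" and o: "\<sigma> r = stk w" and m: "\<forall>v\<in>A. length (e v) \<le> m"
  let ?n = "length (e v)" and ?w = "concat (map (\<lambda>b. [True, b]) (binary (length (e v))))"
  have d: "v \<noteq> 3" "v \<noteq> 2" "r \<notin> {2, 3, 4}" "\<sigma> v = stk (e v)" "\<sigma> 2 = stk []"
    "\<sigma> 3 = stk []" "\<sigma> 4 = stk []" "?n \<le> m"
    using L wf m by (auto simp: layout_def)
  have 1: "exec (copy v 3 2) \<sigma> (?n * 20 + 3) (\<sigma>(3 := stk (e v)))"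
    using exec_copy[of v 3 2 \<sigma> "e v" "[]"] d by auto
  have 2: "exec (bin_loop r) (\<sigma>(3 := stk (e v))) (?n * (20 * ?n + 40) + 1)
      (\<sigma>(3 := stk [], r := stk (rev ?w @ w)))"
    by (rule exec_eq[OF exec_bin_loop[where xs = "e v" and w = w]]) (use d o in auto)
  have 3: "exec (Push r False) (\<sigma>(3 := stk [], r := stk (rev ?w @ w))) 3
      (\<sigma>(r := stk (rev (out (Bin v) e) @ w)))"
    by (rule exec_eq[OF exec_Push]) (use d in \<open>auto simp: fun_eq_iff self_delimiting_def\<close>)
  have le: "?n * (20 * ?n + 40) \<le> m * (20 * m + 40)" using d(8) by (intro mult_mono) auto
  have "exec (compile (Bin v) r) \<sigma> (poly [:20, 100, 20:] m) (\<sigma>(r := stk (rev (out (Bin v) e) @ w)))"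
    unfolding compile.simps
    by (rule exec_mono[OF exec_Seq[OF 1 exec_Seq[OF 2 3]]]) (use le d(8) in \<open>simp add: algebra_simps\<close>)
  moreover have "length (out (Bin v) e) \<le> 2 * ?n + 1"
    using length_binary[of ?n] by (simp add: length_self_delimiting)
  then have "length (out (Bin v) e) \<le> poly [:20, 100, 20:] m"
    using d(8) by (simp add: algebra_simps)
  ultimately show "exec (compile (Bin v) r) \<sigma> (poly [:20, 100, 20:] m)
      (\<sigma>(r := stk (rev (out (Bin v) e) @ w))) \<and> length (out (Bin v) e) \<le> poly [:20, 100, 20:] m" by blast
qed

lemma lp_realized: "wf_lp B c A d \<Longrightarrow> \<exists>p. realized B c A d p"
proof (induction c arbitrary: A d)
  case Quiet
  show ?case by (rule realizedI[where p = 0]) (auto simp: fun_upd_idem)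
next
  case (Emit b)
  show ?case by (rule realizedI[where p = "[:3:]"]) (auto intro: exec_Push)
next
  case (Then c1 c2)
  then obtain p q where p: "realized B c1 A d p" and q: "realized B c2 A d q" by fastforce
  show ?case
  proof (rule realizedI[where p = "p + q + [:1:]"])
    fix r e \<sigma> w m
    assume L: "layout B A d r e \<sigma>" and o: "\<sigma> r = stk w" and m: "\<forall>v\<in>A. length (e v) \<le> m"
    have L': "layout B A d r e (\<sigma>(r := stk (rev (out c1 e) @ w)))"
      using L by (auto simp: layout_def)
    have m': "\<And>v. v \<in> A \<Longrightarrow> length (e v) \<le> m" using m by blast
    note 1 = realizedD[OF p L o m'] and 2 = realizedD[where \<sigma> = "\<sigma>(r := stk (rev (out c1 e) @
      w))", OF q L' fun_upd_same m']
    show "exec (compile (Then c1 c2) r) \<sigma> (poly (p + q + [:1:]) m) (\<sigma>(r := stk (rev (out (Then c1 c2) e) @ w)))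
      \<and> length (out (Then c1 c2) e) \<le> poly (p + q + [:1:]) m"
      using exec_Seq[OF 1(1) 2(1)] 1(2) 2(2) by simp
  qed
next
  case (For i v cF cT)
  then obtain pF pT where "realized B cF (insert i A) (Suc i) pF" "realized B cT (insert i A) (Suc i) pT"
    by fastforce
  then show ?case using For.prems by (intro realized_For) auto
next
  case (IfDrop u v c0 cF cT)
  then obtain p0 pF pT where "realized B c0 A d p0" "realized B cF A d pF" "realized B cT A d pT"
    by fastforce
  then show ?case using IfDrop.prems by (intro realized_IfDrop) auto
next
  case (Bind i c c')
  then obtain p q where "realized B c A (Suc i) p" "realized B c' (insert i A) (Suc i) q"
    by fastforce
  then show ?case using Bind.prems by (intro realized_Bind) auto
next
  case (Bin v)
  then show ?case by (intro realized_Bin) auto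
qed

lemma wf_com_stack:
  assumes "3 \<le> G"
  shows "wf_com K G (Push u b) \<longleftrightarrow> u < K" "wf_com K G (Pop u) \<longleftrightarrow> u < K"
    "wf_com K G (mv u v) \<longleftrightarrow> u < K \<and> v < K" "wf_com K G (clear u) \<longleftrightarrow> u < K"
    "wf_com K G (copy u v t) \<longleftrightarrow> u < K \<and> v < K \<and> t < K"
    "wf_com K G (dropc u v t) \<longleftrightarrow> u < K \<and> v < K \<and> t < K"
    "wf_com K G (bin_loop u) \<longleftrightarrow> u < K \<and> 4 < K"
  using assms
  by (auto simp: Push_def Pop_def mv_def copy_def dropc_def clear_def bin_loop_def halve_def Loop_def
      bit_symbol_def Let_def)

lemma wf_com_Loop: "wf_com K G (Loop u c d) \<longleftrightarrow> u < K \<and> wf_com K G c \<and> wf_com K G d"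
  if "0 < G"
  using that by (auto simp: Loop_def Pop_def)

lemma wf_com_compile:
  assumes "wf_lp B c A d" "A \<subseteq> {..<B}" "r < B" "5 \<le> B" "B \<le> K" "3 \<le> G"
  shows "wf_com K G (compile c r)"
  using assms
proof (induction c arbitrary: A d r)
  case (For i v cF cT)
  have i: "insert i A \<subseteq> {..<B}" "i < B" "v < B" using For.prems by auto
  show ?case using For.IH(1)[OF _ i(1), of "Suc i" r] For.IH(2)[OF _ i(1), of "Suc i" r] For.prems i
    by (simp add: wf_com_stack wf_com_Loop)
next
  case (IfDrop u v c0 cF cT)
  have i: "u < B" "v < B" using IfDrop.prems by auto
  show ?case using IfDrop.IH[of A d r] IfDrop.prems i
    by (simp add: wf_com_stack)
next
  case (Bind i c c')
  have i: "insert i A \<subseteq> {..<B}" "i < B" using Bind.prems by auto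
  show ?case using Bind.IH(1)[of A "Suc i" i] Bind.IH(2)[OF _ i(1), of "Suc i" r] Bind.prems i
    by (simp add: wf_com_stack)
next
  case (Bin v)
  then have "v < B" by auto
  then show ?case using Bin.prems by (simp add: wf_com_stack)
qed (auto simp: wf_com_stack)

lemma wf_lp_mono: "wf_lp B c A d \<Longrightarrow> B \<le> B' \<Longrightarrow> wf_lp B' c A d"
  by (induction c arbitrary: A d) auto

section \<open>Feeding printed strings to a Turing machine\<close>

definition read_out :: "nat \<Rightarrow> com" where
  "read_out b = While b (Branch b Skip (Seq (Push 1 False) (Pop b)) (Seq (Push 1 True) (Pop b)))"

text \<open>A tape left by a foreign machine is not a stack: there may be garbage behind the first
  blank and to the left of the head. Its output is therefore transferred to a proper stack, in
  reverse, and the tape \<open>t\<close> that remains is left unspecified.\<close>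

lemma exec_read_out:
  assumes "output_is (\<sigma> b) w" "\<sigma> 1 = stk v" "b \<noteq> 1"
  shows "\<exists>t. exec (read_out b) \<sigma> (length w * 8 + 1) (\<sigma>(b := t, 1 := stk (rev w @ v)))"
  using assms
proof (induction w arbitrary: \<sigma> v)
  case Nil
  then have "\<sigma> b 0 = 0" by (simp add: output_is_def)
  from exec_While_done[of \<sigma> b, OF this] have "exec (read_out b) \<sigma> (length ([] :: bool list) * 8 + 1)
      (\<sigma>(b := \<sigma> b, 1 := stk (rev [] @ v)))"
    unfolding read_out_def by (rule exec_eq) (use Nil.prems in \<open>auto simp: fun_eq_iff\<close>)
  then show ?case by blast
next
  case (Cons c w)
  have c0: "\<sigma> b 0 = bit_symbol c" using Cons.prems(1) by (force simp: output_is_def)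
  define t where "t = act (0, Go_Right) (\<sigma> b)"
  define \<sigma>1 where "\<sigma>1 = \<sigma>(1 := stk (c # v), b := t)"
  have pop: "exec (Pop b) (\<sigma>(1 := stk (c # v))) 1 \<sigma>1"
    unfolding Pop_def using exec_Prim[of b "\<lambda>_. (0, Go_Right)" "\<sigma>(1 := stk (c # v))"] Cons.prems(3)
    by (simp add: \<sigma>1_def t_def)
  have "exec (Seq (Push 1 c) (Pop b)) \<sigma> (3 + 1 + 1) \<sigma>1"
    by (rule exec_Seq[OF exec_Push pop]) (use Cons.prems in auto)
  then have "exec (Branch b Skip (Seq (Push 1 False) (Pop b)) (Seq (Push 1 True) (Pop b))) \<sigma> (3 + 1 + 1 + 1) \<sigma>1"
    by (intro exec_Branch) (use c0 in \<open>cases c; simp\<close>)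
  moreover have o1: "output_is (\<sigma>1 b) w"
    unfolding output_is_def
  proof (intro conjI allI impI)
    fix i assume "i < length w"
    then have "\<sigma> b (int (Suc i)) = bit_symbol ((c # w) ! Suc i)"
      using Cons.prems(1) unfolding output_is_def by (metis Suc_less_eq length_Cons)
    then show "\<sigma>1 b (int i) = bit_symbol (w ! i)" by (simp add: \<sigma>1_def t_def act_def add.commute)
  next
    have "\<sigma> b (int (length (c # w))) = 0" using Cons.prems(1) unfolding output_is_def by blast
    then show "\<sigma>1 b (int (length w)) = 0" by (simp add: \<sigma>1_def t_def act_def add.commute)
  qed
  have "\<sigma>1 1 = stk (c # v)" using Cons.prems(3) by (simp add: \<sigma>1_def)
  from Cons.IH[OF o1 this Cons.prems(3)] obtain t' where
    "exec (read_out b) \<sigma>1 (length w * 8 + 1) (\<sigma>1(b := t', 1 := stk (rev w @ c # v)))"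
    by blast
  moreover have "\<sigma> b 0 \<noteq> 0" using c0 by (simp add: bit_symbol_def)
  ultimately have "exec (read_out b) \<sigma> (3 + 1 + 1 + 1 + (length w * 8 + 1) + 2) (\<sigma>1(b := t', 1 :=
    stk (rev w @ c # v)))"
    unfolding read_out_def by (intro exec_While_step)
  then have "exec (read_out b) \<sigma> (length (c # w) * 8 + 1) (\<sigma>(b := t', 1 := stk (rev (c # w) @ v)))"
    by (rule exec_eq) (use Cons.prems(3) in \<open>auto simp: \<sigma>1_def fun_eq_iff\<close>)
  then show ?case by blast
qed

text \<open>
  Tape 0 holds the input, tape 1 the output of \<open>M\<close> in reverse, tape 5 the printed strings in reverse;
  \<open>M\<close> runs on the tapes from \<open>B\<close> on.
\<close>

definition pipeline :: "nat \<Rightarrow> lp \<Rightarrow> tm \<Rightarrow> lp \<Rightarrow> com" where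
  "pipeline B c M c' = Seq (compile c 5) (Seq (mv 5 B) (Seq (Run M B 0) (Seq (read_out B)
     (Seq (compile c' 5) (Seq (clear 0) (Branch 5 (Push 0 True) (Push 0 False) (Push 0 False)))))))"

definition env :: "bool list \<Rightarrow> bool list \<Rightarrow> nat \<Rightarrow> bool list" where
  "env x y = (\<lambda>_. [])(0 := x, 1 := y)"

lemma env_simps [simp]: "env x y 0 = x" "env x y (Suc 0) = y"
  by (auto simp: env_def)

text \<open>Moving tape 5 to tape \<open>B\<close> undoes the reversal of the printed string, so
  \<open>M\<close> finds exactly its initial configuration. The second program reports violations,
  so the verdict is \<open>True\<close> precisely if it prints nothing.\<close>

lemma exec_pipeline:
  assumes B: "6 \<le> B" and M: "wf_tm M"
    and c: "realized B c {0} 6 p" and c': "realized B c' {0, 1} 6 p'"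
    and run: "computes_within M (out c (env x [])) w n" and w: "length w \<le> n"
  defines "z \<equiv> out c (env x [])"
  shows "\<exists>\<sigma>'. exec (pipeline B c M c') ((\<lambda>_. stk [])(0 := stk x))
      (9 * poly p (length x) + 9 * n + poly p' (length x + n) + 5 * length x + 30) \<sigma>' \<and>
    output_is (\<sigma>' 0) [out c' (env x (rev w)) = []] \<and> length z \<le> poly p (length x)"
proof -
  let ?k = "num_tapes M" and ?n = "length x"
  define \<sigma>0 :: "nat \<Rightarrow> tape" where "\<sigma>0 = (\<lambda>_. stk [])(0 := stk x)"
  define \<sigma>1 where "\<sigma>1 = \<sigma>0(B := stk z)"
  have L0: "layout B {0} 6 5 (env x []) \<sigma>0" by (auto simp: layout_def \<sigma>0_def)
  have c5: "\<sigma>0 5 = stk []" by (simp add: \<sigma>0_def)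
  have "\<And>v. v \<in> {0} \<Longrightarrow> length (env x [] v) \<le> ?n" by simp
  note r1 = realizedD[OF c L0 c5 this]
  have len: "length z \<le> poly p ?n" unfolding z_def by (rule r1(2))
  have e1: "exec (compile c 5) \<sigma>0 (poly p ?n) (\<sigma>0(5 := stk (rev z)))"
    using r1(1) by (simp add: z_def)
  have e2: "exec (mv 5 B) (\<sigma>0(5 := stk (rev z))) (length (rev z) * 8 + 1) \<sigma>1"
    by (rule exec_eq[OF exec_mv[where xs = "rev z" and w = "[]"]])
      (use B in \<open>auto simp: \<sigma>0_def \<sigma>1_def fun_eq_iff\<close>)
  have "1 \<le> ?k" using M by (simp add: wf_tm_def)
  then have "map \<sigma>1 [B..<B + ?k] = stk z # replicate (?k - 1) (\<lambda>_. 0)"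
    using B by (auto simp: \<sigma>1_def \<sigma>0_def nth_Cons' input_tape_def intro!: nth_equalityI)
  then have in_it: "(0, map \<sigma>1 [B..<B + ?k]) = init M z" by (simp add: init_def)
  obtain ts where ts: "(step M ^^ n) (0, map \<sigma>1 [B..<B + ?k]) = (1, ts)" "output_is (hd ts) w"
    using run unfolding computes_within_def in_it z_def by (auto split: prod.splits)
  define \<sigma>2 where "\<sigma>2 = (\<lambda>r. if B \<le> r \<and> r < B + ?k then ts ! (r - B) else \<sigma>1 r)"
  have sym: "range (\<sigma>1 r) \<subseteq> {..<num_symbols M}" for r
    using M by (auto simp: \<sigma>1_def \<sigma>0_def wf_tm_def input_tape_def bit_symbol_def)
  have q0: "0 < num_states M" using M by (simp add: wf_tm_def)
  have lts: "length ts = ?k" and e3: "exec (Run M B 0) \<sigma>1 (n + 1) \<sigma>2"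
    using exec_Run[OF M q0 sym ts(1)] by (auto simp: \<sigma>2_def)
  have "\<sigma>2 B = hd ts" using \<open>1 \<le> ?k\<close> lts by (cases ts) (auto simp: \<sigma>2_def)
  then obtain t where e4: "exec (read_out B) \<sigma>2 (length w * 8 + 1) (\<sigma>2(B := t, 1 := stk (rev w @ [])))"
    using exec_read_out[of \<sigma>2 B w "[]"] ts(2) B by (auto simp: \<sigma>2_def \<sigma>1_def \<sigma>0_def)
  let ?e = "env x (rev w)"
  define \<sigma>3 where "\<sigma>3 = \<sigma>2(B := t, 1 := stk (rev w @ []))"
  have s3: "\<sigma>3 0 = stk x" "\<sigma>3 1 = stk (rev w)" "\<And>v. v \<in> {2..<B} \<Longrightarrow> \<sigma>3 v = stk []"
    using B by (auto simp: \<sigma>3_def \<sigma>2_def \<sigma>1_def \<sigma>0_def)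
  have L3: "layout B {0, 1} 6 5 ?e \<sigma>3"
    using s3 B unfolding layout_def by auto
  have s35: "\<sigma>3 5 = stk []" using s3 B by auto
  have "\<And>v. v \<in> {0, 1} \<Longrightarrow> length (?e v) \<le> ?n + n" using w by auto
  note r5 = realizedD(1)[OF c' L3 s35 this]
  define \<sigma>4 where "\<sigma>4 = \<sigma>3(5 := stk (rev (out c' ?e)))"
  have e5: "exec (compile c' 5) \<sigma>3 (poly p' (?n + n)) \<sigma>4"
    using r5 by (simp add: \<sigma>4_def)
  have e6: "exec (clear 0) \<sigma>4 (?n * 5 + 1) (\<sigma>4(0 := stk []))"
    by (rule exec_clear) (simp add: \<sigma>4_def s3)
  let ?\<sigma> = "\<sigma>4(0 := stk [out c' ?e = []])"
  have e7: "exec (Branch 5 (Push 0 True) (Push 0 False) (Push 0 False)) (\<sigma>4(0 := stk [])) (3 + 1) ?\<sigma>"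
  proof (rule exec_Branch_stk)
    have "exec (Push 0 (out c' ?e = [])) (\<sigma>4(0 := stk [])) 3 ?\<sigma>"
      by (rule exec_eq[OF exec_Push[where w = "[]"]]) auto
    then show "exec (case rev (out c' ?e) of [] \<Rightarrow> Push 0 True | b # _ \<Rightarrow> if b then Push
      0 False else Push 0 False)
        (\<sigma>4(0 := stk [])) 3 ?\<sigma>"
      by (cases "rev (out c' ?e)") auto
  qed (simp add: \<sigma>4_def)
  have "exec (pipeline B c M c') \<sigma>0
    (9 * poly p ?n + 9 * n + poly p' (?n + n) + 5 * ?n + 30) ?\<sigma>"
    unfolding pipeline_def
    by (rule exec_mono[OF exec_Seq[OF e1 exec_Seq[OF e2 exec_Seq[OF e3 exec_Seq[OF e4 exec_Seq[OF
             e5[unfolded \<sigma>3_def] exec_Seq[OF e6 e7]]]]]]])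
      (use len w in auto)
  moreover have "output_is (?\<sigma> 0) [out c' ?e = []]"
    by (auto simp: output_is_def input_tape_def)
  ultimately show ?thesis using len by (auto simp: \<sigma>0_def)
qed

text \<open>A reduction with a single call of \<open>M\<close>, which only has to behave well on
  strings printed by \<open>c\<close>. The answer \<open>w\<close> is merely asserted to exist for
  each \<open>x\<close>, as suits an approximation algorithm with several admissible answers. Its
  length is bounded separately because a machine that halts at once leaves its whole input as
  output.\<close>

theorem class_P_pipeline:
  assumes wf: "wf_lp B c {0} 6" "wf_lp B' c' {0, 1} 6" and M: "wf_tm M"
    and run: "\<And>x. \<exists>w. computes_within M (out c (env x [])) w (poly p (length (out c (env x [])))) \<and>
      length w \<le> poly p (length (out c (env x []))) \<and> (x \<in> L \<longleftrightarrow> out c' (env x (rev w)) = [])"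
  shows "L \<in> class_P"
proof -
  define C where "C = max 6 (max B B')"
  have wfC: "wf_lp C c {0} 6" "wf_lp C c' {0, 1} 6"
    using wf wf_lp_mono by (auto simp: C_def)
  obtain q q' where q: "realized C c {0} 6 q" "realized C c' {0, 1} 6 q'"
    using lp_realized wfC by meson
  let ?K = "C + num_tapes M" and ?G = "num_symbols M"
  have C6: "6 \<le> C" by (simp add: C_def)
  have G: "3 \<le> ?G" "1 \<le> num_tapes M" "0 < num_states M" using M by (auto simp: wf_tm_def)
  have "wf_com ?K ?G (compile c 5)" "wf_com ?K ?G (compile c' 5)"
    by (rule wf_com_compile[OF wfC(1)] wf_com_compile[OF wfC(2)]; use C6 G in auto)+
  then have "wf_com ?K ?G (pipeline C c M c')"
    using C6 G M by (simp add: pipeline_def read_out_def wf_com_stack)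
  moreover have "pipeline C c M c' \<noteq> Skip" by (simp add: pipeline_def)
  ultimately obtain N where N: "wf_tm N"
    "\<And>x n \<sigma>' w. exec (pipeline C c M c') ((\<lambda>_. stk [])(0 := stk x)) n \<sigma>'
      \<Longrightarrow> output_is (\<sigma>' 0) w \<Longrightarrow>
       computes_within N x w n"
    using tm_of_com[of ?K ?G] G C6 by (metis le_add2 le_trans)
  define s where "s = pcompose p q"
  define P where "P = [:9:] * q + [:9:] * s + pcompose q' ([:0, 1:] + s) + [:30, 5:]"
  have "computes_within N x [x \<in> L] (poly P (length x))" for x
  proof -
    let ?z = "out c (env x [])"
    obtain w where w: "computes_within M ?z w (poly p (length ?z))" "length w \<le> poly p (length ?z)"
      "x \<in> L \<longleftrightarrow> out c' (env x (rev w)) = []" using run by blast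
    from exec_pipeline[OF C6 M q w(1,2)] obtain \<sigma>' where
      e: "exec (pipeline C c M c') ((\<lambda>_. stk [])(0 := stk x))
        (9 * poly q (length x) + 9 * poly p (length ?z) + poly q' (length x + poly p (length ?z)) + 5 * length x + 30) \<sigma>'"
      "output_is (\<sigma>' 0) [out c' (env x (rev w)) = []]" "length ?z \<le> poly q (length x)" by auto
    have le: "poly p (length ?z) \<le> poly s (length x)"
      using poly_nat_mono[OF e(3)] by (simp add: s_def poly_pcompose)
    have "poly q' (length x + poly p (length ?z)) \<le> poly q' (length x + poly s (length x))"
      using le by (intro poly_nat_mono) simp
    then have "exec (pipeline C c M c') ((\<lambda>_. stk [])(0 := stk x)) (poly P (length x)) \<sigma>'"
      by (intro exec_mono[OF e(1)]) (use le in \<open>simp add: P_def poly_pcompose\<close>)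
    then show ?thesis using N(2) e(2) w(3) by simp
  qed
  then show ?thesis using N(1) unfolding class_P_def by blast
qed

subsection \<open>Derived constructs\<close>

definition seqs :: "lp list \<Rightarrow> lp" where
  "seqs cs = foldr Then cs Quiet"

lemma out_seqs [simp]: "out (seqs cs) e = concat (map (\<lambda>c. out c e) cs)"
  by (induction cs) (auto simp: seqs_def)

lemma wf_seqs [simp]: "wf_lp B (seqs cs) A d \<longleftrightarrow> (\<forall>c\<in>set cs. wf_lp B c A d)"
  by (induction cs) (auto simp: seqs_def)

definition emits :: "bool list \<Rightarrow> lp" where
  "emits w = seqs (map Emit w)"

lemma out_emits [simp]: "out (emits w) e = w"
  by (induction w) (auto simp: emits_def)

lemma wf_emits [simp]: "wf_lp B (emits w) A d"
  by (auto simp: emits_def)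

definition Rep :: "nat \<Rightarrow> nat \<Rightarrow> lp \<Rightarrow> lp" where
  "Rep i v c = For i v c c"

lemma wf_Rep [simp]:
  "wf_lp B (Rep i v c) A d \<longleftrightarrow> v \<in> A \<and> d \<le> i \<and> i < B \<and> wf_lp B c (insert i A) (Suc i)"
  by (simp add: Rep_def)

lemma out_Rep:
  assumes "\<And>s. length s < length (e v) \<Longrightarrow> out c (e(i := s)) = f (length s)"
  shows "out (Rep i v c) e = concat (map f (rev [0..<length (e v)]))"
proof -
  have "concat (map (\<lambda>(b, s). (if b then out c else out c) (e(i := s))) (splits xs))
      = concat (map f (rev [0..<length xs]))" if "length xs \<le> length (e v)" for xs
    using that assms by (induction xs) auto
  then show ?thesis by (simp add: Rep_def)
qed

lemma concat_map_replicate: "concat (map (\<lambda>x. replicate (f x) a) xs) = replicate (sum_list (map f xs)) a"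
  by (induction xs) (auto simp: replicate_add)

lemma sum_list_map_const: "sum_list (map (\<lambda>x. k) xs) = length xs * (k :: nat)"
  by (induction xs) auto

section \<open>Conditions on lengths and bits, and polynomials in unary\<close>

datatype cnd = Cst bool | Lt nat nat | At nat nat | Neg cnd | Conj cnd cnd

primrec holds :: "(nat \<Rightarrow> bool list) \<Rightarrow> cnd \<Rightarrow> bool" where
  "holds e (Cst b) \<longleftrightarrow> b"
| "holds e (Lt u v) \<longleftrightarrow> length (e u) < length (e v)"
| "holds e (At u v) \<longleftrightarrow> length (e u) < length (e v) \<and> e v ! length (e u)"
| "holds e (Neg c) \<longleftrightarrow> \<not> holds e c"
| "holds e (Conj c d) \<longleftrightarrow> holds e c \<and> holds e d"

primrec cvars :: "cnd \<Rightarrow> nat set" where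
  "cvars (Cst b) = {}"
| "cvars (Lt u v) = {u, v}"
| "cvars (At u v) = {u, v}"
| "cvars (Neg c) = cvars c"
| "cvars (Conj c d) = cvars c \<union> cvars d"

text \<open>A conjunction duplicates the program for the negative case. This affects only the size
  of the program, which does not depend on the input.\<close>

primrec ite :: "cnd \<Rightarrow> lp \<Rightarrow> lp \<Rightarrow> lp" where
  "ite (Cst b) = (\<lambda>P Q. if b then P else Q)"
| "ite (Lt u v) = (\<lambda>P Q. IfDrop u v Q P P)"
| "ite (At u v) = (\<lambda>P Q. IfDrop u v Q Q P)"
| "ite (Neg c) = (\<lambda>P Q. ite c Q P)"
| "ite (Conj c d) = (\<lambda>P Q. ite c (ite d P Q) Q)"

declare ite.simps [simp del]

lemma out_ite [simp]: "out (ite c P Q) e = (if holds e c then out P e else out Q e)"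
proof (induction c arbitrary: P Q)
  case (Lt u v)
  then show ?case by (auto simp: ite.simps split: list.splits)
next
  case (At u v)
  show ?case
  proof (cases "length (e u) < length (e v)")
    case True
    then show ?thesis by (simp add: ite.simps Cons_nth_drop_Suc[symmetric])
  qed (auto simp: ite.simps)
qed (auto simp: ite.simps)

lemma wf_ite [intro]:
  "cvars c \<subseteq> A \<Longrightarrow> wf_lp B P A d \<Longrightarrow> wf_lp B Q A d \<Longrightarrow>
    wf_lp B (ite c P Q) A d"
  by (induction c arbitrary: P Q) (auto simp: ite.simps)

definition Imp :: "cnd \<Rightarrow> cnd \<Rightarrow> cnd" where
  "Imp c d = Neg (Conj c (Neg d))"

definition Eq :: "nat \<Rightarrow> nat \<Rightarrow> cnd" where
  "Eq u v = Conj (Neg (Lt u v)) (Neg (Lt v u))"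

lemma holds_derived [simp]:
  "holds e (Imp c d) \<longleftrightarrow> (holds e c \<longrightarrow> holds e d)"
  "holds e (Eq u v) \<longleftrightarrow> length (e u) = length (e v)"
  "cvars (Imp c d) = cvars c \<union> cvars d" "cvars (Eq u v) = {u, v}"
  by (auto simp: Imp_def Eq_def)

text \<open>Horner's scheme in unary: \<open>a\<close> marks, followed by one copy of the value of
  the remaining coefficients for every element of \<open>v\<close>. The nested loops use the
  counters from \<open>d\<close> on.\<close>

fun upoly :: "nat list \<Rightarrow> nat \<Rightarrow> nat \<Rightarrow> lp" where
  "upoly [] v d = Quiet"
| "upoly (a # as) v d = Then (emits (replicate a True)) (Rep d v (upoly as v (Suc d)))"

lemma poly_foldr: "poly p x = foldr (\<lambda>a r. a + x * r) (coeffs p) 0" for p :: "nat poly"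
  by (induction p) (auto simp: cCons_def)

lemma out_upoly: "v < d \<Longrightarrow> out (upoly as v d) e = replicate (foldr (\<lambda>a r. a + length (e v) * r) as 0) True"
proof (induction as arbitrary: d e)
  case (Cons a as)
  have "out (Rep d v (upoly as v (Suc d))) e
      = concat (map (\<lambda>_. replicate (foldr (\<lambda>a r. a + length (e v) * r) as 0) True) (rev [0..<length (e v)]))"
    by (rule out_Rep) (use Cons in simp)
  then show ?case by (simp add: concat_map_replicate sum_list_map_const replicate_add)
qed simp

lemma out_upoly_coeffs [simp]: "v < d \<Longrightarrow> out (upoly (coeffs p) v d) e = replicate (poly p (length (e v))) True"
  by (simp add: out_upoly poly_foldr)

lemma wf_upoly: "v \<in> A \<Longrightarrow> d + length as \<le> B \<Longrightarrow> wf_lp B (upoly as v d) A d"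
  by (induction as arbitrary: d A) auto

subsection \<open>Preimages of languages in P\<close>

lemma computes_within_mono:
  assumes "computes_within M x w n" "n \<le> m"
  shows "computes_within M x w m"
proof -
  obtain ts where ts: "(step M ^^ n) (init M x) = (1, ts)" "output_is (hd ts) w"
    using assms(1) unfolding computes_within_def by (auto split: prod.splits)
  have "(step M ^^ k) (1, ts) = (1, ts)" for k
    by (induction k) (auto simp: step_def)
  then have "(step M ^^ (m - n + n)) (init M x) = (1, ts)"
    using ts(1) by (simp only: funpow_add comp_apply)
  then show ?thesis using assms(2) ts(2) by (simp add: computes_within_def)
qed

lemma class_P_vimage:
  assumes c: "wf_lp B c {0} 6" and L: "L \<in> class_P"
  shows "{x. out c (env x []) \<in> L} \<in> class_P"
proof -
  obtain M p where M: "wf_tm M" "\<And>x. computes_within M x [x \<in> L] (poly p (length x))"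
    using L unfolding class_P_def by blast
  \<comment> \<open>Variable 6 is empty, so the first bit of the answer is inspected; silence, which
    means acceptance, follows only if it is \<open>True\<close>. The polynomial \<open>p + 1\<close>
    below leaves room for an answer of length 1 even where \<open>p\<close> vanishes.\<close>
  let ?acc = "Bind 6 Quiet (IfDrop 6 1 (Emit True) (Emit True) Quiet)"
  show ?thesis
  proof (rule class_P_pipeline[OF c _ M(1), where B' = 7 and c' = ?acc and p = "p + 1"])
    fix x
    let ?z = "out c (env x [])"
    show "\<exists>w. computes_within M ?z w (poly (p + 1) (length ?z)) \<and> length w \<le> poly (p + 1) (length ?z) \<and>
       (x \<in> {x. out c (env x []) \<in> L} \<longleftrightarrow> out ?acc (env x (rev w)) = [])"
      using computes_within_mono[OF M(2)[of ?z], of "poly (p + 1) (length ?z)"] by (intro exI[of _ "[?z \<in> L]"]) auto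
  qed auto
qed

text \<open>Bit \<open>k\<close> of the encoded word is at position \<open>2 * k + 1\<close> of its
  code. The outer counter \<open>l\<close> runs downwards, so \<open>k = n - 1 - l\<close> for a
  code of length \<open>n\<close>, and this is the number of values of the inner counter above
  \<open>l\<close>; each of them contributes two marks to variable 7.\<close>

definition undelimit :: lp where
  "undelimit = Rep 6 0 (Bind 7 (Then (Emit True) (Rep 8 0 (ite (Lt 6 8) (emits [True, True]) Quiet)))
     (IfDrop 7 0 Quiet (Emit False) (Emit True)))"

lemma drop_self_delimiting:
  "(case drop (Suc (2 * k)) (self_delimiting x) of [] \<Rightarrow> [] | b # _ \<Rightarrow> [b]) = (if k <
    length x then [x ! k] else [])"
proof (induction x arbitrary: k)
  case (Cons b x)
  then show ?case by (cases k) (auto simp: self_delimiting_def)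
qed (simp add: self_delimiting_def)

lemma out_undelimit: "out undelimit (env (self_delimiting x) y) = x"
proof -
  let ?z = "self_delimiting x"
  let ?n = "length ?z"
  define f where "f l = (case drop (2 * (?n - 1 - l) + 1) ?z of [] \<Rightarrow> [] | b # _ \<Rightarrow> [b])" for l
  have count: "out (Rep 8 0 (ite (Lt 6 8) (emits [True, True]) Quiet)) e
      = replicate (2 * (length (e 0) - 1 - length (e 6))) True" for e
  proof -
    have "sum_list (map (\<lambda>l. if length (e 6) < l then 2 else 0) (rev [0..<m])) = 2 * (m - 1 - length (e 6))" for m
      by (induction m) auto
    then show ?thesis
      by (subst out_Rep[where f = "\<lambda>l. replicate (if length (e 6) < l then 2 else 0) True"])
        (auto simp: numeral_2_eq_2 concat_map_replicate)
  qed
  have "out undelimit (env ?z y) = concat (map f (rev [0..<?n]))"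
    unfolding undelimit_def
    by (subst out_Rep[where f = f]) (auto simp: count f_def split: list.splits)
  also have "map f (rev [0..<?n]) = map (\<lambda>k. if k < length x then [x ! k] else []) [0..<?n]"
    by (rule nth_equalityI) (auto simp: rev_nth f_def drop_self_delimiting)
  also have "[0..<?n] = [0..<length x] @ [length x..<?n]"
    using upt_add_eq_append[of 0 "length x" "?n - length x"] by (simp add: length_self_delimiting mult_2)
  also have "concat (map (\<lambda>k. if k < length x then [x ! k] else []) \<dots>) = map ((!) x) [0..<length x]"
  proof -
    have 1: "map (\<lambda>k. if k < length x then [x ! k] else []) [0..<length x] = map (\<lambda>k. [x ! k]) [0..<length x]"
      by simp
    have 2: "concat (map (\<lambda>k. if k < length x then [x ! k] else []) [length x..<?n]) = []"
      by auto
    show ?thesis by (simp only: map_append concat_append 1 2) (simp add: concat_map_singleton)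
  qed
  finally show ?thesis by (simp add: map_nth)
qed

text \<open>The hypothesis that P and NP differ is refuted only by equality, so the easy inclusion
  is required too. The zero polynomial admits just the empty certificate, and the verifier decodes
  the pair before it decides.\<close>

lemma P_subset_NP: "class_P \<subseteq> class_NP"
proof
  fix L assume "L \<in> class_P"
  moreover have "wf_lp 9 undelimit {0} 6" by (auto simp: undelimit_def)
  ultimately have V: "{z. out undelimit (env z []) \<in> L} \<in> class_P" by (intro class_P_vimage)
  have "x \<in> L \<longleftrightarrow> (\<exists>y. length y \<le> poly 0 (length x) \<and> encode_pair x y
    \<in> {z. out undelimit (env z []) \<in> L})" for x
    by (simp add: encode_pair_def out_undelimit)
  then show "L \<in> class_NP"
    unfolding class_NP_def using V by blast
qed

subsection \<open>Certificates of fixed length\<close>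

text \<open>A certificate of length at most \<open>m\<close> is padded to length \<open>m + 1\<close> by
  \<open>True\<close> and a number of \<open>False\<close>.\<close>

definition unpad :: "bool list \<Rightarrow> bool list" where
  "unpad v = concat (map (\<lambda>(b, s). if True \<in> set s then [b] else []) (splits v))"

lemma unpad_pad: "unpad (y @ True # replicate k False) = y"
proof -
  have "unpad (replicate k False) = []" by (induction k) (auto simp: unpad_def)
  then have "unpad (True # replicate k False) = []" by (auto simp: unpad_def)
  then show ?thesis by (induction y) (auto simp: unpad_def)
qed

lemma length_unpad: "length (unpad v) \<le> length v - 1"
proof (induction v)
  case (Cons b v)
  then show ?case by (cases v) (auto simp: unpad_def)
qed (simp add: unpad_def)

text \<open>The boundary between input and certificate is not marked. Variable 7 tries all lengths
  \<open>n\<close> of the input, and variable 9 holds \<open>n + p n\<close> for comparison with the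
  total length. A position belongs to the certificate if fewer than \<open>p n\<close> elements
  follow it; variable 11 collects the bits \<open>True\<close> among these, as \<open>unpad\<close>
  asks whether there is one.\<close>

definition repack :: "nat poly \<Rightarrow> lp" where
  "repack p = Bind 6 Quiet (Rep 7 0 (Bind 8 (upoly (coeffs p) 7 9)
     (Bind 9 (Then (Rep 10 7 (Emit True)) (Rep 10 8 (Emit True)))
       (ite (Eq 9 0)
         (seqs [For 10 0 (ite (Lt 10 8) Quiet (emits [True, False])) (ite (Lt 10 8) Quiet (emits [True, True])),
            Emit False,
            For 10 0
              (ite (Lt 10 8) (Bind 11 (For 12 10 Quiet (Emit True)) (ite (Lt 6 11) (Emit False) Quiet)) Quiet)
              (ite (Lt 10 8) (Bind 11 (For 12 10 Quiet (Emit True)) (ite (Lt 6 11) (Emit True) Quiet)) Quiet)])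
         Quiet))))"

lemma wf_repack: "wf_lp (13 + length (coeffs p)) (repack p) {0} 6"
  by (auto simp: repack_def intro!: wf_ite wf_upoly)

lemma splits_mem: "(b, s) \<in> set (splits xs) \<Longrightarrow> length s < length xs"
  by (induction xs) auto

lemma concat_single:
  assumes "n < m" "\<And>k. k < m \<Longrightarrow> k \<noteq> n \<Longrightarrow> f k = []"
  shows "concat (map f (rev [0..<m])) = f n"
proof -
  have "concat (map f (rev [0..<m])) = (if n < m then f n else [])" if "\<And>k. k < m \<Longrightarrow> k
    \<noteq> n \<Longrightarrow> f k = []" for m
    using that by (induction m) (auto simp: less_Suc_eq)
  then show ?thesis using assms by auto
qed

lemma out_repack:
  assumes v: "length v = poly p (length x)" "0 < length v"
  shows "out (repack p) (env (x @ v) y) = encode_pair x (unpad v)"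
proof -
  let ?z = "x @ v" and ?n = "length x"
  let ?r = "\<lambda>n. poly p n"
  define body where "body n = concat (map (\<lambda>(b, s). if length s < ?r n then [] else [True, b]) (splits ?z)) @ [False] @
     concat (map (\<lambda>(b, s). if length s < ?r n then if True \<in> set s then [b] else [] else []) (splits ?z))" for n
  define f where "f n = (if n + ?r n = length ?z then body n else [])" for n
  have trues: "out (For 12 10 Quiet (Emit True)) e = filter (\<lambda>b. b) (e 10)" for e
  proof -
    have "concat (map (\<lambda>(b, s). (if b then out (Emit True) else out Quiet) (e(12 := s))) (splits xs))
        = filter (\<lambda>b. b) xs" for xs
      by (induction xs) auto
    then show ?thesis by simp
  qed
  have front: "out (For 10 0 (ite (Lt 10 8) Quiet (emits [True, False])) (ite (Lt 10 8) Quiet (emits [True, True]))) e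
     = concat (map (\<lambda>(b, s). if length s < length (e 8) then [] else [True, b]) (splits (e 0)))" for e
    unfolding out.simps(4) by (intro arg_cong[of _ _ concat] map_cong refl) auto
  have rear: "out (For 10 0
        (ite (Lt 10 8) (Bind 11 (For 12 10 Quiet (Emit True)) (ite (Lt 6 11) (Emit False) Quiet)) Quiet)
        (ite (Lt 10 8) (Bind 11 (For 12 10 Quiet (Emit True)) (ite (Lt 6 11) (Emit True) Quiet)) Quiet)) e
     = concat (map (\<lambda>(b, s). if length s < length (e 8) then if True \<in> set s then [b] else [] else
       []) (splits (e 0)))"
    if "e 6 = []" for e
    unfolding out.simps(4) using that
    by (intro arg_cong[of _ _ concat] map_cong refl) (auto simp: trues filter_empty_conv simp del: out.simps(4))
  have units: "out (Rep 10 u (Emit True)) e = replicate (length (e u)) True" for u e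
    by (subst out_Rep[where f = "\<lambda>_. [True]"]) (auto simp: map_replicate_const)
  have "out (repack p) (env ?z y) = concat (map f (rev [0..<length ?z]))"
    unfolding repack_def out.simps(1,6)
  proof (subst out_Rep[where f = f])
    fix s :: "bool list"
    let ?body = "seqs [For 10 0 (ite (Lt 10 8) Quiet (emits [True, False])) (ite (Lt 10 8) Quiet (emits [True, True])),
            Emit False,
            For 10 0
              (ite (Lt 10 8) (Bind 11 (For 12 10 Quiet (Emit True)) (ite (Lt 6 11) (Emit False) Quiet)) Quiet)
              (ite (Lt 10 8) (Bind 11 (For 12 10 Quiet (Emit True)) (ite (Lt 6 11) (Emit True) Quiet)) Quiet)]"
    show "out (Bind 8 (upoly (coeffs p) 7 9)
     (Bind 9 (Then (Rep 10 7 (Emit True)) (Rep 10 8 (Emit True))) (ite (Eq 9 0) ?body Quiet)))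
        ((env ?z y)(6 := rev [], 7 := s)) = f (length s)"
      by (simp add: front rear units f_def body_def del: out.simps(4))
  qed simp
  \<comment> \<open>\<open>n + p n\<close> is strictly increasing, so only the true length passes
    the test. It is below the total length, and hence among the values tried, because the
    certificate is not empty.\<close>
  also have "\<dots> = f ?n"
  proof (rule concat_single)
    fix k assume "k \<noteq> ?n"
    then consider "k < ?n" | "?n < k" by linarith
    then have "k + ?r k \<noteq> ?n + ?r ?n"
      by cases (use poly_nat_mono[of k ?n p] poly_nat_mono[of ?n k p] in linarith)+
    then show "f k = []" using v by (simp add: f_def)
  qed (use v in auto)
  also have "\<dots> = body ?n" using v by (simp add: f_def)
  also have "\<dots> = encode_pair x (unpad v)"
  proof -
    have 1: "map (\<lambda>(b, s). if length s < ?r ?n then [] else [True, b]) (map (\<lambda>(b, s). (b, s @ v)) (splits x))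
        = map (\<lambda>(b, s). [True, b]) (splits x)"
      using v by (auto simp: case_prod_unfold)
    have lt: "length s < ?r ?n" if "(b, s) \<in> set (splits v)" for b s
      using splits_mem[OF that] v by simp
    have 2: "map (\<lambda>(b, s). if length s < ?r ?n then [] else [True, b]) (splits v) = map (\<lambda>_. []) (splits v)"
      using lt by (auto simp: case_prod_unfold)
    have 3: "map (\<lambda>(b, s). if length s < ?r ?n then if True \<in> set s then [b] else [] else [])
       (map (\<lambda>(b, s). (b, s @ v)) (splits x)) = map (\<lambda>_. []) (splits x)"
      using v by (auto simp: case_prod_unfold)
    have 4: "map (\<lambda>(b, s). if length s < ?r ?n then if True \<in> set s then [b] else [] else []) (splits v)
       = map (\<lambda>(b, s). if True \<in> set s then [b] else []) (splits v)"
      using lt by (auto simp: case_prod_unfold)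
    have 5: "concat (map (\<lambda>(b, s). [True, b]) (splits x)) = concat (map (\<lambda>b. [True, b]) x)"
      by (induction x) auto
    have 6: "concat (map (\<lambda>_. []) ys) = []" for ys :: "'z list" by (induction ys) auto
    show ?thesis
      by (simp only: body_def splits_append map_append concat_append 1 2 3 4 5 6)
        (simp add: encode_pair_def self_delimiting_def unpad_def)
  qed
  finally show ?thesis .
qed

text \<open>With certificates of a fixed length, the running time of the verifier and the size of
  the tableau depend on \<open>length x\<close> only. Plain concatenation puts \<open>x\<close> and
  the certificate on adjacent stretches of the input tape, where unary constraints can describe
  them.\<close>

lemma class_NP_padded:
  assumes "L \<in> class_NP"
  obtains V p where "V \<in> class_P" "\<And>x. x \<in> L \<longleftrightarrow> (\<exists>v. length v = poly p
    (length x) \<and> x @ v \<in> V)"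
proof -
  obtain W p where W: "W \<in> class_P" and
    L: "\<And>x. x \<in> L \<longleftrightarrow> (\<exists>y. length y \<le> poly p (length x) \<and> encode_pair x y \<in> W)"
    using assms unfolding class_NP_def by blast
  define V where "V = {z. out (repack (p + 1)) (env z []) \<in> W}"
  have "V \<in> class_P" unfolding V_def by (rule class_P_vimage[OF wf_repack W])
  moreover have "x \<in> L \<longleftrightarrow> (\<exists>v. length v = poly (p + 1) (length x) \<and> x @ v \<in> V)" for x
  proof -
    have V: "x @ v \<in> V \<longleftrightarrow> encode_pair x (unpad v) \<in> W" if "length v = poly (p + 1) (length x)" for v
      using out_repack[OF that] that by (simp add: V_def)
    show ?thesis
    proof
      assume "x \<in> L"
      then obtain y where y: "length y \<le> poly p (length x)" "encode_pair x y \<in> W" using L by blast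
      let ?v = "y @ True # replicate (poly p (length x) - length y) False"
      have "length ?v = poly (p + 1) (length x)" using y by simp
      moreover from this have "x @ ?v \<in> V" using V y(2) by (simp add: unpad_pad)
      ultimately show "\<exists>v. length v = poly (p + 1) (length x) \<and> x @ v \<in> V" by blast
    next
      assume "\<exists>v. length v = poly (p + 1) (length x) \<and> x @ v \<in> V"
      then obtain v where v: "length v = poly (p + 1) (length x)" "x @ v \<in> V" by blast
      then have "length (unpad v) \<le> poly p (length x)" using length_unpad[of v] by simp
      then show "x \<in> L" using V v L by blast
    qed
  qed
  ultimately show thesis using that by blast
qed

section \<open>Computation tableaux\<close>

text \<open>
  Cell \<open>(t, i)\<close> of a tableau describes position \<open>i - W\<close> relative to the heads at time
    \<open>t\<close>. Its value
  consists of the symbols at this position together with the state and the symbols under the heads.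
  The latter are the same for all cells of a row; they make the dependence of a cell on the
  previous row a binary constraint.
\<close>

type_synonym cell = "nat \<times> nat list \<times> nat list"

definition cells :: "tm \<Rightarrow> cell set" where
  "cells N = {..<num_states N} \<times>
     {rs. set rs \<subseteq> {..<num_symbols N} \<and> length rs = num_tapes N} \<times>
     {ss. set ss \<subseteq> {..<num_symbols N} \<and> length ss = num_tapes N}"

text \<open>\<^const>\<open>step\<close> does nothing in the halting state; this is the same as rewriting the
  symbols read.\<close>

definition next_of :: "tm \<Rightarrow> nat \<Rightarrow> nat list \<Rightarrow> nat \<times> (nat \<times> move) list" where
  "next_of N q rs = (if q = 1 then (1, map (\<lambda>s. (s, Stay)) rs) else delta N q rs)"

text \<open>Column \<open>W\<close> is the one under the heads. In row 0 the bits behind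
  \<open>x\<close>, up to length \<open>e\<close>, are left free: they are the guessed certificate.
  The last row has to halt with symbol 2, the code of \<open>True\<close>, under the first
  head.\<close>

definition cell_ok :: "tm \<Rightarrow> bool list \<Rightarrow> nat \<Rightarrow> nat \<Rightarrow> nat
  \<Rightarrow> nat \<Rightarrow> nat \<Rightarrow> cell \<Rightarrow> bool" where
  "cell_ok N x e T W t i c = (case c of (q, rs, ss) \<Rightarrow>
     (i = W \<longrightarrow> ss = rs) \<and>
     (t = 0 \<longrightarrow> q = 0 \<and> (\<forall>j<num_tapes N. 0 < j \<longrightarrow> ss ! j = 0) \<and>
        (if i < W then ss ! 0 = 0
         else if i - W < length x then ss ! 0 = bit_symbol (x ! (i - W))
         else if i - W < e then ss ! 0 = 1 \<or> ss ! 0 = 2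
         else ss ! 0 = 0)) \<and>
     (t = T \<longrightarrow> q = 1 \<and> rs ! 0 = 2))"

text \<open>Tapes are described relative to the heads, so it is the contents that move: what is at
  \<open>i'\<close> after the move was at \<open>i\<close> before.\<close>

definition moved :: "move \<Rightarrow> nat \<Rightarrow> nat \<Rightarrow> bool" where
  "moved m i i' \<longleftrightarrow> int i = int i' + offset m"

definition link :: "tm \<Rightarrow> nat \<Rightarrow> nat \<Rightarrow> nat \<Rightarrow> cell \<Rightarrow>
  nat \<Rightarrow> nat \<Rightarrow> cell \<Rightarrow> bool" where
  "link N W t i c t' i' c' = (case c of (q, rs, ss) \<Rightarrow> case c' of (q', rs', ss') \<Rightarrow>
     (t' = t \<longrightarrow> q' = q \<and> rs' = rs) \<and>
     (t' = Suc t \<longrightarrow> q' = fst (next_of N q rs) \<and>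
       (\<forall>j<num_tapes N. moved (snd (snd (next_of N q rs) ! j)) i i' \<longrightarrow>
          ss' ! j = (if i = W then fst (snd (next_of N q rs) ! j) else ss ! j))))"

definition tableau :: "tm \<Rightarrow> bool list \<Rightarrow> nat \<Rightarrow> nat \<Rightarrow> nat
  \<Rightarrow> nat \<Rightarrow> (nat \<Rightarrow> nat \<Rightarrow> cell) \<Rightarrow> bool" where
  "tableau N x e T W R A \<longleftrightarrow>
     (\<forall>t\<le>T. \<forall>i<R. A t i \<in> cells N \<and> cell_ok N x e T W t i (A t i) \<and>
        (\<forall>t'\<le>T. \<forall>i'<R. link N W t i (A t i) t' i' (A t' i')))"

lemma finite_cells: "finite (cells N)"
  unfolding cells_def by (intro finite_cartesian_product finite_lists_length_eq) auto

section \<open>Tableaux and actual runs\<close>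

definition conf :: "tm \<Rightarrow> bool list \<Rightarrow> nat \<Rightarrow> nat \<times> tape list" where
  "conf N z t = (step N ^^ t) (init N z)"

text \<open>\<open>next_of\<close> gives one rule for running and halted configurations alike, so
  later arguments about consecutive rows need no case distinction on the state.\<close>

lemma conf_wf:
  assumes N: "wf_tm N"
  shows "fst (conf N z t) < num_states N \<and> length (snd (conf N z t)) = num_tapes N \<and>
    (\<forall>j<num_tapes N. range (snd (conf N z t) ! j) \<subseteq> {..<num_symbols N}) \<and>
    fst (conf N z (Suc t)) = fst (next_of N (fst (conf N z t)) (map (\<lambda>\<tau>. \<tau> 0) (snd (conf N z t)))) \<and>
    snd (conf N z (Suc t)) = map2 act (snd (next_of N (fst (conf N z t)) (map (\<lambda>\<tau>. \<tau> 0) (snd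
      (conf N z t))))) (snd (conf N z t)) \<and>
    length (snd (next_of N (fst (conf N z t)) (map (\<lambda>\<tau>. \<tau> 0) (snd (conf N z t))))) = num_tapes N"
proof -
  let ?k = "num_tapes N"
  define inv where "inv c \<longleftrightarrow> fst c < num_states N \<and> length (snd c) = ?k \<and>
    (\<forall>j<?k. range (snd c ! j) \<subseteq> {..<num_symbols N})" for c :: "nat \<times> tape list"
  define nx where "nx c = next_of N (fst c) (map (\<lambda>\<tau>. \<tau> 0) (snd c))" for c :: "nat \<times> tape list"
  have nx: "fst (nx c) < num_states N" "length (snd (nx c)) = ?k"
    "\<And>j. j < ?k \<Longrightarrow> fst (snd (nx c) ! j) < num_symbols N" if "inv c" for c
  proof -
    let ?rs = "map (\<lambda>\<tau>. \<tau> 0) (snd c)"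
    have r: "(snd c ! j) i < num_symbols N" if "j < ?k" for j i using \<open>inv c\<close> that by (auto simp: inv_def)
    have "set ?rs \<subseteq> {..<num_symbols N}"
      using \<open>inv c\<close> r by (auto simp: inv_def in_set_conv_nth)
    then have "fst (delta N (fst c) ?rs) < num_states N \<and> length (snd (delta N (fst c) ?rs)) = ?k \<and>
      (\<forall>j<?k. fst (snd (delta N (fst c) ?rs) ! j) < num_symbols N)"
      using wf_tm_delta[OF N, of "fst c" ?rs] \<open>inv c\<close> by (auto simp: inv_def)
    then show "fst (nx c) < num_states N" "length (snd (nx c)) = ?k"
      "\<And>j. j < ?k \<Longrightarrow> fst (snd (nx c) ! j) < num_symbols N"
      using \<open>inv c\<close> r by (auto simp: nx_def next_of_def inv_def)
  qed
  have st: "step N c = (fst (nx c), map2 act (snd (nx c)) (snd c))" if "inv c" for c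
  proof (cases "fst c = 1")
    case True
    have "map2 act (map (\<lambda>s. (s, Stay)) (map (\<lambda>\<tau>. \<tau> 0) (snd c))) (snd c) = snd c"
      by (rule nth_equalityI) (auto simp: act_def fun_eq_iff)
    then show ?thesis using True by (auto simp: step_def nx_def next_of_def prod_eq_iff)
  next
    case False
    then show ?thesis by (auto simp: step_def nx_def next_of_def split: prod.splits)
  qed
  have inv_step: "inv (step N c)" if "inv c" for c
  proof -
    have "act (snd (nx c) ! j) (snd c ! j) i < num_symbols N" if "j < ?k" for j i
      using nx(3)[OF \<open>inv c\<close> that] \<open>inv c\<close> that by (auto simp: act_def inv_def)
    then show ?thesis using nx[OF that] that by (auto simp: st[OF that] inv_def)
  qed
  have "inv (conf N z t)" for t
  proof (induction t)
    case 0
    show ?case using N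
      by (auto simp: conf_def init_def inv_def wf_tm_def nth_Cons' input_tape_def bit_symbol_def)
  next
    case (Suc t)
    then show ?case using inv_step by (simp add: conf_def)
  qed
  then show ?thesis using st nx(2) by (auto simp: inv_def nx_def conf_def)
qed

lemma conf_Suc_nth:
  fixes t :: nat and z :: "bool list"
  assumes N: "wf_tm N" and j: "j < num_tapes N"
  defines "a \<equiv> snd (next_of N (fst (conf N z t)) (map (\<lambda>\<tau>. \<tau> 0) (snd (conf N z t)))) ! j"
  shows "(snd (conf N z (Suc t)) ! j) p =
    (if p + offset (snd a) = 0 then fst a else (snd (conf N z t) ! j) (p + offset (snd a)))"
  using conf_wf[OF N, of z t] j by (simp add: a_def act_def)

lemma conf_0: "fst (conf N z 0) = 0" "snd (conf N z 0) = input_tape z # replicate (num_tapes N - 1) (\<lambda>_. 0)"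
  by (auto simp: conf_def init_def)

lemma tableau_complete:
  assumes N: "wf_tm N" and z: "z = x @ v" "length z = e"
    and acc: "fst (conf N z T) = 1" "hd (snd (conf N z T)) 0 = 2"
  shows "\<exists>A. tableau N x e T W R A"
proof -
  let ?k = "num_tapes N"
  define A :: "nat \<Rightarrow> nat \<Rightarrow> cell" where "A t i = (fst (conf N z t), map
    (\<lambda>\<tau>. \<tau> 0) (snd (conf N z t)),
    map (\<lambda>\<tau>. \<tau> (int i - int W)) (snd (conf N z t)))" for t i
  note w = conf_wf[OF N, of z]
  have k: "1 \<le> ?k" using N by (simp add: wf_tm_def)
  have "A t i \<in> cells N" for t i
  proof -
    have "(snd (conf N z t) ! j) p < num_symbols N" if "j < ?k" for j p
      using w[of t] that by auto
    then show ?thesis using w[of t] by (auto simp: A_def cells_def in_set_conv_nth)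
  qed
  moreover have "cell_ok N x e T W t i (A t i)" for t i
  proof -
    have "hd (snd (conf N z t)) = snd (conf N z t) ! 0"
      using w[of t] k by (cases "snd (conf N z t)") auto
    then have "t = T \<longrightarrow> map (\<lambda>\<tau>. \<tau> 0) (snd (conf N z t)) ! 0 = 2"
      using acc w[of t] k by auto
    moreover have "(if i < W then a = 0 else if i - W < length x then a = bit_symbol (x ! (i - W))
         else if i - W < e then a = 1 \<or> a = 2 else a = 0)" if "a = input_tape z (int i - int W)" for a
      using z that by (auto simp: input_tape_def bit_symbol_def nth_append nat_diff_distrib)
    ultimately show ?thesis
      using k acc(1) by (auto simp: A_def cell_ok_def conf_0 nth_Cons')
  qed
  moreover have "link N W t i (A t i) t' i' (A t' i')" for t i t' i'
    using w[of t]
    by (auto simp: link_def A_def act_def moved_def algebra_simps)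
  ultimately have "tableau N x e T W R A" by (simp add: tableau_def)
  then show ?thesis by blast
qed

text \<open>A border cell whose predecessor would lie outside the tableau is not constrained by the
  previous row, so errors can spread inwards by one column per step. Row \<open>t\<close> is
  certified only for columns \<open>i\<close> with \<open>t \<le> i\<close> and
  \<open>i + t < R\<close>; as \<open>T < W\<close> and \<open>W + W \<le> R\<close>, the column
  \<open>W\<close> of the heads is reliable up to row \<open>T\<close>.\<close>

lemma tableau_sound:
  assumes N: "wf_tm N" and A: "tableau N x e T W R A"
    and le: "length x \<le> e" "T < W" "W + W + e \<le> R"
  shows "\<exists>v. length v = e - length x \<and> fst (conf N (x @ v) T) = 1 \<and> hd (snd (conf N (x @ v) T)) 0 = 2"
proof -
  let ?k = "num_tapes N" and ?n = "length x"
  define q where "q t i = fst (A t i)" for t i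
  define rs where "rs t i = fst (snd (A t i))" for t i
  define ss where "ss t i = snd (snd (A t i))" for t i
  have A_eq: "A t i = (q t i, rs t i, ss t i)" for t i by (simp add: q_def rs_def ss_def)
  have k: "1 \<le> ?k" using N by (simp add: wf_tm_def)
  have len: "length (rs t i) = ?k" "length (ss t i) = ?k" if "t \<le> T" "i < R" for t i
    using A that unfolding tableau_def A_eq by (auto simp: cells_def)
  have ok: "cell_ok N x e T W t i (q t i, rs t i, ss t i)" if "t \<le> T" "i < R" for t i
    using A that unfolding tableau_def A_eq by blast
  have lnk: "link N W t i (q t i, rs t i, ss t i) t' i' (q t' i', rs t' i', ss t' i')"
    if "t \<le> T" "i < R" "t' \<le> T" "i' < R" for t i t' i'
    using A that unfolding tableau_def A_eq by blast
  have WR: "W < R" using le by linarith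
  have row: "q t i = q t W" "rs t i = rs t W" if "t \<le> T" "i < R" for t i
    using lnk[of t W t i] that WR by (auto simp: link_def)
  \<comment> \<open>The certificate is read off the free bits of row 0, with symbol 2 standing for
    \<open>True\<close>.\<close>
  define v where "v = map (\<lambda>j. ss 0 (W + ?n + j) ! 0 = 2) [0..<e - ?n]"
  define z where "z = x @ v"
  have lv: "length v = e - ?n" by (simp add: v_def)
  have lz: "length z = e" using le by (simp add: z_def lv)
  note w = conf_wf[OF N, of z]
  have main: "q t W = fst (conf N z t) \<and>
      (\<forall>i j. t \<le> i \<and> i + t < R \<and> j < ?k \<longrightarrow> ss t i ! j = (snd (conf N z t)
        ! j) (int i - int W))" if "t \<le> T" for t
    using that
  proof (induction t)
    case 0
    have "ss 0 i ! j = (snd (conf N z 0) ! j) (int i - int W)" if "i < R" "j < ?k" for i j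
    proof (cases "j = 0")
      case True
      note o = ok[OF _ that(1), of 0]
      have v_nth: "i - W - ?n < e - ?n \<Longrightarrow> ?n \<le> i - W \<Longrightarrow> W \<le> i
        \<Longrightarrow> v ! (i - W - ?n) = (ss 0 i ! 0 = 2)"
        by (simp add: v_def)
      show ?thesis
        using o True le lz v_nth
        by (auto simp: cell_ok_def conf_0 input_tape_def z_def nth_append bit_symbol_def nat_diff_distrib
            split: if_splits)
    next
      case False
      then show ?thesis using ok[OF _ that(1), of 0] that(2) by (auto simp: cell_ok_def conf_0)
    qed
    moreover have "q 0 W = 0" using ok[OF _ WR, of 0] by (auto simp: cell_ok_def)
    ultimately show ?case by (auto simp: conf_0)
  next
    case (Suc t)
    then have t: "t \<le> T" "t < T" and IH: "q t W = fst (conf N z t)"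
      "\<And>i j. t \<le> i \<Longrightarrow> i + t < R \<Longrightarrow> j < ?k \<Longrightarrow> ss t i ! j =
        (snd (conf N z t) ! j) (int i - int W)"
      by auto
    have "rs t W = ss t W" using ok[OF t(1) WR] by (simp add: cell_ok_def)
    also have "\<dots> = map (\<lambda>\<tau>. \<tau> 0) (snd (conf N z t))"
    proof (rule nth_equalityI)
      show "length (ss t W) = length (map (\<lambda>\<tau>. \<tau> 0) (snd (conf N z t)))" using len t WR w[of t] by simp
      fix j assume "j < length (ss t W)"
      then show "ss t W ! j = map (\<lambda>\<tau>. \<tau> 0) (snd (conf N z t)) ! j"
        using len t WR w[of t] IH(2)[of W j] le by simp
    qed
    finally have rsW: "rs t W = map (\<lambda>\<tau>. \<tau> 0) (snd (conf N z t))" .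
    let ?nx = "next_of N (fst (conf N z t)) (map (\<lambda>\<tau>. \<tau> 0) (snd (conf N z t)))"
    have l: "link N W t i (fst (conf N z t), map (\<lambda>\<tau>. \<tau> 0) (snd (conf N z t)), ss t i)
        (Suc t) i' (q (Suc t) i', rs (Suc t) i', ss (Suc t) i')" if "i < R" "i' < R" for i i'
      using lnk[OF t(1) that(1) Suc.prems that(2)] row[OF t(1) that(1)] rsW IH(1) by simp
    have "q (Suc t) W = fst (conf N z (Suc t))"
      using l[OF WR WR] w[of t] by (simp add: link_def)
    moreover have "ss (Suc t) i' ! j = (snd (conf N z (Suc t)) ! j) (int i' - int W)"
      if i': "Suc t \<le> i'" "i' + Suc t < R" and j: "j < ?k" for i' j
    proof -
      let ?a = "snd ?nx ! j"
      \<comment> \<open>The column that the contents of \<open>i'\<close> come from. It differs from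
        \<open>i'\<close> by at most one, so it lies in the certified part of row
        \<open>t\<close>.\<close>
      define i where "i = nat (int i' + offset (snd ?a))"
      have off: "offset (snd ?a) \<in> {-1, 0, 1}" by (cases "snd ?a") auto
      then have i: "int i = int i' + offset (snd ?a)" using i' by (auto simp: i_def)
      then have ir: "t \<le> i" "i + t < R" using off i' by auto
      have "moved (snd ?a) i i'" using i by (simp add: moved_def)
      then have "ss (Suc t) i' ! j = (if i = W then fst ?a else ss t i ! j)"
        using l[of i i'] ir i' j by (simp add: link_def)
      also have "\<dots> = (if i = W then fst ?a else (snd (conf N z t) ! j) (int i - int W))"
        using IH(2)[OF ir j] by simp
      also have "\<dots> = (snd (conf N z (Suc t)) ! j) (int i' - int W)"
        unfolding conf_Suc_nth[OF N j] using i by (auto simp: algebra_simps)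
      finally show ?thesis .
    qed
    ultimately show ?case by blast
  qed
  have "q T W = 1" "rs T W ! 0 = 2" "ss T W = rs T W"
    using ok[OF _ WR, of T] by (auto simp: cell_ok_def)
  moreover have "ss T W ! 0 = (snd (conf N z T) ! 0) 0"
    using main[of T] le k by (auto dest!: spec[of _ W] spec[of _ 0])
  moreover have "hd (snd (conf N z T)) = snd (conf N z T) ! 0"
    using w[of T] k by (cases "snd (conf N z T)") auto
  ultimately show ?thesis using main[of T] lv unfolding z_def by auto
qed

lemma tableau_iff:
  assumes N: "wf_tm N" "\<And>z. computes_within N z [z \<in> V] (poly q (length z))"
    and L: "x \<in> L \<longleftrightarrow> (\<exists>v. length v = m \<and> x @ v \<in> V)"
    and e: "e = length x + m" and T: "T = poly q e" and le: "T < W" "W + W + e \<le> R"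
  shows "x \<in> L \<longleftrightarrow> (\<exists>A. tableau N x e T W R A)"
proof -
  \<comment> \<open>At time \<open>T\<close> the verifier has halted with an answer of a single bit,
    so the symbol under the first head decides.\<close>
  have V: "z \<in> V \<longleftrightarrow> hd (snd (conf N z T)) 0 = 2" "fst (conf N z T) = 1" if "length z = e" for z
    using N(2)[of z] that T unfolding computes_within_def conf_def output_is_def
    by (auto simp: bit_symbol_def split: prod.splits if_splits)
  show ?thesis
  proof
    assume "x \<in> L"
    then obtain v where v: "length v = m" "x @ v \<in> V" using L by blast
    then show "\<exists>A. tableau N x e T W R A"
      using V[of "x @ v"] e by (intro tableau_complete[OF N(1), of "x @ v"]) auto
  next
    assume "\<exists>A. tableau N x e T W R A"
    then obtain A where "tableau N x e T W R A" ..
    then obtain v where "length v = e - length x" "hd (snd (conf N (x @ v) T)) 0 = 2"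
      using tableau_sound[OF N(1) _ _ le] e by (metis le_add1)
    then show "x \<in> L" using L V[of "x @ v"] e by auto
  qed
qed

section \<open>Tableaux as diversification instances\<close>

lemma concat_map_Nil: "concat (map f xs) = [] \<longleftrightarrow> (\<forall>x\<in>set xs. f x = [])"
  by (induction xs) auto

text \<open>Two nested loops that count down visit the pairs \<open>(t, i)\<close> in the order in
  which a single one visits the numbers \<open>t * m + i\<close>.\<close>

lemma concat_map_product:
  "concat (map (\<lambda>t. concat (map (h t) (rev [0..<m]))) (rev [0..<n])) =
   concat (map (\<lambda>g. h (g div m) (g mod m)) (rev [0..<n * m]))"
proof (cases "m = 0")
  case False
  show ?thesis
  proof (induction n)
    case (Suc n)
    have "[0..<Suc n * m] = [0..<n * m] @ map (\<lambda>i. n * m + i) [0..<m]"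
      using upt_add_eq_append[of 0 "n * m" m] by (simp add: map_add_upt add.commute)
    then have "concat (map (\<lambda>g. h (g div m) (g mod m)) (rev [0..<Suc n * m])) =
        concat (map (h n) (rev [0..<m])) @ concat (map (\<lambda>g. h (g div m) (g mod m)) (rev [0..<n * m]))"
      using False by (auto simp: rev_map comp_def intro!: arg_cong[of _ _ concat])
    then show ?case using Suc by simp
  qed simp
qed simp

definition conjs :: "cnd list \<Rightarrow> cnd" where
  "conjs cs = foldr Conj cs (Cst True)"

lemma holds_conjs [simp]: "holds e (conjs cs) \<longleftrightarrow> (\<forall>c\<in>set cs. holds e c)"
  by (induction cs) (auto simp: conjs_def)

lemma cvars_conjs [simp]: "cvars (conjs cs) = (\<Union>c\<in>set cs. cvars c)"
  by (induction cs) (auto simp: conjs_def)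

definition Choose :: "cnd \<Rightarrow> cnd \<Rightarrow> cnd \<Rightarrow> cnd" where
  "Choose c a b = Conj (Imp c a) (Imp (Neg c) b)"

lemma holds_Choose [simp]: "holds e (Choose c a b) \<longleftrightarrow> (if holds e c then holds e a else holds e b)"
  "cvars (Choose c a b) = cvars c \<union> cvars a \<union> cvars b"
  by (auto simp: Choose_def)

lemma units: "out (Rep i v (emits (replicate d True))) e = replicate (length (e v) * d) True"
  by (subst out_Rep[where f = "\<lambda>_. replicate d True"]) (auto simp: concat_map_replicate sum_list_map_const)

lemma unit: "out (Rep i v (Emit True)) e = replicate (length (e v)) True"
  using units[of i v 1 e] by (simp add: emits_def seqs_def Rep_def)

text \<open>\<open>f\<close> is the length of the certificates, \<open>q\<close> the running time of
  the verifier \<open>N\<close>, and \<open>vals\<close> a list of all cell values. None of them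
  depends on the input, so they may be built into the printed programs as constants.\<close>

locale reduction =
  fixes N :: tm and f q :: "nat poly" and vals :: "cell list"
  assumes set_vals: "set vals = cells N" and wf_N: "wf_tm N"
begin

definition D :: nat where "D = length vals"
definition ee :: "nat \<Rightarrow> nat" where "ee n = n + poly f n"
definition TT :: "nat \<Rightarrow> nat" where "TT n = poly q (ee n)"
text \<open>The least value above the time bound, as soundness of tableaux requires. It has a second
  role as the number of rows, which are numbered from 0 to \<open>TT n\<close>.\<close>

definition WW :: "nat \<Rightarrow> nat" where "WW n = Suc (TT n)"
definition RR :: "nat \<Rightarrow> nat" where "RR n = WW n + WW n + ee n"

abbreviation ok :: "bool list \<Rightarrow> nat \<Rightarrow> nat \<Rightarrow> cell \<Rightarrow> bool" where
  "ok x \<equiv> cell_ok N x (ee (length x)) (TT (length x)) (WW (length x))"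

text \<open>The unary constraints are folded into the relation between pairs, since a distance has
  nowhere else to record them. Both directions of \<open>link\<close> are included to make the
  relation symmetric.\<close>

definition compat :: "bool list \<Rightarrow> nat \<Rightarrow> nat \<Rightarrow> nat \<Rightarrow> nat
  \<Rightarrow> nat \<Rightarrow> nat \<Rightarrow> bool" where
  "compat x t i a t' i' b \<longleftrightarrow> ok x t i (vals ! a) \<and> ok x t' i' (vals ! b) \<and>
     link N (WW (length x)) t i (vals ! a) t' i' (vals ! b) \<and>
     link N (WW (length x)) t' i' (vals ! b) t i (vals ! a)"

text \<open>
  Variables 6 to 10 hold 0, the length of the input of the verifier, the time bound, the center of a
  row and the width of a row. A loop over the cells \<open>(t, i)\<close> binds \<open>t\<close>,
    \<open>i\<close>, \<open>i - W\<close>, \<open>t + 1\<close>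
  and \<open>i + 1\<close> to the variables from \<open>k\<close> on.
\<close>

definition prelude :: "lp \<Rightarrow> lp" where
  "prelude c = Bind 6 Quiet (Bind 7 (Then (Rep 8 0 (Emit True)) (upoly (coeffs f) 0 8))
     (Bind 8 (upoly (coeffs q) 7 9) (Bind 9 (Then (Emit True) (Rep 10 8 (Emit True)))
       (Bind 10 (seqs [Rep 11 9 (Emit True), Rep 11 9 (Emit True), Rep 11 7 (Emit True)]) c))))"

definition base :: "bool list \<Rightarrow> bool list \<Rightarrow> (nat \<Rightarrow> bool list) \<Rightarrow> bool" where
  "base x y e \<longleftrightarrow> e 0 = x \<and> e 1 = y \<and> e 6 = [] \<and> length (e 7) = ee (length x) \<and>
     length (e 8) = TT (length x) \<and> length (e 9) = WW (length x) \<and> length (e 10) = RR (length x)"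

lemma out_prelude:
  assumes "\<And>e. base x y e \<Longrightarrow> out c e = r"
  shows "out (prelude c) (env x y) = r"
  unfolding prelude_def out.simps(6)
  by (rule assms) (simp add: unit base_def ee_def TT_def WW_def RR_def add.commute)

lemma wf_prelude:
  assumes "wf_lp B c (A \<union> {6, 7, 8, 9, 10}) 11" "0 \<in> A"
    "12 + length (coeffs f) + length (coeffs q) \<le> B"
  shows "wf_lp B (prelude c) A 6"
  using assms by (auto simp: prelude_def insert_commute Un_commute intro!: wf_upoly)

definition ploop :: "nat \<Rightarrow> lp \<Rightarrow> lp" where
  "ploop k c = Rep k 9 (Rep (k + 1) 10 (Bind (k + 2) (Rep (k + 3) (k + 1) (ite (Lt (k + 3) 9) Quiet (Emit True)))
     (Bind (k + 3) (Then (Emit True) (Rep (k + 4) k (Emit True)))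
       (Bind (k + 4) (Then (Emit True) (Rep (k + 5) (k + 1) (Emit True))) c))))"

definition located :: "nat \<Rightarrow> nat \<Rightarrow> nat \<Rightarrow> nat \<Rightarrow> (nat
  \<Rightarrow> bool list) \<Rightarrow> bool" where
  "located k t i W e \<longleftrightarrow> length (e k) = t \<and> length (e (k + 1)) = i \<and> length (e (k + 2)) = i - W \<and>
     length (e (k + 3)) = t + 1 \<and> length (e (k + 4)) = i + 1"

lemma out_ploop:
  assumes b: "base x y e" and k: "11 \<le> k"
    and c: "\<And>t i e'. t < WW (length x) \<Longrightarrow> i < RR (length x) \<Longrightarrow>
      (\<forall>v<k. e' v = e v) \<Longrightarrow>
      located k t i (WW (length x)) e' \<Longrightarrow> out c e' = h t i"
  shows "out (ploop k c) e = concat (map (\<lambda>g. h (g div RR (length x)) (g mod RR (length x)))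
    (rev [0..<WW (length x) * RR (length x)]))"
proof -
  let ?W = "WW (length x)" and ?R = "RR (length x)"
  have diff: "out (Rep (k + 3) (k + 1) (ite (Lt (k + 3) 9) Quiet (Emit True))) e'
      = replicate (length (e' (k + 1)) - length (e' 9)) True" for e'
  proof -
    have "sum_list (map (\<lambda>l. if l < length (e' 9) then 0 else 1) (rev [0..<m])) = m - length (e' 9)" for m
      by (induction m) auto
    then show ?thesis
      by (subst out_Rep[where f = "\<lambda>l. replicate (if l < length (e' 9) then 0 else 1) True"])
        (use k in \<open>auto simp: concat_map_replicate\<close>)
  qed
  have "out (ploop k c) e = concat (map (\<lambda>t. concat (map (h t) (rev [0..<?R]))) (rev [0..<length (e 9)]))"
    unfolding ploop_def
  proof (rule out_Rep)
    fix s :: "bool list" assume s: "length s < length (e 9)"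
    let ?e = "e(k := s)"
    have "out (Rep (k + 1) 10 (Bind (k + 2) (Rep (k + 3) (k + 1) (ite (Lt (k + 3) 9) Quiet (Emit True)))
       (Bind (k + 3) (Then (Emit True) (Rep (k + 4) k (Emit True)))
         (Bind (k + 4) (Then (Emit True) (Rep (k + 5) (k + 1) (Emit True))) c)))) ?e
      = concat (map (h (length s)) (rev [0..<length (?e 10)]))"
    proof (rule out_Rep)
      fix s' :: "bool list" assume s': "length s' < length (?e 10)"
      show "out (Bind (k + 2) (Rep (k + 3) (k + 1) (ite (Lt (k + 3) 9) Quiet (Emit True)))
       (Bind (k + 3) (Then (Emit True) (Rep (k + 4) k (Emit True)))
         (Bind (k + 4) (Then (Emit True) (Rep (k + 5) (k + 1) (Emit True))) c))) (?e(k + 1 := s')) = h (length s) (length s')"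
        unfolding out.simps(6)
        by (rule c; (simp only: diff)?) (use s s' b k in \<open>auto simp: base_def located_def unit\<close>)
    qed
    then show "out (Rep (k + 1) 10 (Bind (k + 2) (Rep (k + 3) (k + 1) (ite (Lt (k + 3) 9) Quiet (Emit True)))
       (Bind (k + 3) (Then (Emit True) (Rep (k + 4) k (Emit True)))
         (Bind (k + 4) (Then (Emit True) (Rep (k + 5) (k + 1) (Emit True))) c)))) ?e
      = concat (map (h (length s)) (rev [0..<?R]))" using b k by (simp add: base_def)
  qed
  then show ?thesis using b by (simp add: concat_map_product base_def)
qed

lemma wf_ploop:
  assumes "d \<le> k" "wf_lp B c (A \<union> {k, k + 1, k + 2, k + 3, k + 4}) (k + 5)" "{9, 10} \<subseteq> A" "k + 6 \<le> B"
  shows "wf_lp B (ploop k c) A d"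
  using assms by (auto simp: ploop_def insert_commute Un_commute add.commute[of 5 k] intro!: wf_ite)

text \<open>Prints \<open>(t * R + i) * d + a\<close> in unary: the number of a point for
  \<open>d = D\<close>, and that of a group for \<open>d = 1\<close> and
  \<open>a = 0\<close>.\<close>

definition idx :: "nat \<Rightarrow> nat \<Rightarrow> nat \<Rightarrow> nat \<Rightarrow> lp" where
  "idx k v d a = Then (Rep v k (Rep (v + 1) 10 (emits (replicate d True))))
     (Then (Rep v (k + 1) (emits (replicate d True))) (emits (replicate a True)))"

lemma out_idx:
  assumes "base x y e" "located k t i W e" "k + 4 < v" "10 < v"
  shows "length (out (idx k v d a) e) = (t * RR (length x) + i) * d + a"
proof -
  have "out (Rep v k (Rep (v + 1) 10 (emits (replicate d True)))) e = replicate (length (e k) * (RR (length x) * d)) True"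
    by (subst out_Rep[where f = "\<lambda>_. replicate (RR (length x) * d) True"])
      (use assms in \<open>auto simp: units base_def concat_map_replicate sum_list_map_const\<close>)
  then show ?thesis
    using assms by (simp add: idx_def units located_def algebra_simps)
qed

lemma wf_idx: "{k, k + 1, 10} \<subseteq> A \<Longrightarrow> d' \<le> v \<Longrightarrow> v + 2 \<le> B
  \<Longrightarrow> wf_lp B (idx k v d a) A d'"
  by (auto simp: idx_def)

text \<open>The value \<open>c\<close> is a constant of the program, so everything that concerns
  only \<open>c\<close> is evaluated when the program is built; tests on the position and on bits of
  \<open>x\<close> remain. The row is 0 if it is not longer than the empty variable 6, and it is the
  last one if it is not shorter than variable 8.\<close>

definition okc :: "nat \<Rightarrow> cell \<Rightarrow> cnd" where
  "okc k c = (case c of (s, rs, ss) \<Rightarrow> conjs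
    [if ss = rs then Cst True else Neg (Eq (k + 1) 9),
     Imp (Neg (Lt 6 k)) (Conj (Cst (s = 0 \<and> (\<forall>j<num_tapes N. 0 < j \<longrightarrow> ss ! j = 0)))
       (Choose (Lt (k + 1) 9) (Cst (ss ! 0 = 0))
         (Choose (Lt (k + 2) 0)
            (if ss ! 0 = 2 then At (k + 2) 0 else if ss ! 0 = 1 then Neg (At (k + 2) 0) else Cst False)
            (Choose (Lt (k + 2) 7) (Cst (ss ! 0 = 1 \<or> ss ! 0 = 2)) (Cst (ss ! 0 = 0)))))),
     Imp (Neg (Lt k 8)) (Cst (s = 1 \<and> rs ! 0 = 2))])"

lemma holds_okc:
  assumes "base x y e" "located k t i (WW (length x)) e" "t < WW (length x)"
  shows "holds e (okc k c) \<longleftrightarrow> ok x t i c"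
proof -
  obtain s rs ss where c: "c = (s, rs, ss)" by (cases c)
  have T: "\<not> t < TT (length x) \<longleftrightarrow> t = TT (length x)" using assms(3) by (auto simp: WW_def)
  show ?thesis
    using assms(1,2) T unfolding c base_def located_def okc_def cell_ok_def
    by (auto simp: bit_symbol_def)
qed

text \<open>Subtraction is avoided by comparing with the successors stored at \<open>k + 4\<close>
  and \<open>k' + 4\<close>; for instance \<open>i = i' - 1\<close> is tested as
  \<open>i' = i + 1\<close>.\<close>

definition movedc :: "move \<Rightarrow> nat \<Rightarrow> nat \<Rightarrow> cnd" where
  "movedc m k k' = (case m of Go_Left \<Rightarrow> Eq (k' + 1) (k + 4) | Stay \<Rightarrow> Eq (k' + 1) (k + 1)
     | Go_Right \<Rightarrow> Eq (k + 1) (k' + 4))"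

definition linkc :: "nat \<Rightarrow> cell \<Rightarrow> nat \<Rightarrow> cell \<Rightarrow> cnd" where
  "linkc k c k' c' = (case c of (s, rs, ss) \<Rightarrow> case c' of (s', rs', ss') \<Rightarrow>
     Conj (if s' = s \<and> rs' = rs then Cst True else Neg (Eq k' k))
       (Imp (Eq k' (k + 3)) (Conj (Cst (s' = fst (next_of N s rs)))
         (conjs (map (\<lambda>j. Imp (movedc (snd (snd (next_of N s rs) ! j)) k k')
            (Choose (Eq (k + 1) 9) (Cst (ss' ! j = fst (snd (next_of N s rs) ! j))) (Cst (ss' ! j = ss ! j))))
           [0..<num_tapes N])))))"

lemma holds_linkc:
  assumes "base x y e" "located k t i (WW (length x)) e" "located k' t' i' (WW (length x)) e"
  shows "holds e (linkc k c k' c') \<longleftrightarrow> link N (WW (length x)) t i c t' i' c'"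
proof -
  obtain s rs ss where c: "c = (s, rs, ss)" by (cases c)
  obtain s' rs' ss' where c': "c' = (s', rs', ss')" by (cases c')
  have m: "holds e (movedc m k k') \<longleftrightarrow> moved m i i'" for m
    using assms by (cases m) (auto simp: movedc_def moved_def located_def)
  have i: "length (e (k + 1)) = i" "length (e 9) = WW (length x)" "length (e k) = t" "length (e k') = t'"
    "length (e (k + 3)) = Suc t"
    using assms by (auto simp: located_def base_def)
  show ?thesis
    unfolding c c' linkc_def link_def prod.case holds.simps holds_derived holds_conjs i
    by (auto simp: m i i[simplified] holds_derived)
qed

definition compatc :: "nat \<Rightarrow> nat \<Rightarrow> nat \<Rightarrow> nat \<Rightarrow> cnd" where
  "compatc k k' a b = conjs [okc k (vals ! a), okc k' (vals ! b),
     linkc k (vals ! a) k' (vals ! b), linkc k' (vals ! b) k (vals ! a)]"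

lemma holds_compatc:
  assumes "base x y e" "located k t i (WW (length x)) e" "located k' t' i' (WW (length x)) e"
    "t < WW (length x)" "t' < WW (length x)"
  shows "holds e (compatc k k' a b) \<longleftrightarrow> compat x t i a t' i' b"
  using assms by (auto simp: compatc_def compat_def holds_okc holds_linkc)

definition samec :: "nat \<Rightarrow> nat \<Rightarrow> nat \<Rightarrow> nat \<Rightarrow> cnd" where
  "samec k k' a b = (if a = b then Conj (Eq k k') (Eq (k + 1) (k' + 1)) else Cst False)"

lemma holds_samec:
  assumes "located k t i W e" "located k' t' i' W e"
  shows "holds e (samec k k' a b) \<longleftrightarrow> t = t' \<and> i = i' \<and> a = b"
  using assms by (auto simp: samec_def located_def)

lemma cvars_compatc:
  "cvars (compatc k k' a b) \<subseteq> {0, 6, 7, 8, 9} \<union> {k, k + 1, k + 2, k + 3, k + 4} \<union> {k',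
    k' + 1, k' + 2, k' + 3, k' + 4}"
proof -
  have o: "cvars (okc k c) \<subseteq> {0, 6, 7, 8, 9} \<union> {k, k + 1, k + 2, k + 3, k + 4}" for k c
    by (auto simp: okc_def split: prod.splits if_splits)
  have m: "cvars (movedc m k k') \<subseteq> {k + 1, k + 4, k' + 1, k' + 4}" for m k k'
    by (cases m) (auto simp: movedc_def)
  then have l: "cvars (linkc k c k' c') \<subseteq> {9} \<union> {k, k + 1, k + 3, k + 4} \<union> {k', k' + 1,
    k' + 4}" for k c k' c'
    by (fastforce simp: linkc_def split: prod.splits if_splits)
  have "cvars (compatc k k' a b) = cvars (okc k (vals ! a)) \<union> cvars (okc k' (vals ! b)) \<union>
      (cvars (linkc k (vals ! a) k' (vals ! b)) \<union> cvars (linkc k' (vals ! b) k (vals ! a)))"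
    by (simp add: compatc_def Un_assoc)
  also have "\<dots> \<subseteq> ({0, 6, 7, 8, 9} \<union> {k, k + 1, k + 2, k + 3, k + 4}) \<union> ({0, 6, 7,
    8, 9} \<union> {k', k' + 1, k' + 2, k' + 3, k' + 4}) \<union>
      (({9} \<union> {k, k + 1, k + 3, k + 4} \<union> {k', k' + 1, k' + 4}) \<union> ({9} \<union> {k', k' +
        1, k' + 3, k' + 4} \<union> {k, k + 1, k + 4}))"
    by (intro Un_mono o l)
  also have "\<dots> \<subseteq> {0, 6, 7, 8, 9} \<union> {k, k + 1, k + 2, k + 3, k + 4} \<union> {k', k' + 1,
    k' + 2, k' + 3, k' + 4}"
    by blast
  finally show ?thesis .
qed

lemma cvars_samec: "cvars (samec k k' a b) \<subseteq> {k, k + 1, k', k' + 1}"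
  by (auto simp: samec_def)

section \<open>The instance, its printer and the checker\<close>

definition npts :: "bool list \<Rightarrow> nat" where
  "npts x = WW (length x) * RR (length x) * D"

abbreviation groups :: "bool list \<Rightarrow> nat" where
  "groups x \<equiv> WW (length x) * RR (length x)"

text \<open>Point \<open>\<nu>\<close> stands for value number \<open>\<nu> mod D\<close> of cell
  number \<open>\<nu> div D\<close>, where cells are counted row by row.\<close>

definition compat_pts :: "bool list \<Rightarrow> nat \<Rightarrow> nat \<Rightarrow> bool" where
  "compat_pts x \<nu> \<mu> = compat x (\<nu> div D div RR (length x)) (\<nu> div D mod RR (length x)) (\<nu> mod D)
     (\<mu> div D div RR (length x)) (\<mu> div D mod RR (length x)) (\<mu> mod D)"

definition dd :: "bool list \<Rightarrow> nat \<Rightarrow> nat \<Rightarrow> rat" where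
  "dd x \<nu> \<mu> = (if \<nu> = \<mu> then 0 else if compat_pts x \<nu> \<mu> then 2 else 1)"

text \<open>Loops count down, so the points \<open>\<nu>\<close> are listed in descending order.\<close>

definition inst :: "bool list \<Rightarrow> fmm" where
  "inst x = \<lparr>group_of = map (\<lambda>\<nu>. \<nu> div D) (rev [0..<npts x]), demand = replicate (groups x) 1,
     dist_matrix = map (\<lambda>\<nu>. map (dd x \<nu>) (rev [0..<npts x])) (rev [0..<npts x])\<rparr>"

definition entry :: "nat \<Rightarrow> nat \<Rightarrow> lp" where
  "entry a b = ite (samec 11 17 a b) (emits (encode_nats (rat_code 0)))
     (ite (compatc 11 17 a b) (emits (encode_nats (rat_code 2))) (emits (encode_nats (rat_code 1))))"

text \<open>Unlike the loops over the cells, the loop over their values is unrolled, since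
  \<open>D\<close> depends on the verifier alone. This is what makes each value a constant in its
  copy of the body. The order is descending, to match the loops around it.\<close>

definition each :: "(nat \<Rightarrow> lp) \<Rightarrow> lp" where
  "each c = seqs (map c (rev [0..<D]))"

text \<open>The five items follow the encoding of an instance: number of points, number of groups,
  group of each point, demands, and distance matrix.\<close>

definition print_inst :: lp where
  "print_inst = prelude (seqs
     [Bind 11 (Rep 12 9 (Rep 13 10 (emits (replicate D True)))) (Bin 11),
      Bind 11 (Rep 12 9 (Rep 13 10 (emits (replicate 1 True)))) (Bin 11),
      ploop 11 (Bind 16 (idx 11 17 1 0) (each (\<lambda>a. Bin 16))),
      Rep 11 9 (Rep 12 10 (emits (encode_nats [1]))),
      ploop 11 (each (\<lambda>a. ploop 17 (each (entry a))))])"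

text \<open>Variable 1 holds the answer in reverse. As the instance lists its points in descending
  order, the two reversals cancel, and bit \<open>\<nu>\<close> tells whether the point numbered
  \<open>\<nu>\<close> was selected.\<close>

definition clash :: "nat \<Rightarrow> nat \<Rightarrow> lp" where
  "clash a b = Bind 22 (idx 17 23 D b)
     (ite (conjs [At 22 1, Neg (samec 11 17 a b), Neg (compatc 11 17 a b)]) (Emit True) Quiet)"

definition print_clashes :: lp where
  "print_clashes = prelude (ploop 11 (each (\<lambda>a. Bind 16 (idx 11 17 D a)
     (ite (At 16 1) (ploop 17 (each (clash a))) Quiet))))"

lemma concat_points:
  "concat (map (\<lambda>g. concat (map (F (g div R) (g mod R)) (rev [0..<D]))) (rev [0..<W * R]))
    = concat (map (\<lambda>\<nu>. F (\<nu> div D div R) (\<nu> div D mod R) (\<nu> mod D)) (rev [0..<W * R * D]))"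
  using concat_map_product[of "\<lambda>g. F (g div R) (g mod R)" D "W * R"] by simp

lemma out_each: "(\<And>a. a < D \<Longrightarrow> out (c a) e = F a) \<Longrightarrow> out (each c) e = concat
  (map F (rev [0..<D]))"
  by (auto simp: each_def comp_def intro!: arg_cong[of _ _ concat])

lemma out_point_loop:
  assumes b: "base x y e" and k: "11 \<le> k"
    and c: "\<And>t i a e'. t < WW (length x) \<Longrightarrow> i < RR (length x) \<Longrightarrow> a < D
      \<Longrightarrow> (\<forall>v<k. e' v = e v) \<Longrightarrow>
      located k t i (WW (length x)) e' \<Longrightarrow> out (c a) e' = F t i a"
  shows "out (ploop k (each c)) e =
    concat (map (\<lambda>\<nu>. F (\<nu> div D div RR (length x)) (\<nu> div D mod RR (length x)) (\<nu> mod
      D)) (rev [0..<npts x]))"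
proof -
  have "out (ploop k (each c)) e = concat (map (\<lambda>g. concat (map (F (g div RR (length x)) (g mod RR
    (length x))) (rev [0..<D])))
      (rev [0..<groups x]))"
    by (rule out_ploop[OF b k]) (auto intro!: out_each c)
  then show ?thesis by (simp add: concat_points npts_def)
qed

lemma base_mono: "base x y e \<Longrightarrow> (\<forall>v<k. e' v = e v) \<Longrightarrow> 11 \<le> k
  \<Longrightarrow> base x y e'"
  by (auto simp: base_def)

lemma located_mono: "located j t i W e \<Longrightarrow> (\<forall>v<k. e' v = e v) \<Longrightarrow> j + 5
  \<le> k \<Longrightarrow> located j t i W e'"
  by (auto simp: located_def)

lemma point_index: "(\<nu> div D div R * R + \<nu> div D mod R) * D + \<nu> mod D = \<nu>"
  by simp

lemma same_point: "\<nu> div D div R = \<mu> div D div R \<and> \<nu> div D mod R = \<mu> div D mod R \<and>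
  \<nu> mod D = \<mu> mod D \<longleftrightarrow> \<nu> = \<mu>"
  by (metis div_mult_mod_eq)

lemma out_print_inst: "out print_inst (env x y) = encode_fmm (inst x)"
proof -
  let ?W = "WW (length x)" and ?R = "RR (length x)"
  let ?sd = "\<lambda>n. self_delimiting (binary n)"
  have enc_append: "encode_nats (as @ bs) = encode_nats as @ encode_nats bs" for as bs
    by (simp add: encode_nats_def)
  have enc_Cons: "encode_nats (a # as) = ?sd a @ encode_nats as" for a as
    by (simp add: encode_nats_def)
  have concat_concat: "concat (concat xss) = concat (map concat xss)" for xss :: "bool list list list"
    by (induction xss) auto
  have enc_concat: "encode_nats (concat ass) = concat (map encode_nats ass)" for ass
    by (induction ass) (auto simp: enc_append, simp add: encode_nats_def)
  have enc_map: "encode_nats (map g xs) = concat (map (\<lambda>a. ?sd (g a)) xs)" for g :: "nat \<Rightarrow> nat" and xs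
    by (simp add: encode_nats_def comp_def)
  show ?thesis
    unfolding print_inst_def
  proof (rule out_prelude)
    fix e assume b: "base x y e"
    have l: "length (e 9) = ?W" "length (e 10) = ?R" using b by (auto simp: base_def)
    have grid: "out (Rep 11 9 (Rep 12 10 (emits w))) e = concat (replicate (?W * ?R) w)" for w
    proof -
      have in1: "out (Rep 12 10 (emits w)) e' = concat (replicate ?R w)" if "length (e' 10) = ?R" for e'
        by (subst out_Rep[where f = "\<lambda>_. w"]) (use that in \<open>auto simp: map_replicate_const\<close>)
      have "out (Rep 11 9 (Rep 12 10 (emits w))) e = concat (map (\<lambda>_. concat (replicate ?R w)) (rev [0..<length (e 9)]))"
        by (rule out_Rep) (use in1 l in simp)
      moreover have "concat (replicate m (concat (replicate n w))) = concat (replicate (m * n) w)" for m n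
        by (induction m) (auto simp: replicate_add)
      ultimately show ?thesis by (simp add: l map_replicate_const)
    qed
    have cnt: "length (out (Rep 12 9 (Rep 13 10 (emits (replicate d True)))) e) = ?W * ?R * d" for d
      by (subst out_Rep[where f = "\<lambda>_. replicate (?R * d) True"])
        (use l in \<open>auto simp: units concat_map_replicate sum_list_map_const\<close>)
    \<comment> \<open>The \<open>D\<close> points of a cell are listed consecutively, so the group
      number of each cell is printed \<open>D\<close> times.\<close>
    have 3: "out (ploop 11 (Bind 16 (idx 11 17 1 0) (each (\<lambda>a. Bin 16)))) e =
        concat (map (\<lambda>\<nu>. ?sd (\<nu> div D)) (rev [0..<npts x]))"
    proof -
      have "out (ploop 11 (Bind 16 (idx 11 17 1 0) (each (\<lambda>a. Bin 16)))) e =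
          concat (map (\<lambda>g. concat (map (\<lambda>a. ?sd (g div ?R * ?R + g mod ?R)) (rev [0..<D]))) (rev [0..<?W * ?R]))"
      proof (rule out_ploop[OF b])
        fix t i e' assume "\<forall>v<11. e' v = e v" "located 11 t i ?W e'"
        then have "length (out (idx 11 17 1 0) e') = t * ?R + i"
          using out_idx[of x y e' 11 t i ?W 17 1 0] base_mono[OF b] by auto
        then show "out (Bind 16 (idx 11 17 1 0) (each (\<lambda>a. Bin 16))) e' =
            concat (map (\<lambda>a. ?sd (t * ?R + i)) (rev [0..<D]))"
          by (simp, intro out_each) simp
      qed simp
      then show ?thesis by (simp add: concat_map_product npts_def)
    qed
    have 5: "out (ploop 11 (each (\<lambda>a. ploop 17 (each (entry a))))) e =
      concat (map (\<lambda>\<nu>. concat (map (\<lambda>\<mu>. encode_nats (rat_code (dd x \<nu> \<mu>))) (rev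
        [0..<npts x]))) (rev [0..<npts x]))"
    proof -
      let ?F = "\<lambda>t i a t' i' b. encode_nats (rat_code
        (if t = t' \<and> i = i' \<and> a = b then 0 else if compat x t i a t' i' b then 2 else 1))"
      have "out (ploop 11 (each (\<lambda>a. ploop 17 (each (entry a))))) e = concat (map (\<lambda>\<nu>.
        concat (map (\<lambda>\<mu>.
          ?F (\<nu> div D div ?R) (\<nu> div D mod ?R) (\<nu> mod D) (\<mu> div D div ?R) (\<mu> div D mod ?R) (\<mu> mod D))
          (rev [0..<npts x]))) (rev [0..<npts x]))"
      proof (rule out_point_loop[OF b], simp)
        fix t i a e' assume 1: "t < ?W" "\<forall>v<11. e' v = e v" "located 11 t i ?W e'"
        have b': "base x y e'" using base_mono[OF b 1(2)] by simp
        show "out (ploop 17 (each (entry a))) e' = concat (map (\<lambda>\<mu>.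
          ?F t i a (\<mu> div D div ?R) (\<mu> div D mod ?R) (\<mu> mod D)) (rev [0..<npts x]))"
        proof (rule out_point_loop[OF b'], simp)
          fix t' i' b e'' assume 2: "t' < ?W" "\<forall>v<17. e'' v = e' v" "located 17 t' i' ?W e''"
          have "base x y e''" "located 11 t i ?W e''"
            using base_mono[OF b' 2(2)] located_mono[OF 1(3) 2(2)] by auto
          then show "out (entry a b) e'' = ?F t i a t' i' b"
            using 1(1) 2(1,3) by (simp add: entry_def holds_samec holds_compatc)
        qed
      qed
      then show ?thesis by (simp only: same_point dd_def compat_pts_def)
    qed
    show "out (seqs
     [Bind 11 (Rep 12 9 (Rep 13 10 (emits (replicate D True)))) (Bin 11),
      Bind 11 (Rep 12 9 (Rep 13 10 (emits (replicate 1 True)))) (Bin 11),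
      ploop 11 (Bind 16 (idx 11 17 1 0) (each (\<lambda>a. Bin 16))),
      Rep 11 9 (Rep 12 10 (emits (encode_nats [1]))),
      ploop 11 (each (\<lambda>a. ploop 17 (each (entry a))))]) e = encode_fmm (inst x)"
    proof -
      have rep1: "encode_nats (replicate m 1) = concat (replicate m (encode_nats [1]))" for m
        by (simp add: encode_nats_def)
      have "encode_fmm (inst x) = ?sd (npts x) @ ?sd (?W * ?R) @
        concat (map (\<lambda>\<nu>. ?sd (\<nu> div D)) (rev [0..<npts x])) @ concat (replicate (?W * ?R) (encode_nats [1])) @
        concat (map (\<lambda>\<nu>. concat (map (\<lambda>\<mu>. encode_nats (rat_code (dd x \<nu> \<mu>)))
          (rev [0..<npts x]))) (rev [0..<npts x]))"
        by (simp add: encode_fmm_def inst_def num_groups_def enc_Cons enc_append enc_concat enc_map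
            rep1[simplified] map_concat concat_concat comp_def)
      then show ?thesis using cnt[of D] cnt[of 1] 3 5 grid[of "encode_nats [1]"]
        by (simp add: npts_def)
    qed
  qed
qed

lemma out_print_clashes:
  "out print_clashes (env x y) = [] \<longleftrightarrow> (\<forall>\<nu><npts x. \<forall>\<mu><npts x.
     \<nu> < length y \<longrightarrow> y ! \<nu> \<longrightarrow> \<mu> < length y \<longrightarrow> y !
       \<mu> \<longrightarrow> \<nu> \<noteq> \<mu> \<longrightarrow> compat_pts x \<nu> \<mu>)"
proof -
  let ?W = "WW (length x)" and ?R = "RR (length x)"
  let ?sel = "\<lambda>\<nu>. \<nu> < length y \<and> y ! \<nu>"
  let ?n = "\<lambda>t i a. (t * ?R + i) * D + a"
  let ?G = "\<lambda>t i a t' i' b. if ?sel (?n t' i' b) \<and> \<not> (t = t' \<and> i = i' \<and> a = b)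
    \<and> \<not> compat x t i a t' i' b then [True] else []"
  let ?F = "\<lambda>t i a. if ?sel (?n t i a) then concat (map (\<lambda>\<mu>.
     ?G t i a (\<mu> div D div ?R) (\<mu> div D mod ?R) (\<mu> mod D)) (rev [0..<npts x])) else []"
  have "out print_clashes (env x y) = concat (map (\<lambda>\<nu>.
     ?F (\<nu> div D div ?R) (\<nu> div D mod ?R) (\<nu> mod D)) (rev [0..<npts x]))"
    unfolding print_clashes_def
  proof (rule out_prelude)
    fix e assume b: "base x y e"
    show "out (ploop 11 (each (\<lambda>a. Bind 16 (idx 11 17 D a) (ite (At 16 1) (ploop 17 (each (clash a))) Quiet)))) e =
      concat (map (\<lambda>\<nu>. ?F (\<nu> div D div ?R) (\<nu> div D mod ?R) (\<nu> mod D)) (rev [0..<npts x]))"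
    proof (rule out_point_loop[OF b], simp)
      fix t i a e' assume 1: "t < ?W" "\<forall>v<11. e' v = e v" "located 11 t i ?W e'"
      let ?e = "e'(16 := rev (out (idx 11 17 D a) e'))"
      have b': "base x y e'" using base_mono[OF b 1(2)] by simp
      then have be: "base x y ?e" by (simp add: base_def)
      have le: "located 11 t i ?W ?e" using 1(3) by (simp add: located_def)
      have n: "length (?e 16) = ?n t i a"
        using out_idx[OF b' 1(3), of 17 D a] by simp
      have y: "?e 1 = y" using be by (simp add: base_def)
      have "out (ploop 17 (each (clash a))) ?e = concat (map (\<lambda>\<mu>.
          ?G t i a (\<mu> div D div ?R) (\<mu> div D mod ?R) (\<mu> mod D)) (rev [0..<npts x]))"
      proof (rule out_point_loop[OF be], simp)
        fix t' i' b e'' assume 2: "t' < ?W" "\<forall>v<17. e'' v = ?e v" "located 17 t' i' ?W e''"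
        let ?e' = "e''(22 := rev (out (idx 17 23 D b) e''))"
        have b'': "base x y e''" and l'': "located 11 t i ?W e''"
          using base_mono[OF be 2(2)] located_mono[OF le 2(2)] by auto
        have c: "base x y ?e'" "located 11 t i ?W ?e'" "located 17 t' i' ?W ?e'"
          using b'' l'' 2(3) by (auto simp: base_def located_def)
        have n': "length (?e' 22) = ?n t' i' b" "?e' 1 = y"
          using out_idx[OF b'' 2(3), of 23 D b] c(1) by (auto simp: base_def)
        show "out (clash a b) e'' = ?G t i a t' i' b"
          unfolding clash_def out.simps(6) out_ite holds_conjs
          using n' holds_samec[OF c(2,3)] holds_compatc[OF c 1(1) 2(1)] by auto
      qed
      then show "out (Bind 16 (idx 11 17 D a) (ite (At 16 1) (ploop 17 (each (clash a))) Quiet)) e' = ?F t i a"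
        unfolding out.simps(6) out_ite holds.simps n y by simp
    qed
  qed
  then show ?thesis
    by (simp only: point_index same_point compat_pts_def[symmetric])
      (auto simp: concat_map_Nil Ball_def simp del: concat_eq_Nil_conv split: if_splits)
qed

section \<open>Scoping of variables in the two programs\<close>

lemma wf_each [simp]: "wf_lp B (each c) A d \<longleftrightarrow> (\<forall>a<D. wf_lp B (c a) A d)"
  by (auto simp: each_def)

abbreviation B0 :: nat where "B0 \<equiv> 25 + length (coeffs f) + length (coeffs q)"

lemma cvars_here:
  assumes "{0, 6, 7, 8, 9, 11, 12, 13, 14, 15, 17, 18, 19, 20, 21} \<subseteq> A"
  shows "cvars (compatc 11 17 a b) \<subseteq> A" "cvars (samec 11 17 a b) \<subseteq> A"
proof -
  have "cvars (compatc 11 17 a b) \<subseteq> {0, 6, 7, 8, 9, 11, 12, 13, 14, 15, 17, 18, 19, 20, 21}"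
    by (rule order_trans[OF cvars_compatc]) simp
  then show "cvars (compatc 11 17 a b) \<subseteq> A" using assms by (rule order_trans)
  have "cvars (samec 11 17 a b) \<subseteq> {0, 6, 7, 8, 9, 11, 12, 13, 14, 15, 17, 18, 19, 20, 21}"
    by (rule order_trans[OF cvars_samec]) simp
  then show "cvars (samec 11 17 a b) \<subseteq> A" using assms by (rule order_trans)
qed

lemma wf_entry:
  assumes "{0, 6, 7, 8, 9, 11, 12, 13, 14, 15, 17, 18, 19, 20, 21} \<subseteq> A"
  shows "wf_lp B (entry a b) A d"
  unfolding entry_def by (intro wf_ite cvars_here assms wf_emits)

lemma wf_clash:
  assumes "{0, 6, 7, 8, 9, 11, 12, 13, 14, 15, 17, 18, 19, 20, 21} \<subseteq> A" "{1, 10} \<subseteq> A" "25 \<le> B"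
  shows "wf_lp B (clash a b) A 22"
proof -
  have "wf_lp B (idx 17 23 D b) A 23"
    using assms by (intro wf_idx) auto
  moreover have "cvars (conjs [At 22 1, Neg (samec 11 17 a b), Neg (compatc 11 17 a b)]) \<subseteq> insert 22 A"
    using cvars_here[OF assms(1), of a b] assms(2) by auto
  ultimately show ?thesis
    using assms(3) by (auto simp: clash_def intro!: wf_ite)
qed

lemma wf_print_inst: "wf_lp B0 print_inst {0} 6"
  unfolding print_inst_def
  by (intro wf_prelude) (auto intro!: wf_ploop wf_idx wf_entry)

lemma wf_print_clashes: "wf_lp B0 print_clashes {0, 1} 6"
  unfolding print_clashes_def
  by (intro wf_prelude) (auto intro!: wf_ploop wf_idx wf_clash wf_ite)

section \<open>Metric, optimum and tableaux of the instance\<close>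

lemma D_pos: "0 < D"
proof -
  have "(0, replicate (num_tapes N) 0, replicate (num_tapes N) 0) \<in> cells N"
    using wf_N by (auto simp: cells_def wf_tm_def)
  then show ?thesis using set_vals by (auto simp: D_def)
qed

text \<open>Unary constraints are enforced only through pairs; a second column gives every cell a
  partner with which its own constraint is tested.\<close>

lemma RR_ge: "2 \<le> RR n"
  by (auto simp: RR_def WW_def)

lemma points_inst: "points (inst x) = {..<npts x}"
  by (simp add: points_def inst_def)

lemma num_groups_inst: "num_groups (inst x) = groups x"
  by (simp add: num_groups_def inst_def)

lemma demand_inst: "i < groups x \<Longrightarrow> demand (inst x) ! i = 1"
  by (simp add: inst_def)

lemma members_inst: "members (inst x) g = {u. u < npts x \<and> (npts x - 1 - u) div D = g}"
  by (auto simp: members_def points_inst) (auto simp: inst_def rev_nth)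

lemma distance_inst:
  "u < npts x \<Longrightarrow> v < npts x \<Longrightarrow> distance (inst x) u v = real_of_rat (dd x (npts x
    - 1 - u) (npts x - 1 - v))"
  by (auto simp: distance_def points_inst) (simp add: inst_def rev_nth)

lemma rev_bij: "u < n \<Longrightarrow> v < n \<Longrightarrow> n - 1 - u = n - 1 - v \<longleftrightarrow> u = v" for n :: nat
  by arith

lemma group_less: "\<nu> < npts x \<Longrightarrow> \<nu> div D < groups x"
  by (auto simp: npts_def intro: less_mult_imp_div_less)

lemma point_less: "g < groups x \<Longrightarrow> a < D \<Longrightarrow> g * D + a < npts x"
proof -
  assume a: "g < groups x" "a < D"
  then have "g * D + a < Suc g * D" by simp
  also have "\<dots> \<le> groups x * D" using a by (intro mult_right_mono) auto
  finally show ?thesis by (simp add: npts_def)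
qed

lemma compat_pts_sym: "compat_pts x \<nu> \<mu> \<longleftrightarrow> compat_pts x \<mu> \<nu>"
  by (auto simp: compat_pts_def compat_def)

text \<open>Distances between distinct points are 1 or 2, and 2 does not exceed 1 + 1, so the
  triangle inequality holds whatever the constraints are.\<close>

lemma Metric_inst: "Metric_space (points (inst x)) (distance (inst x))"
proof
  fix u v w
  have d: "distance (inst x) u v = (if u < npts x \<and> v < npts x then if u = v then 0
      else if compat_pts x (npts x - 1 - u) (npts x - 1 - v) then 2 else 1 else 0)" for u v
    using rev_bij[of u "npts x" v]
    by (auto simp: distance_inst dd_def) (auto simp: distance_def points_inst)
  show "0 \<le> distance (inst x) u v" by (simp add: d)
  show "distance (inst x) u v = distance (inst x) v u" using compat_pts_sym by (auto simp: d)
  assume p: "u \<in> points (inst x)" "v \<in> points (inst x)"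
  show "distance (inst x) u v = 0 \<longleftrightarrow> u = v"
    using p by (auto simp: d points_inst)
  assume "w \<in> points (inst x)"
  then show "distance (inst x) u w \<le> distance (inst x) u v + distance (inst x) v w"
    using p by (auto simp: d points_inst)
qed

lemma group_member:
  assumes "g < groups x" "a < D"
  shows "npts x - 1 - (g * D + a) \<in> members (inst x) g"
  using point_less[OF assms] assms by (auto simp: members_inst)

lemma valid_inst: "valid (inst x)"
  unfolding valid_def
proof (intro conjI ballI allI impI)
  show "length (dist_matrix (inst x)) = length (group_of (inst x))" by (simp add: inst_def)
  show "length r = length (group_of (inst x))" if "r \<in> set (dist_matrix (inst x))" for r
    using that by (auto simp: inst_def)
  show "Metric_space (points (inst x)) (distance (inst x))" by (rule Metric_inst)
  show "g < num_groups (inst x)" if "g \<in> set (group_of (inst x))" for g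
    using that group_less by (auto simp: inst_def num_groups_inst num_groups_def)
  fix i assume "i < num_groups (inst x)"
  then have i: "i < groups x" by (simp add: num_groups_inst)
  show "members (inst x) i \<noteq> {}" using group_member[OF i D_pos] by auto
  moreover have "finite (members (inst x) i)" by (simp add: members_inst)
  ultimately show "demand (inst x) ! i \<le> card (members (inst x) i)"
    using i by (simp add: demand_inst Suc_le_eq card_gt_0_iff)
qed

lemma opt_inst:
  assumes A: "tableau N x (ee (length x)) (TT (length x)) (WW (length x)) (RR (length x)) A"
  shows "2 \<le> opt_diversity (inst x)"
proof -
  let ?R = "RR (length x)" and ?n = "npts x"
  have cell: "A t i \<in> set vals" if "t < WW (length x)" "i < ?R" for t i
    using A that unfolding tableau_def WW_def set_vals by (meson less_Suc_eq_le)
  \<comment> \<open>The index in \<open>vals\<close> of the value that the tableau assigns to cell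
    number \<open>g\<close>; the list may contain repetitions, so one index is chosen.\<close>
  define \<alpha> where "\<alpha> g = (SOME a. a < D \<and> vals ! a = A (g div ?R) (g mod ?R))" for g
  have div_less: "g div ?R < WW (length x)" "g mod ?R < ?R" if "g < groups x" for g
    using that RR_ge[of "length x"] by (auto intro: less_mult_imp_div_less)
  have \<alpha>: "\<alpha> g < D" "vals ! \<alpha> g = A (g div ?R) (g mod ?R)" if "g < groups x" for g
  proof -
    have "\<exists>a. a < D \<and> vals ! a = A (g div ?R) (g mod ?R)"
      using cell[OF div_less[OF that]] by (auto simp: in_set_conv_nth D_def)
    from someI_ex[OF this] show "\<alpha> g < D" "vals ! \<alpha> g = A (g div ?R) (g mod ?R)"
      by (auto simp: \<alpha>_def)
  qed
  define S where "S = {u. u < ?n \<and> (?n - 1 - u) mod D = \<alpha> ((?n - 1 - u) div D)}"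
  have compat: "compat_pts x \<nu> \<mu>"
    if "\<nu> < ?n" "\<mu> < ?n" "\<nu> mod D = \<alpha> (\<nu> div D)" "\<mu> mod D = \<alpha> (\<mu> div D)" for \<nu> \<mu>
  proof -
    note g = group_less[OF that(1)] group_less[OF that(2)]
    have "\<nu> div D div ?R \<le> TT (length x)" "\<mu> div D div ?R \<le> TT (length x)"
      "\<nu> div D mod ?R < ?R" "\<mu> div D mod ?R < ?R"
      using div_less[OF g(1)] div_less[OF g(2)] by (auto simp: WW_def)
    then show ?thesis
      using A \<alpha>[OF g(1)] \<alpha>[OF g(2)] that(3,4) by (simp add: compat_pts_def compat_def tableau_def)
  qed
  have "card (S \<inter> members (inst x) g) = 1" if g: "g < groups x" for g
  proof -
    have "S \<inter> members (inst x) g = {?n - 1 - (g * D + \<alpha> g)}"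
    proof (intro equalityI subsetI)
      fix u assume "u \<in> S \<inter> members (inst x) g"
      then have u: "u < ?n" "(?n - 1 - u) div D = g" "(?n - 1 - u) mod D = \<alpha> g"
        by (auto simp: S_def members_inst)
      then have "?n - 1 - u = g * D + \<alpha> g" by (metis div_mult_mod_eq)
      then show "u \<in> {?n - 1 - (g * D + \<alpha> g)}" using u(1) by simp
    next
      fix u assume "u \<in> {?n - 1 - (g * D + \<alpha> g)}"
      then show "u \<in> S \<inter> members (inst x) g"
        using group_member[OF g \<alpha>(1)[OF g]] point_less[OF g \<alpha>(1)[OF g]] \<alpha>(1)[OF g]
        by (auto simp: S_def)
    qed
    then show ?thesis by simp
  qed
  then have "feasible (inst x) S"
    by (auto simp: feasible_def points_inst num_groups_inst demand_inst S_def)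
  moreover have "2 \<le> diversity (inst x) S"
    unfolding diversity_def
  proof (rule INF_greatest, clarify)
    fix u v assume uv: "u \<in> S" "v \<in> S" "u \<noteq> v"
    then have "dd x (?n - 1 - u) (?n - 1 - v) = 2"
      using compat[of "?n - 1 - u" "?n - 1 - v"] rev_bij[of u ?n v] by (auto simp: S_def dd_def)
    then show "2 \<le> ereal (distance (inst x) u v)"
      using uv by (simp add: distance_inst S_def)
  qed
  moreover have "finite {S. feasible (inst x) S}"
    by (rule finite_subset[of _ "Pow {..<?n}"]) (auto simp: feasible_def points_inst)
  ultimately show ?thesis
    unfolding opt_diversity_def by (intro order_trans[OF _ Max_ge]) auto
qed

text \<open>A group may have several selected points, and two of them may even be compatible, since
  \<open>link\<close> within one cell compares only state and read symbols. Any choice of one point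
  per group works: points of different cells are distinct, so all constraints between them
  hold.\<close>

lemma tableau_of_selection:
  assumes sel: "\<And>g. g < groups x \<Longrightarrow> \<exists>\<nu><npts x. Q \<nu> \<and> \<nu> div D = g"
    and compat: "\<And>\<nu> \<mu>. \<nu> < npts x \<Longrightarrow> \<mu> < npts x \<Longrightarrow> Q \<nu>
      \<Longrightarrow> Q \<mu> \<Longrightarrow> \<nu> \<noteq> \<mu> \<Longrightarrow> compat_pts x \<nu> \<mu>"
  shows "\<exists>A. tableau N x (ee (length x)) (TT (length x)) (WW (length x)) (RR (length x)) A"
proof -
  let ?R = "RR (length x)" and ?W = "WW (length x)"
  obtain s where s: "s g < npts x" "Q (s g)" "s g div D = g" if "g < groups x" for g
    using sel by metis
  define A where "A t i = vals ! (s (t * ?R + i) mod D)" for t i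
  have gl: "t * ?R + i < groups x" if "t \<le> TT (length x)" "i < ?R" for t i
  proof -
    have "t * ?R + i < Suc t * ?R" using that by simp
    also have "\<dots> \<le> groups x" using that by (intro mult_right_mono) (auto simp: WW_def)
    finally show ?thesis .
  qed
  have dec: "(t * ?R + i) div ?R = t" "(t * ?R + i) mod ?R = i" if "i < ?R" for t i
    using that by auto
  have pair: "ok x t i (A t i) \<and> link N ?W t i (A t i) t' i' (A t' i')"
    if "t \<le> TT (length x)" "i < ?R" "t' \<le> TT (length x)" "i' < ?R" "(t, i) \<noteq> (t', i')" for t i t' i'
  proof -
    let ?g = "t * ?R + i" and ?h = "t' * ?R + i'"
    have ne: "?g \<noteq> ?h" using that(5) dec[OF that(2), of t] dec[OF that(4), of t'] by metis
    have "s ?g \<noteq> s ?h" using s(3)[OF gl[OF that(1,2)]] s(3)[OF gl[OF that(3,4)]] ne by metis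
    then have "compat_pts x (s ?g) (s ?h)"
      using s gl[OF that(1,2)] gl[OF that(3,4)] by (intro compat) auto
    then show ?thesis
      unfolding compat_pts_def compat_def s(3)[OF gl[OF that(1,2)]] s(3)[OF gl[OF that(3,4)]]
        dec[OF that(2)] dec[OF that(4)] A_def by blast
  qed
  have "A t i \<in> cells N" for t i
    using D_pos set_vals nth_mem[of "s (t * ?R + i) mod D" vals] by (auto simp: A_def D_def)
  moreover have "ok x t i (A t i)" if "t \<le> TT (length x)" "i < ?R" for t i
  proof -
    obtain i' where "i' < ?R" "i' \<noteq> i"
      using RR_ge[of "length x"] by (cases "i = 0") (auto intro: that[of 0] that[of 1])
    then show ?thesis using pair[of t i t i'] that by blast
  qed
  moreover have "link N ?W t i (A t i) t' i' (A t' i')"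
    if "t \<le> TT (length x)" "i < ?R" "t' \<le> TT (length x)" "i' < ?R" for t i t' i'
  proof (cases "(t, i) = (t', i')")
    \<comment> \<open>A cell is always linked to itself: the condition for equal rows is trivial and
      the one for consecutive rows does not apply.\<close>
    case True
    then show ?thesis by (auto simp: link_def split: prod.splits)
  qed (use pair that in blast)
  ultimately have "tableau N x (ee (length x)) (TT (length x)) ?W ?R A" by (simp add: tableau_def)
  then show ?thesis by blast
qed

lemma tableau_iff_no_clash:
  assumes \<alpha>: "1 \<le> \<alpha>" "\<alpha> < 2" and \<beta>: "0 < \<beta>"
    and S: "S \<subseteq> points (inst x)" "opt_diversity (inst x) / ereal \<alpha> \<le> diversity (inst x) S"
      "\<forall>i<num_groups (inst x). \<beta> * real (demand (inst x) ! i) \<le> real (card (S \<inter> members (inst x) i))"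
  shows "(\<exists>A. tableau N x (ee (length x)) (TT (length x)) (WW (length x)) (RR (length x)) A)
    \<longleftrightarrow> out print_clashes (env x (rev (encode_subset (inst x) S))) = []"
proof -
  let ?n = "npts x"
  let ?y = "rev (encode_subset (inst x) S)"
  have len: "length ?y = ?n" by (simp add: encode_subset_def inst_def)
  have nth: "?y ! \<nu> \<longleftrightarrow> ?n - 1 - \<nu> \<in> S" if "\<nu> < ?n" for \<nu>
    using that by (simp add: encode_subset_def inst_def rev_nth)
  have nc: "out print_clashes (env x ?y) = [] \<longleftrightarrow>
    (\<forall>\<nu><?n. \<forall>\<mu><?n. ?n - 1 - \<nu> \<in> S \<longrightarrow> ?n - 1 - \<mu> \<in> S
      \<longrightarrow> \<nu> \<noteq> \<mu> \<longrightarrow> compat_pts x \<nu> \<mu>)"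
    unfolding out_print_clashes len using nth by blast
  show ?thesis
  proof
    assume "\<exists>A. tableau N x (ee (length x)) (TT (length x)) (WW (length x)) (RR (length x)) A"
    then have opt: "2 \<le> opt_diversity (inst x)" using opt_inst by blast
    \<comment> \<open>Here \<alpha> < 2 enters: the guaranteed diversity exceeds 1, which is the
      smaller of the two distances.\<close>
    have "ereal 1 < ereal (2 / \<alpha>)" using \<alpha> by simp
    also have "ereal (2 / \<alpha>) = 2 / ereal \<alpha>" using \<alpha> by simp
    also have "\<dots> \<le> opt_diversity (inst x) / ereal \<alpha>"
      using opt \<alpha> by (intro ereal_divide_right_mono) auto
    finally have div: "1 < diversity (inst x) S" using S(2) by (simp add: one_ereal_def)
    show "out print_clashes (env x ?y) = []"
      unfolding nc
    proof (intro allI impI)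
      fix \<nu> \<mu> assume a: "\<nu> < ?n" "\<mu> < ?n" "?n - 1 - \<nu> \<in> S" "?n - 1 - \<mu> \<in> S" "\<nu> \<noteq> \<mu>"
      have "?n - 1 - \<nu> \<noteq> ?n - 1 - \<mu>" using a(5) rev_bij[OF a(1,2)] by simp
      then have "diversity (inst x) S \<le> ereal (distance (inst x) (?n - 1 - \<nu>) (?n - 1 - \<mu>))"
        using a unfolding diversity_def by (intro INF_lower2[of "(?n - 1 - \<nu>, ?n - 1 - \<mu>)"]) auto
      then have "1 < distance (inst x) (?n - 1 - \<nu>) (?n - 1 - \<mu>)"
        using div by (metis less_le_trans one_ereal_def ereal_less(3) less_ereal.simps(1))
      then have "1 < real_of_rat (dd x \<nu> \<mu>)" using a by (simp add: distance_inst)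
      then show "compat_pts x \<nu> \<mu>" by (auto simp: dd_def split: if_splits)
    qed
  next
    assume "out print_clashes (env x ?y) = []"
    then have c: "\<And>\<nu> \<mu>. \<nu> < ?n \<Longrightarrow> \<mu> < ?n \<Longrightarrow> ?n - 1 - \<nu>
      \<in> S \<Longrightarrow> ?n - 1 - \<mu> \<in> S \<Longrightarrow> \<nu> \<noteq> \<mu> \<Longrightarrow>
      compat_pts x \<nu> \<mu>"
      unfolding nc by blast
    show "\<exists>A. tableau N x (ee (length x)) (TT (length x)) (WW (length x)) (RR (length x)) A"
    proof (rule tableau_of_selection)
      fix g assume g: "g < groups x"
      then have "\<beta> \<le> real (card (S \<inter> members (inst x) g))"
        using S(3) by (auto simp: num_groups_inst demand_inst)
      \<comment> \<open>Every demand is 1, so the fairness guarantee bounds the cardinality from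
        below by \<beta>, and any positive \<beta> rules out an empty intersection.\<close>
      then have "S \<inter> members (inst x) g \<noteq> {}" using \<beta> by auto
      then obtain u where "u \<in> S" "u < ?n" "(?n - 1 - u) div D = g" by (auto simp: members_inst)
      then show "\<exists>\<nu><?n. ?n - 1 - \<nu> \<in> S \<and> \<nu> div D = g"
        by (intro exI[of _ "?n - 1 - u"]) auto
    qed (use c in blast)
  qed
qed

text \<open>Supplies the length bound on answers that the pipeline asks for. Every encoded number
  takes at least one symbol, and the encoding lists one group number per point.\<close>

lemma length_encode_inst: "length (encode_subset (inst x) S) \<le> length (encode_fmm (inst x))"
proof -
  have "length ns \<le> length (encode_nats ns)" for ns
    by (induction ns) (auto simp: encode_nats_def length_self_delimiting)
  from order_trans[OF _ this] show ?thesis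
    unfolding encode_fmm_def by (simp add: encode_subset_def)
qed

end

section \<open>Deciding NP with an approximation algorithm\<close>

lemma NP_subset_P:
  assumes \<alpha>: "1 \<le> \<alpha>" "\<alpha> < 2" and \<beta>: "0 < \<beta>" and M: "poly_time_fair_approx \<alpha> \<beta> M"
  shows "class_NP \<subseteq> class_P"
proof
  fix L assume "L \<in> class_NP"
  then obtain V f where V: "V \<in> class_P"
    and L: "\<And>x. x \<in> L \<longleftrightarrow> (\<exists>v. length v = poly f (length x) \<and> x @ v \<in> V)"
    by (rule class_NP_padded) blast
  obtain N q where N: "wf_tm N" "\<And>z. computes_within N z [z \<in> V] (poly q (length z))"
    using V unfolding class_P_def by blast
  obtain vals where "set vals = cells N" using finite_list[OF finite_cells] by blast
  then interpret reduction N f q vals using N(1) by unfold_locales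
  obtain p where wfM: "wf_tm M" and p: "\<And>I. valid I \<Longrightarrow> \<exists>S. S \<subseteq> points I \<and>
      computes_within M (encode_fmm I) (encode_subset I S) (poly p (length (encode_fmm I))) \<and>
      diversity I S \<ge> opt_diversity I / ereal \<alpha> \<and>
      (\<forall>i<num_groups I. real (card (S \<inter> members I i)) \<ge> \<beta> * real (demand I ! i))"
    using M unfolding poly_time_fair_approx_def by blast
  show "L \<in> class_P"
  \<comment> \<open>The linear summand accounts for the length of the answer, which the time bound
    \<open>p\<close> need not cover.\<close>
  proof (rule class_P_pipeline[OF wf_print_inst wf_print_clashes wfM, where p = "p + [:0, 1:]"])
    fix x
    obtain S where S: "S \<subseteq> points (inst x)"
      "computes_within M (encode_fmm (inst x)) (encode_subset (inst x) S) (poly p (length (encode_fmm (inst x))))"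
      "opt_diversity (inst x) / ereal \<alpha> \<le> diversity (inst x) S"
      "\<forall>i<num_groups (inst x). \<beta> * real (demand (inst x) ! i) \<le> real (card (S \<inter> members (inst x) i))"
      using p[OF valid_inst] by blast
    have "x \<in> L \<longleftrightarrow> out print_clashes (env x (rev (encode_subset (inst x) S))) = []"
      unfolding tableau_iff_no_clash[OF \<alpha> \<beta> S(1,3,4), symmetric]
      by (rule tableau_iff[OF N L]) (auto simp: ee_def TT_def WW_def RR_def)
    moreover have "computes_within M (encode_fmm (inst x)) (encode_subset (inst x) S)
        (poly (p + [:0, 1:]) (length (encode_fmm (inst x))))"
      by (rule computes_within_mono[OF S(2)]) simp
    moreover have "length (encode_subset (inst x) S) \<le> poly (p + [:0, 1:]) (length (encode_fmm (inst x)))"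
      using length_encode_inst[of x S] by simp
    ultimately show "\<exists>w. computes_within M (out print_inst (env x [])) w (poly (p + [:0, 1:]) (length
      (out print_inst (env x [])))) \<and>
      length w \<le> poly (p + [:0, 1:]) (length (out print_inst (env x []))) \<and>
      (x \<in> L \<longleftrightarrow> out print_clashes (env x (rev w)) = [])"
      unfolding out_print_inst by blast
  qed
qed

theorem theorem3:
  fixes \<alpha> \<beta> :: real
  assumes "1 \<le> \<alpha>" and "\<alpha> < 2" and "\<beta> > 0"
    and "class_P \<noteq> class_NP"
  shows "\<not> (\<exists>M. poly_time_fair_approx \<alpha> \<beta> M)"
  using assms NP_subset_P P_subset_NP by blast

end
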